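(* Let $p\ge 1$ be an integer. There exists a constant $c_p>0$, depending only on $p$, such that for every $F$ in the $p$-th Wiener chaos $\mathcal{W}_p$ with $\mathbb{E}[F^2]=1$, $$ c_p\operatorname{Var}\Gamma(F,F)\le d_{\mathrm{TV}}(\mathbf{P}_F,\boldsymbol{\gamma}_{F,1}), $$ where $\mathbf{P}_F$ is the law of $F$ and $\boldsymbol{\gamma}_{F,1}$ is the signed measure on $\mathbb{R}$ with Lebesgue density $x\mapsto \frac{e^{-x^2/2}}{\sqrt{2\pi}}\left(1+\frac{\mathbb{E}[H_3(F)]}{3!}H_3(x)\right)$.
   Context: Let $\gamma$ be the standard Gaussian measure on $\mathbb{R}$ and $(\Omega,\mathscr{F},\mathbf{P})=(\mathbb{R},\mathscr{B}(\mathbb{R}),\gamma)^{\mathbb{N}}$ with coordinate functions $N_i$ (i.i.d. standard Gaussian). Hermite polynomials: $H_k(x)=(-1)^k e^{x^2/2}\frac{d^k}{dx^k}e^{-x^2/2}$. The $p$-th Wiener chaos $\mathcal{W}_p$ is the $L^2(\mathbf{P})$-closure of the linear span of the products $\prod_{i\ge0}H_{k_i}(N_i)$ with $\sum_i k_i=p$; $L^2(\mathbf{P})=\bigoplus_{q\ge0}\mathcal{W}_q$, and $J_q$ is the orthogonal projection onto $\mathcal{W}_q$. The carr\'e-du-champ operator is $\Gamma(\phi,\psi)=\sum_k\partial_{x_k}\phi\,\partial_{x_k}\psi$ for $C^2$ functions $\phi,\psi$ of finitely many coordinates whose derivatives up to order 2 have polynomial growth, extended by closability to $\{H\in L^2(\mathbf{P}):\sum_q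 q\|J_q(H)\|_2^2<\infty\}$. For finite signed measures $\mu,\nu$ on $\mathbb{R}$, $d_{\mathrm{TV}}(\mu,\nu)=\frac12\sup\{|\int h\,d\mu-\int h\,d\nu| : h:\mathbb{R}\to\mathbb{R}\text{ continuous},\ \|h\|_\infty\le1\}$. *)

theory Defs
  imports "HOL-Probability.Probability"
begin

text \<open>Random variables are functions on \<open>nat \<Rightarrow> real\<close>, not equivalence classes; elements of
  \<open>L\<^sup>2\<close> and \<open>L\<^sup>1\<close> are determined only up to almost-sure equality. The coordinate variable \<open>N\<^sub>i\<close>
  is \<open>\<lambda>w. w i\<close>.\<close>

definition gaussian :: "real measure" where
  "gaussian = density lborel (\<lambda>x. ennreal (std_normal_density x))"

definition wiener :: "(nat \<Rightarrow> real) measure" where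
  "wiener = PiM UNIV (\<lambda>_. gaussian)"

abbreviation expect :: "((nat \<Rightarrow> real) \<Rightarrow> real) \<Rightarrow> real" where
  "expect \<equiv> prob_space.expectation wiener"

abbreviation var :: "((nat \<Rightarrow> real) \<Rightarrow> real) \<Rightarrow> real" where
  "var \<equiv> prob_space.variance wiener"

definition square_integrable :: "((nat \<Rightarrow> real) \<Rightarrow> real) set" where
  "square_integrable =
     {F. F \<in> borel_measurable wiener \<and> integrable wiener (\<lambda>w. (F w)\<^sup>2)}"

definition L2_tendsto ::
  "(nat \<Rightarrow> (nat \<Rightarrow> real) \<Rightarrow> real) \<Rightarrow> ((nat \<Rightarrow> real) \<Rightarrow> real) \<Rightarrow> bool" where
  "L2_tendsto f F \<longleftrightarrow>
     F \<in> square_integrable \<and> (\<forall>n. f n \<in> square_integrable) \<and>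
     (\<lambda>n. expect (\<lambda>w. (f n w - F w)\<^sup>2)) \<longlonglongrightarrow> 0"


section \<open>Hermite polynomials and Wiener chaos\<close>

definition hermite :: "nat \<Rightarrow> real \<Rightarrow> real" where
  "hermite k x = (-1) ^ k * exp (x\<^sup>2 / 2) * (deriv ^^ k) (\<lambda>t. exp (- t\<^sup>2 / 2)) x"

definition multi_indices :: "nat \<Rightarrow> (nat \<Rightarrow> nat) set" where
  "multi_indices p = {k. finite {i. k i \<noteq> 0} \<and> (\<Sum>i | k i \<noteq> 0. k i) = p}"

text \<open>The product over all coordinates reduces to the finite support of \<open>k\<close>, as \<open>H\<^sub>0 = 1\<close>.\<close>

definition hermite_prod :: "(nat \<Rightarrow> nat) \<Rightarrow> (nat \<Rightarrow> real) \<Rightarrow> real" where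
  "hermite_prod k w = (\<Prod>i | k i \<noteq> 0. hermite (k i) (w i))"

definition hermite_span :: "nat \<Rightarrow> ((nat \<Rightarrow> real) \<Rightarrow> real) set" where
  "hermite_span p =
     {(\<lambda>w. \<Sum>k\<in>A. c k * hermite_prod k w) | A c. finite A \<and> A \<subseteq> multi_indices p}"

definition chaos :: "nat \<Rightarrow> ((nat \<Rightarrow> real) \<Rightarrow> real) set" where
  "chaos p = {F. \<exists>f. (\<forall>n. f n \<in> hermite_span p) \<and> L2_tendsto f F}"

definition chaos_proj :: "nat \<Rightarrow> ((nat \<Rightarrow> real) \<Rightarrow> real) \<Rightarrow> (nat \<Rightarrow> real) \<Rightarrow> real" where
  "chaos_proj q F =
     (SOME G. G \<in> chaos q \<and> (\<forall>K\<in>chaos q. expect (\<lambda>w. (F w - G w) * K w) = 0))"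


section \<open>The carre-du-champ operator\<close>

definition partial :: "nat \<Rightarrow> ((nat \<Rightarrow> real) \<Rightarrow> real) \<Rightarrow> (nat \<Rightarrow> real) \<Rightarrow> real" where
  "partial k \<phi> w = deriv (\<lambda>t. \<phi> (w(k := t))) (w k)"

text \<open>For functions of finitely many coordinates, continuity for the product topology on
  \<open>nat \<Rightarrow> real\<close> is ordinary joint continuity in these coordinates.\<close>

definition C1_fun :: "((nat \<Rightarrow> real) \<Rightarrow> real) \<Rightarrow> bool" where
  "C1_fun \<phi> \<longleftrightarrow> continuous_on UNIV \<phi> \<and>
     (\<forall>k. (\<forall>w. (\<lambda>t. \<phi> (w(k := t))) differentiable (at (w k))) \<and>
          continuous_on UNIV (partial k \<phi>))"

definition poly_growth :: "nat \<Rightarrow> ((nat \<Rightarrow> real) \<Rightarrow> real) \<Rightarrow> bool" where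
  "poly_growth n \<phi> \<longleftrightarrow> (\<exists>C m. \<forall>w. \<bar>\<phi> w\<bar> \<le> C * (1 + (\<Sum>i<n. \<bar>w i\<bar>)) ^ m)"

definition smooth_cylinder :: "((nat \<Rightarrow> real) \<Rightarrow> real) set" where
  "smooth_cylinder =
     {\<phi>. \<exists>n. (\<forall>w w'. (\<forall>i<n. w i = w' i) \<longrightarrow> \<phi> w = \<phi> w') \<and>
             C1_fun \<phi> \<and> (\<forall>k. C1_fun (partial k \<phi>)) \<and>
             poly_growth n \<phi> \<and> (\<forall>k. poly_growth n (partial k \<phi>)) \<and>
             (\<forall>k l. poly_growth n (partial l (partial k \<phi>)))}"

text \<open>On \<open>smooth_cylinder\<close> all but finitely many terms of this series vanish.\<close>

definition gamma_smooth ::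
  "((nat \<Rightarrow> real) \<Rightarrow> real) \<Rightarrow> ((nat \<Rightarrow> real) \<Rightarrow> real) \<Rightarrow> (nat \<Rightarrow> real) \<Rightarrow> real" where
  "gamma_smooth \<phi> \<psi> w = (\<Sum>k. partial k \<phi> w * partial k \<psi> w)"

definition gamma_dom :: "((nat \<Rightarrow> real) \<Rightarrow> real) set" where
  "gamma_dom = {H \<in> square_integrable.
     summable (\<lambda>q. real q * expect (\<lambda>w. (chaos_proj q H w)\<^sup>2))}"

definition gamma_approx ::
  "(nat \<Rightarrow> (nat \<Rightarrow> real) \<Rightarrow> real) \<Rightarrow> ((nat \<Rightarrow> real) \<Rightarrow> real) \<Rightarrow> bool" where
  "gamma_approx \<phi> F \<longleftrightarrow>
     (\<forall>n. \<phi> n \<in> smooth_cylinder) \<and> L2_tendsto \<phi> F \<and>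
     (\<forall>\<epsilon>>0. \<exists>M. \<forall>m\<ge>M. \<forall>n\<ge>M.
        expect (gamma_smooth (\<lambda>w. \<phi> m w - \<phi> n w) (\<lambda>w. \<phi> m w - \<phi> n w)) < \<epsilon>)"

text \<open>The extension by closability. \<open>carre_du_champ F G\<close> is the \<open>L\<^sup>1\<close>-limit of
  \<open>gamma_smooth (\<phi> n) (\<psi> n)\<close> along approximations that converge in \<open>L\<^sup>2\<close> and are Cauchy in
  energy. Closability makes the limit almost surely independent of the approximations.\<close>

definition is_carre_du_champ ::
  "((nat \<Rightarrow> real) \<Rightarrow> real) \<Rightarrow> ((nat \<Rightarrow> real) \<Rightarrow> real) \<Rightarrow> ((nat \<Rightarrow> real) \<Rightarrow> real) \<Rightarrow> bool" where
  "is_carre_du_champ F G X \<longleftrightarrow>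
     F \<in> gamma_dom \<and> G \<in> gamma_dom \<and> integrable wiener X \<and>
     (\<exists>\<phi> \<psi>. gamma_approx \<phi> F \<and> gamma_approx \<psi> G \<and>
        (\<lambda>n. expect (\<lambda>w. \<bar>gamma_smooth (\<phi> n) (\<psi> n) w - X w\<bar>)) \<longlonglongrightarrow> 0)"

definition carre_du_champ ::
  "((nat \<Rightarrow> real) \<Rightarrow> real) \<Rightarrow> ((nat \<Rightarrow> real) \<Rightarrow> real) \<Rightarrow> (nat \<Rightarrow> real) \<Rightarrow> real" where
  "carre_du_champ F G = (SOME X. is_carre_du_champ F G X)"


section \<open>Finite signed measures on the real line and total variation\<close>

text \<open>A finite signed measure is a countably additive set function \<open>real set \<Rightarrow> real\<close> on the
  Borel sets. Integrals against it are defined through its Jordan decomposition, the positive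
  part being \<open>\<nu>\<^sup>+ A = sup {\<nu> B | B \<subseteq> A}\<close>. (The supremum is nonnegative because of \<open>B = {}\<close>,
  so truncation by \<open>ennreal\<close> is harmless.)\<close>

definition pos_part :: "(real set \<Rightarrow> real) \<Rightarrow> real measure" where
  "pos_part \<nu> =
     measure_of UNIV (sets borel) (\<lambda>A. SUP B\<in>{B \<in> sets borel. B \<subseteq> A}. ennreal (\<nu> B))"

definition signed_integral :: "(real set \<Rightarrow> real) \<Rightarrow> (real \<Rightarrow> real) \<Rightarrow> real" where
  "signed_integral \<nu> h =
     integral\<^sup>L (pos_part \<nu>) h - integral\<^sup>L (pos_part (\<lambda>A. - \<nu> A)) h"

definition d_TV :: "(real set \<Rightarrow> real) \<Rightarrow> (real set \<Rightarrow> real) \<Rightarrow> real" where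
  "d_TV \<mu> \<nu> = 1 / 2 *
     (SUP h\<in>{h. continuous_on UNIV h \<and> (\<forall>x. \<bar>h x\<bar> \<le> 1)}.
        \<bar>signed_integral \<mu> h - signed_integral \<nu> h\<bar>)"

definition law :: "((nat \<Rightarrow> real) \<Rightarrow> real) \<Rightarrow> real set \<Rightarrow> real" where
  "law F = measure (distr wiener borel F)"

definition edgeworth :: "((nat \<Rightarrow> real) \<Rightarrow> real) \<Rightarrow> real set \<Rightarrow> real" where
  "edgeworth F A = (LINT x:A|lborel.
     exp (- x\<^sup>2 / 2) / sqrt (2 * pi) *
       (1 + expect (\<lambda>w. hermite 3 (F w)) / fact 3 * hermite 3 x))"

end

theory Submission
  imports Defs "HOL-Computational_Algebra.Polynomial"
begin

text \<open>Test against \<open>h(x) = cos (s x)\<close> with a small \<open>s\<close>: the Hermite correction is odd, so the Edgeworth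
  measure integrates \<open>h\<close> to \<open>exp (- s\<^sup>2 / 2)\<close>, and it suffices to bound
  \<open>E cos (s F) - exp (- s\<^sup>2 / 2)\<close> from below by a multiple of \<open>Var \<Gamma>(F, F)\<close>.

  Let \<open>F\<close> be a polynomial in the chaos and \<open>G = \<Gamma>(F, F) / p - 1\<close>. Since \<open>L F = - p F\<close>, integration by parts
  turns the derivative in \<open>s\<close> of \<open>exp (s\<^sup>2 / 2) E cos (s F)\<close> into an expectation of \<open>G cos (s F)\<close>. Replacing
  \<open>1 - cos (s x)\<close> by \<open>s\<^sup>2 x\<^sup>2 / 2\<close> gives the main term \<open>E[F\<^sup>2 G]\<close>, which dominates \<open>Var \<Gamma>(F, F)\<close>. The remainder
  is \<open>O(s\<^sup>3 Var \<Gamma>(F, F))\<close>: repeated integration by parts rewrites it with triangular contractions of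
  iterated derivatives of \<open>F\<close>, which are controlled by the two-fold contractions in the chaos expansion
  of \<open>F\<^sup>2\<close>, by the Poincare inequality and by hypercontractivity. All constants depend only on
  \<open>p\<close>, hence so does the choice of \<open>s\<close>, and the inequality passes to the whole chaos along an approximating
  sequence, by closability of the gradient and Fatou's lemma.\<close>

section \<open>Gaussian measure and integration by parts\<close>

text \<open>The estimate has to be linear in the variance \<open>V\<close> of
  \<open>\<Gamma>(F, F)\<close>. Cauchy-Schwarz applied to the expectation of
  \<open>(\<Gamma>(F, F) - p) * (1 - cos (s * F))\<close> yields only \<open>sqrt V\<close>, which
  dominates the main term when the variance is small. Linearity is recovered by centring: the
  quantities in the recursion are covariances with a function h(F). Repeated integration by parts
  ends in constants, whose covariances vanish although the constants themselves need not be small.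
  Along the way the derivative of h attaches a further vertex, and what appears is a sum of products
  of two contractions, each of size \<open>sqrt V\<close>. The one term that is not centred is a
  product of two means, and each of these is again of size \<open>sqrt V\<close>. Multiple Wiener
  integrals are avoided: the kernel of F is read off from the expectations of its p-fold
  derivatives, membership in a chaos becomes an eigenvalue equation for finitely many coordinates,
  and infinite dimension enters only in the final limit.\<close>

lemma prob_space_gaussian: "prob_space gaussian"
  unfolding gaussian_def using prob_space_normal_density[of 1 0] by simp

lemma sets_gaussian [simp, measurable_cong]: "sets gaussian = sets borel"
  by (simp add: gaussian_def)

lemma space_gaussian [simp]: "space gaussian = UNIV"
  by (simp add: gaussian_def)

interpretation gaussian: prob_space gaussian
  by (rule prob_space_gaussian)

lemma prob_space_wiener: "prob_space wiener"
  unfolding wiener_def by (rule prob_space_PiM) (rule prob_space_gaussian)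

interpretation wiener: prob_space wiener
  by (rule prob_space_wiener)

lemma sets_wiener: "sets wiener = sets (borel :: (nat \<Rightarrow> real) measure)"
  unfolding wiener_def
  by (subst sets_PiM_equal_borel[symmetric]) (rule sets_PiM_cong, auto)

lemma space_wiener [simp]: "space wiener = UNIV"
  by (simp add: wiener_def space_PiM)

lemma continuous_measurable_wiener:
  "continuous_on UNIV f \<Longrightarrow> f \<in> borel_measurable wiener"
  using borel_measurable_continuous_onI measurable_cong_sets[OF sets_wiener refl] by blast

section \<open>Gaussian moments and functions of polynomial growth\<close>

lemma integrable_gaussian_power: "integrable gaussian (\<lambda>x. \<bar>x\<bar> ^ k)"
  unfolding gaussian_def
  by (subst integrable_density) (auto simp: integrable_std_normal_moment_abs)

lemma continuous_on_coordinate: "continuous_on UNIV (\<lambda>w :: nat \<Rightarrow> real. w i)"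
  by (rule continuous_on_product_coordinates)

lemma measurable_coordinate: "(\<lambda>w. w i) \<in> borel_measurable wiener"
  by (rule continuous_measurable_wiener[OF continuous_on_coordinate])

lemma distr_wiener_coordinate: "distr wiener gaussian (\<lambda>w. w i) = gaussian"
  unfolding wiener_def by (rule distr_PiM_component) (auto simp: prob_space_gaussian)

lemma integrable_wiener_coordinate_power: "integrable wiener (\<lambda>w. \<bar>w i\<bar> ^ k)"
proof -
  have [measurable]: "(\<lambda>x. \<bar>x\<bar> ^ k) \<in> borel_measurable gaussian" using integrable_gaussian_power by blast
  have "integrable (distr wiener gaussian (\<lambda>w. w i)) (\<lambda>x. \<bar>x\<bar> ^ k)"
    by (simp add: distr_wiener_coordinate integrable_gaussian_power)
  then show ?thesis
    using measurable_coordinate[of i] by (subst (asm) integrable_distr_eq) (auto cong: measurable_cong_sets)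
qed

text \<open>The base on the left is at most n + 1 times the maximum of 1 and the entries, and the
  power of that maximum is one of the terms on the right. Integrability of growth weights thus comes
  down to moments of single coordinates.\<close>

lemma sum_power_le:
  fixes a :: "nat \<Rightarrow> real"
  assumes "\<And>i. i < n \<Longrightarrow> 0 \<le> a i"
  shows "(1 + (\<Sum>i<n. a i)) ^ m \<le> (real n + 1) ^ m * (1 + (\<Sum>i<n. a i ^ m))"
proof -
  define M where "M = Max (insert 1 (a ` {..<n}))"
  have M: "M \<in> insert 1 (a ` {..<n})" unfolding M_def by (intro Max_in) auto
  have ge: "1 \<le> M" "\<And>i. i < n \<Longrightarrow> a i \<le> M" unfolding M_def by auto
  have "(\<Sum>i<n. a i) \<le> (\<Sum>i<n. M)" by (intro sum_mono) (use ge in auto)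
  then have "1 + (\<Sum>i<n. a i) \<le> (real n + 1) * M" using ge by (simp add: algebra_simps)
  then have "(1 + (\<Sum>i<n. a i)) ^ m \<le> ((real n + 1) * M) ^ m"
    by (intro power_mono) (auto intro!: add_nonneg_nonneg sum_nonneg assms)
  also have "\<dots> = (real n + 1) ^ m * M ^ m" by (rule power_mult_distrib)
  also have "M ^ m \<le> 1 + (\<Sum>i<n. a i ^ m)"
  proof (cases "M = 1")
    case True then show ?thesis using assms by (auto intro!: sum_nonneg)
  next
    case False
    then obtain i where i: "i < n" "M = a i" using M by auto
    have "a i ^ m \<le> (\<Sum>i<n. a i ^ m)" by (rule member_le_sum) (use i assms in auto)
    then show ?thesis using i by simp
  qed
  finally show ?thesis by (simp add: mult_left_mono)
qed

lemma integrable_growth: "integrable wiener (\<lambda>w. (1 + (\<Sum>i<n. \<bar>w i\<bar>)) ^ m)"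
proof (rule Bochner_Integration.integrable_bound)
  show "integrable wiener (\<lambda>w. (real n + 1) ^ m * (1 + (\<Sum>i<n. \<bar>w i\<bar> ^ m)))"
    by (intro integrable_mult_right Bochner_Integration.integrable_add Bochner_Integration.integrable_sum integrable_wiener_coordinate_power) simp
  show "AE w in wiener. norm ((1 + (\<Sum>i<n. \<bar>w i\<bar>)) ^ m) \<le> norm ((real n + 1) ^ m * (1 + (\<Sum>i<n. \<bar>w i\<bar> ^ m)))"
    using sum_power_le[of n "\<lambda>i. \<bar>w i\<bar>" m for w]
    by (intro AE_I2) (simp add: abs_mult sum_nonneg add_nonneg_nonneg)
qed (intro continuous_measurable_wiener continuous_intros continuous_on_coordinate)

lemma poly_growthE:
  assumes "poly_growth n X"
  obtains C m where "C \<ge> 0" "\<And>w. \<bar>X w\<bar> \<le> C * (1 + (\<Sum>i<n. \<bar>w i\<bar>)) ^ m"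
proof -
  obtain C m where *: "\<And>w. \<bar>X w\<bar> \<le> C * (1 + (\<Sum>i<n. \<bar>w i\<bar>)) ^ m"
    using assms unfolding poly_growth_def by blast
  \<comment> \<open>At the origin the weight equals 1, so the bound itself makes the constant
    non-negative.\<close>
  have "0 \<le> C" using *[of "\<lambda>_. 0"] by simp
  with * that show ?thesis by blast
qed

lemma integrable_poly_growth:
  assumes "poly_growth n X" "X \<in> borel_measurable wiener"
  shows "integrable wiener X"
proof -
  obtain C m where *: "\<And>w. \<bar>X w\<bar> \<le> C * (1 + (\<Sum>i<n. \<bar>w i\<bar>)) ^ m"
    using assms(1) by (rule poly_growthE) blast
  show ?thesis
  proof (rule Bochner_Integration.integrable_bound[OF integrable_mult_right[OF integrable_growth, of C n m] assms(2)])
    show "AE w in wiener. norm (X w) \<le> norm (C * (1 + (\<Sum>i<n. \<bar>w i\<bar>)) ^ m)"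
      using * by (intro AE_I2) (simp only: real_norm_def order_trans[OF _ abs_ge_self])
  qed
qed

lemma growth_ge_1: "1 \<le> 1 + (\<Sum>i<n. \<bar>w i\<bar> :: real)"
  by (simp add: sum_nonneg)

lemma poly_growth_mult:
  assumes "poly_growth n X" "poly_growth n Y"
  shows "poly_growth n (\<lambda>w. X w * Y w)"
proof -
  obtain C m where 1: "C \<ge> 0" "\<And>w. \<bar>X w\<bar> \<le> C * (1 + (\<Sum>i<n. \<bar>w i\<bar>)) ^ m"
    using assms(1) by (rule poly_growthE) blast
  obtain D l where 2: "D \<ge> 0" "\<And>w. \<bar>Y w\<bar> \<le> D * (1 + (\<Sum>i<n. \<bar>w i\<bar>)) ^ l"
    using assms(2) by (rule poly_growthE) blast
  have "\<bar>X w * Y w\<bar> \<le> (C * D) * (1 + (\<Sum>i<n. \<bar>w i\<bar>)) ^ (m + l)" for w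
    using mult_mono[OF 1(2)[of w] 2(2)[of w]] 1(1) growth_ge_1[of w n]
    by (simp add: abs_mult power_add mult_ac)
  then show ?thesis unfolding poly_growth_def by blast
qed

lemma poly_growth_add:
  assumes "poly_growth n X" "poly_growth n Y"
  shows "poly_growth n (\<lambda>w. X w + Y w)"
proof -
  obtain C m where 1: "C \<ge> 0" "\<And>w. \<bar>X w\<bar> \<le> C * (1 + (\<Sum>i<n. \<bar>w i\<bar>)) ^ m"
    using assms(1) by (rule poly_growthE) blast
  obtain D l where 2: "D \<ge> 0" "\<And>w. \<bar>Y w\<bar> \<le> D * (1 + (\<Sum>i<n. \<bar>w i\<bar>)) ^ l"
    using assms(2) by (rule poly_growthE) blast
  have "\<bar>X w + Y w\<bar> \<le> (C + D) * (1 + (\<Sum>i<n. \<bar>w i\<bar>)) ^ (m + l)" for w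
  proof -
    let ?b = "1 + (\<Sum>i<n. \<bar>w i\<bar>)"
    have "\<bar>X w + Y w\<bar> \<le> C * ?b ^ m + D * ?b ^ l" using 1(2)[of w] 2(2)[of w] by linarith
    also have "\<dots> \<le> C * ?b ^ (m + l) + D * ?b ^ (m + l)"
      by (intro add_mono mult_left_mono power_increasing growth_ge_1 1 2) auto
    finally show ?thesis by (simp add: algebra_simps)
  qed
  then show ?thesis unfolding poly_growth_def by blast
qed

lemma poly_growth_const: "poly_growth n (\<lambda>_. c)"
  unfolding poly_growth_def by (rule exI[of _ "\<bar>c\<bar>"], rule exI[of _ 0]) simp

lemma poly_growth_bound:
  assumes "poly_growth n Y" "\<And>w. \<bar>X w\<bar> \<le> \<bar>Y w\<bar>"
  shows "poly_growth n X"
  using assms unfolding poly_growth_def by (meson order_trans)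

lemma poly_growth_coordinate: "i < n \<Longrightarrow> poly_growth n (\<lambda>w. w i)"
  unfolding poly_growth_def
proof (rule exI[of _ 1], rule exI[of _ 1], intro allI)
  fix w :: "nat \<Rightarrow> real" assume "i < n"
  then have "\<bar>w i\<bar> \<le> (\<Sum>i<n. \<bar>w i\<bar>)" by (intro member_le_sum) auto
  then show "\<bar>w i\<bar> \<le> 1 * (1 + (\<Sum>i<n. \<bar>w i\<bar>)) ^ 1" by simp
qed

lemma poly_growth_mono:
  assumes "poly_growth n X" "n \<le> m"
  shows "poly_growth m X"
proof -
  obtain C l where 1: "C \<ge> 0" "\<And>w. \<bar>X w\<bar> \<le> C * (1 + (\<Sum>i<n. \<bar>w i\<bar>)) ^ l"
    using assms(1) by (rule poly_growthE) blast
  have "(\<Sum>i<n. \<bar>w i\<bar>) \<le> (\<Sum>i<m. \<bar>w i :: real\<bar>)" for w using assms(2) by (intro sum_mono2) auto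
  then have "C * (1 + (\<Sum>i<n. \<bar>w i\<bar>)) ^ l \<le> C * (1 + (\<Sum>i<m. \<bar>w i\<bar>)) ^ l" for w
    using 1(1) by (intro mult_left_mono power_mono) (auto simp: sum_nonneg)
  then show ?thesis using 1(2) unfolding poly_growth_def by (meson order_trans)
qed

text \<open>One factor of the Gaussian integration by parts is split off by resampling a single
  coordinate.\<close>

lemma wiener_resample:
  "distr (gaussian \<Otimes>\<^sub>M wiener) wiener (\<lambda>(t, w). w(k := t)) = wiener"
  using distr_pair_PiM_eq_PiM[of UNIV "\<lambda>_. gaussian" k]
  by (simp add: wiener_def prob_space_gaussian)

lemma measurable_resample [measurable]:
  "(\<lambda>(t, w). w(k := t)) \<in> measurable (gaussian \<Otimes>\<^sub>M wiener) wiener"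
proof -
  have "(\<lambda>(t, w). w(k := t)) \<in> measurable (gaussian \<Otimes>\<^sub>M PiM UNIV (\<lambda>_. gaussian)) (PiM (insert k UNIV) (\<lambda>_. gaussian))"
    by measurable
  then show ?thesis by (simp add: wiener_def)
qed

lemma expect_resample:
  fixes X :: "(nat \<Rightarrow> real) \<Rightarrow> real"
  assumes "integrable wiener X"
  shows "expect X = expect (\<lambda>w. \<integral>t. X (w(k := t)) \<partial>gaussian)"
proof -
  interpret pair_sigma_finite gaussian wiener ..
  have X[measurable]: "X \<in> borel_measurable wiener" using assms by auto
  have "integrable (distr (gaussian \<Otimes>\<^sub>M wiener) wiener (\<lambda>(t, w). w(k := t))) X"
    using assms by (simp add: wiener_resample)
  then have int: "integrable (gaussian \<Otimes>\<^sub>M wiener) (\<lambda>(t, w). X (w(k := t)))"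
    by (subst (asm) integrable_distr_eq) (auto simp: case_prod_beta')
  have "expect X = (\<integral>z. X z \<partial>distr (gaussian \<Otimes>\<^sub>M wiener) wiener (\<lambda>(t, w). w(k := t)))"
    by (simp add: wiener_resample)
  also have "\<dots> = (\<integral>z. (case z of (t, w) \<Rightarrow> X (w(k := t))) \<partial>(gaussian \<Otimes>\<^sub>M wiener))"
    by (subst integral_distr) (auto simp: case_prod_beta')
  also have "\<dots> = expect (\<lambda>w. \<integral>t. X (w(k := t)) \<partial>gaussian)"
    using integral_snd[OF int] by simp
  finally show ?thesis .
qed

lemma gaussian_integral: "(\<integral>x. h x \<partial>gaussian) = (\<integral>x. std_normal_density x * h x \<partial>lborel)"
  if "h \<in> borel_measurable borel" for h :: "real \<Rightarrow> real"
  unfolding gaussian_def by (subst integral_density) (use that in auto)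

lemma tendsto_poly_gauss:
  fixes h :: "real \<Rightarrow> real"
  assumes "\<And>x. \<bar>h x\<bar> \<le> C * (1 + \<bar>x\<bar>) ^ m"
  shows "((\<lambda>x. h x * std_normal_density x) \<longlongrightarrow> 0) at_top"
    and "((\<lambda>x. h x * std_normal_density x) \<longlongrightarrow> 0) at_bot"
proof -
  have lim: "((\<lambda>x. C * (1 + x) ^ m * (1 / sqrt (2 * pi) * exp (- x\<^sup>2 / 2))) \<longlongrightarrow> 0) at_top"
  proof -
    have "((\<lambda>x::real. (1 + x) ^ m / exp (1 + x)) \<longlongrightarrow> 0) at_top"
      by (rule filterlim_compose[OF tendsto_power_div_exp_0])
         (rule filterlim_tendsto_add_at_top[OF tendsto_const filterlim_ident])
    then have *: "((\<lambda>x::real. \<bar>C\<bar> * exp 2 * ((1 + x) ^ m / exp (1 + x))) \<longlongrightarrow> \<bar>C\<bar> * exp 2 * 0) at_top"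
      by (intro tendsto_mult_left)
    show ?thesis
    proof (rule Lim_null_comparison[OF _ *[simplified]])
      show "\<forall>\<^sub>F x in at_top. norm (C * (1 + x) ^ m * (1 / sqrt (2 * pi) * exp (- x\<^sup>2 / 2)))
          \<le> \<bar>C\<bar> * exp 2 * (1 + x) ^ m / exp (1 + x)"
        using eventually_ge_at_top[of 0]
      proof eventually_elim
        case (elim x)
        \<comment> \<open>Completing the square at 1 trades the Gaussian tail for exp (2 - (1 + x)),
          against which every power of 1 + x is negligible.\<close>
        have "- x\<^sup>2 / 2 \<le> 2 - (1 + x)"
          using zero_le_power2[of "x - 1"] by (simp add: power2_eq_square algebra_simps)
        then have "exp (- x\<^sup>2 / 2) \<le> exp 2 / exp (1 + x)" by (simp flip: exp_diff)
        moreover have "1 / sqrt (2 * pi) \<le> 1" using pi_gt3 by (simp add: real_le_rsqrt)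
        ultimately have "1 / sqrt (2 * pi) * exp (- x\<^sup>2 / 2) \<le> 1 * (exp 2 / exp (1 + x))"
          by (intro mult_mono) auto
        then have "\<bar>C\<bar> * (1 + x) ^ m * (1 / sqrt (2 * pi) * exp (- x\<^sup>2 / 2)) \<le> \<bar>C\<bar> * (1 + x) ^ m * (exp 2 / exp (1 + x))"
          using elim by (intro mult_left_mono) auto
        then show ?case using elim by (simp add: abs_mult mult_ac)
      qed
    qed
  qed
  have bd: "\<bar>h x * std_normal_density x\<bar> \<le> C * (1 + \<bar>x\<bar>) ^ m * (1 / sqrt (2 * pi) * exp (- \<bar>x\<bar>\<^sup>2 / 2))" for x
    using mult_right_mono[OF assms[of x], of "std_normal_density x"]
    by (simp add: abs_mult std_normal_density_def)
  have abs_lim: "((\<lambda>x. C * (1 + \<bar>x\<bar>) ^ m * (1 / sqrt (2 * pi) * exp (- \<bar>x\<bar>\<^sup>2 / 2))) \<longlongrightarrow> 0) F"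
    if "filterlim abs at_top F" for F :: "real filter"
    using filterlim_compose[OF lim that] by simp
  have "filterlim (abs :: real \<Rightarrow> real) at_top at_top"
    by (rule filterlim_abs_real)
  moreover have "filterlim (abs :: real \<Rightarrow> real) at_top at_bot"
    unfolding filterlim_at_top 
  proof
    fix Z :: real
    show "\<forall>\<^sub>F x in at_bot. Z \<le> \<bar>x\<bar>"
      using eventually_le_at_bot[of "- \<bar>Z\<bar>"] by eventually_elim linarith
  qed
  ultimately show "((\<lambda>x. h x * std_normal_density x) \<longlongrightarrow> 0) at_top" "((\<lambda>x. h x * std_normal_density x) \<longlongrightarrow> 0) at_bot"
    using bd by (simp_all only: real_norm_def Lim_null_comparison[OF always_eventually abs_lim] simp_thms)
qed

lemma integrable_gaussian_growth:
  fixes h :: "real \<Rightarrow> real"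
  assumes "\<And>x. \<bar>h x\<bar> \<le> C * (1 + \<bar>x\<bar>) ^ m" "h \<in> borel_measurable borel"
  shows "integrable gaussian h"
proof (rule Bochner_Integration.integrable_bound)
  show "integrable gaussian (\<lambda>x. \<bar>C\<bar> * (2 ^ m * (1 + \<bar>x\<bar> ^ m)))"
    by (intro integrable_mult_right Bochner_Integration.integrable_add integrable_gaussian_power) simp
  show "AE x in gaussian. norm (h x) \<le> norm (\<bar>C\<bar> * (2 ^ m * (1 + \<bar>x\<bar> ^ m)))"
  proof (intro AE_I2)
    fix x :: real
    have "(1 + \<bar>x\<bar>) ^ m \<le> 2 ^ m * (1 + \<bar>x\<bar> ^ m)" using sum_power_le[of 1 "\<lambda>_. \<bar>x\<bar> :: real" m] by simp
    then have "\<bar>C\<bar> * (1 + \<bar>x\<bar>) ^ m \<le> \<bar>C\<bar> * (2 ^ m * (1 + \<bar>x\<bar> ^ m))" by (intro mult_left_mono) auto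
    moreover have "\<bar>h x\<bar> \<le> \<bar>C\<bar> * (1 + \<bar>x\<bar>) ^ m" using assms(1)[of x] 
      by (smt (verit) mult_right_mono zero_le_power)
    ultimately show "norm (h x) \<le> norm (\<bar>C\<bar> * (2 ^ m * (1 + \<bar>x\<bar> ^ m)))" by (simp add: abs_mult)
  qed
qed (use assms(2) in \<open>simp add: gaussian_def\<close>)

text \<open>The derivative of \<open>h\<close> times the Gaussian density is the density times
  \<open>h' x - x * h x\<close>. Polynomial growth kills the boundary values at both infinities, so
  the fundamental theorem of calculus on the whole line gives zero.\<close>

lemma gaussian_ibp:
  fixes h h' :: "real \<Rightarrow> real"
  assumes der: "\<And>x. (h has_real_derivative h' x) (at x)"
    and cont: "continuous_on UNIV h'"
    and bd: "\<And>x. \<bar>h x\<bar> \<le> C * (1 + \<bar>x\<bar>) ^ m" "\<And>x. \<bar>h' x\<bar> \<le> C' * (1 + \<bar>x\<bar>) ^ m'"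
  shows "(\<integral>x. x * h x \<partial>gaussian) = (\<integral>x. h' x \<partial>gaussian)"
proof -
  have conth: "continuous_on UNIV h" using der by (meson DERIV_continuous continuous_at_imp_continuous_on)
  have meas[measurable]: "h \<in> borel_measurable borel" "h' \<in> borel_measurable borel"
    using conth cont by (auto intro: borel_measurable_continuous_onI)
  have bd1: "\<bar>x * h x\<bar> \<le> C * (1 + \<bar>x\<bar>) ^ (m + 1)" for x
    using mult_mono[OF _ bd(1)[of x], of "\<bar>x\<bar>" "1 + \<bar>x\<bar>"] by (simp add: abs_mult mult_ac)
  have i1: "integrable gaussian (\<lambda>x. x * h x)" by (rule integrable_gaussian_growth[OF bd1]) measurable
  have i2: "integrable gaussian h'" by (rule integrable_gaussian_growth[OF bd(2)]) measurable
  let ?f = "\<lambda>x. std_normal_density x * (h' x - x * h x)"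
  have "integrable gaussian (\<lambda>x. h' x - x * h x)" using i1 i2 by simp
  then have if0: "integrable lborel ?f"
    unfolding gaussian_def by (subst (asm) integrable_density) auto
  have "(LBINT x=-\<infinity>..\<infinity>. ?f x) = 0 - 0"
  proof (rule interval_integral_FTC_integrable[where F = "\<lambda>x. h x * std_normal_density x"])
    fix x :: real
    have "(std_normal_density has_real_derivative - x * std_normal_density x) (at x)"
      unfolding std_normal_density_def by (auto intro!: derivative_eq_intros simp: real_div_sqrt field_simps)
    then have "((\<lambda>x. h x * std_normal_density x) has_real_derivative ?f x) (at x)"
      by (auto intro!: derivative_eq_intros der simp: algebra_simps)
    then show "((\<lambda>x. h x * std_normal_density x) has_vector_derivative ?f x) (at x)"
      by (simp add: has_real_derivative_iff_has_vector_derivative)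
    show "isCont ?f x"
      using conth cont unfolding std_normal_density_def
      by (auto intro!: continuous_intros simp: continuous_on_eq_continuous_at)
  next
    show "set_integrable lborel (einterval (-\<infinity>) \<infinity>) ?f" using if0 by (simp add: set_integrable_def)
  next
    show "(((\<lambda>x. h x * std_normal_density x) \<circ> real_of_ereal) \<longlongrightarrow> 0) (at_right (-\<infinity>))"
      unfolding comp_def at_right_MInf filterlim_filtermap using tendsto_poly_gauss(2)[OF bd(1)] by simp
    show "(((\<lambda>x. h x * std_normal_density x) \<circ> real_of_ereal) \<longlongrightarrow> 0) (at_left \<infinity>)"
      unfolding comp_def at_left_PInf filterlim_filtermap using tendsto_poly_gauss(1)[OF bd(1)] by simp
  qed simp
  then have "(\<integral>x. ?f x \<partial>lborel) = 0"
    by (simp add: interval_lebesgue_integral_def set_lebesgue_integral_def)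
  then have "(\<integral>x. h' x - x * h x \<partial>gaussian) = 0" by (simp add: gaussian_integral)
  then show ?thesis using i1 i2 by simp
qed

section \<open>Calculus of functions with polynomially growing derivatives\<close>

text \<open>One polynomially growing derivative is what integration by parts asks for, and the class
  contains polynomials as well as sines and cosines of them. The index \<open>n\<close> restricts
  the growth bounds only, not the coordinates on which the function depends.\<close>

definition tame :: "nat \<Rightarrow> ((nat \<Rightarrow> real) \<Rightarrow> real) \<Rightarrow> bool" where
  "tame n X \<longleftrightarrow> C1_fun X \<and> poly_growth n X \<and> (\<forall>k. poly_growth n (partial k X))"

lemma C1_fun_has_partial:
  assumes "C1_fun X"
  shows "((\<lambda>t. X (w(k := t))) has_real_derivative partial k X (w(k := t))) (at t)"
proof -
  have "(\<lambda>s. X ((w(k := t))(k := s))) differentiable (at ((w(k := t)) k))"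
    using assms unfolding C1_fun_def by blast
  then show ?thesis
    unfolding partial_def using DERIV_deriv_iff_real_differentiable by (simp add: field_differentiable_def)
qed

lemma C1_fun_has_partial':
  assumes "C1_fun X"
  shows "((\<lambda>t. X (w(k := t))) has_real_derivative partial k X w) (at (w k))"
  using C1_fun_has_partial[OF assms, of w k "w k"] by simp

lemma partial_eqI:
  assumes "((\<lambda>t. X (w(k := t))) has_real_derivative d) (at (w k))"
  shows "partial k X w = d"
  unfolding partial_def using assms by (rule DERIV_imp_deriv)

lemma C1_funI:
  assumes "continuous_on UNIV X"
    and "\<And>k w. ((\<lambda>t. X (w(k := t))) has_real_derivative X' k w) (at (w k))"
    and "\<And>k. continuous_on UNIV (X' k)"
  shows "C1_fun X" "partial k X = X' k"
proof -
  have p: "partial k X = X' k" for k using assms(2) by (intro ext partial_eqI)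
  show "partial k X = X' k" by (rule p)
  have "(\<lambda>t. X (w(k := t))) differentiable (at (w k))" for k w
    using assms(2)[of w k] real_differentiable_def by blast
  then show "C1_fun X" unfolding C1_fun_def p using assms(1,3) by simp
qed

lemma C1_fun_continuous: "C1_fun X \<Longrightarrow> continuous_on UNIV X" "C1_fun X \<Longrightarrow> continuous_on UNIV (partial k X)"
  by (auto simp: C1_fun_def)

lemma C1_fun_mult:
  assumes "C1_fun X" "C1_fun Y"
  shows "C1_fun (\<lambda>w. X w * Y w)"
    and "partial k (\<lambda>w. X w * Y w) = (\<lambda>w. partial k X w * Y w + X w * partial k Y w)"
proof -
  have d: "((\<lambda>t. X (w(k := t)) * Y (w(k := t))) has_real_derivative partial k X w * Y w + X w * partial k Y w) (at (w k))" for k w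
    using DERIV_mult[OF C1_fun_has_partial'[OF assms(1), of w k] C1_fun_has_partial'[OF assms(2), of w k]] by (simp add: algebra_simps)
  have c: "continuous_on UNIV (\<lambda>w. X w * Y w)" "continuous_on UNIV (\<lambda>w. partial k X w * Y w + X w * partial k Y w)" for k
    by (intro continuous_on_mult continuous_on_add C1_fun_continuous assms)+
  show "C1_fun (\<lambda>w. X w * Y w)"
    "partial k (\<lambda>w. X w * Y w) = (\<lambda>w. partial k X w * Y w + X w * partial k Y w)"
    by (rule C1_funI[OF c(1) d c(2)])+
qed

lemma C1_fun_add:
  assumes "C1_fun X" "C1_fun Y"
  shows "C1_fun (\<lambda>w. X w + Y w)"
    and "partial k (\<lambda>w. X w + Y w) = (\<lambda>w. partial k X w + partial k Y w)"
proof -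
  have d: "((\<lambda>t. X (w(k := t)) + Y (w(k := t))) has_real_derivative partial k X w + partial k Y w) (at (w k))" for k w
    using DERIV_add[OF C1_fun_has_partial'[OF assms(1), of w k] C1_fun_has_partial'[OF assms(2), of w k]] by simp
  have c: "continuous_on UNIV (\<lambda>w. X w + Y w)" "continuous_on UNIV (\<lambda>w. partial k X w + partial k Y w)" for k
    by (intro continuous_on_mult continuous_on_add C1_fun_continuous assms)+
  show "C1_fun (\<lambda>w. X w + Y w)"
    "partial k (\<lambda>w. X w + Y w) = (\<lambda>w. partial k X w + partial k Y w)"
    by (rule C1_funI[OF c(1) d c(2)])+
qed

lemma C1_fun_const: "C1_fun (\<lambda>_. c)" "partial k (\<lambda>_. c) = (\<lambda>_. 0)"
  by (rule C1_funI[where X' = "\<lambda>_ _. 0", OF continuous_on_const DERIV_const continuous_on_const])+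

lemma C1_fun_coordinate: "C1_fun (\<lambda>w. w i)" "partial k (\<lambda>w. w i) = (\<lambda>_. if i = k then 1 else 0)"
proof -
  have d: "((\<lambda>t. (w(k := t)) i) has_real_derivative (if i = k then 1 else 0)) (at (w k))" for k and w :: "nat \<Rightarrow> real"
    by (cases "i = k") (auto intro!: derivative_eq_intros)
  show "C1_fun (\<lambda>w. w i)" "partial k (\<lambda>w. w i) = (\<lambda>_. if i = k then 1 else 0)"
    by (rule C1_funI[OF continuous_on_coordinate d continuous_on_const])+
qed

lemma C1_fun_compose:
  assumes "C1_fun X" and f: "\<And>x. (f has_real_derivative f' x) (at x)" "continuous_on UNIV f'"
  shows "C1_fun (\<lambda>w. f (X w))" and "partial k (\<lambda>w. f (X w)) = (\<lambda>w. f' (X w) * partial k X w)"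
proof -
  have d: "((\<lambda>t. f (X (w(k := t)))) has_real_derivative f' (X w) * partial k X w) (at (w k))" for k w
    using DERIV_chain2[OF _ C1_fun_has_partial'[OF assms(1), of w k], of f "f' (X w)"] f(1) by simp
  have cf: "continuous_on UNIV f" using f(1) by (meson DERIV_continuous continuous_at_imp_continuous_on)
  have c: "continuous_on UNIV (\<lambda>w. f (X w))"
    by (rule continuous_on_compose2[OF cf C1_fun_continuous(1)[OF assms(1)]]) simp
  have c': "continuous_on UNIV (\<lambda>w. f' (X w) * partial k X w)" for k
    by (rule continuous_on_mult[OF continuous_on_compose2[OF f(2) C1_fun_continuous(1)[OF assms(1)]]
        C1_fun_continuous(2)[OF assms(1)]]) simp
  show "C1_fun (\<lambda>w. f (X w))" "partial k (\<lambda>w. f (X w)) = (\<lambda>w. f' (X w) * partial k X w)"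
    by (rule C1_funI[OF c d c'])+
qed

lemma tame_mult: "tame n X \<Longrightarrow> tame n Y \<Longrightarrow> tame n (\<lambda>w. X w * Y w)"
  unfolding tame_def by (auto simp: C1_fun_mult intro!: poly_growth_add poly_growth_mult)

lemma tame_add: "tame n X \<Longrightarrow> tame n Y \<Longrightarrow> tame n (\<lambda>w. X w + Y w)"
  unfolding tame_def by (auto simp: C1_fun_add intro!: poly_growth_add)

lemma tame_const: "tame n (\<lambda>_. c)"
  unfolding tame_def by (auto simp: C1_fun_const intro!: poly_growth_const)

lemma tame_coordinate: "i < n \<Longrightarrow> tame n (\<lambda>w. w i)"
  unfolding tame_def by (auto simp: C1_fun_coordinate intro!: poly_growth_const poly_growth_coordinate)

lemma tame_C1: "tame n X \<Longrightarrow> C1_fun X" by (simp add: tame_def)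

lemma tame_growth: "tame n X \<Longrightarrow> poly_growth n X" "tame n X \<Longrightarrow> poly_growth n (partial k X)"
  by (simp_all add: tame_def)

lemma tame_measurable: "tame n X \<Longrightarrow> X \<in> borel_measurable wiener"
  "tame n X \<Longrightarrow> partial k X \<in> borel_measurable wiener"
  by (auto intro!: continuous_measurable_wiener C1_fun_continuous tame_C1)

lemma tame_integrable: "tame n X \<Longrightarrow> integrable wiener X"
  "tame n X \<Longrightarrow> integrable wiener (partial k X)"
  by (auto intro!: integrable_poly_growth tame_growth tame_measurable)

lemma tame_mono: "tame n X \<Longrightarrow> n \<le> m \<Longrightarrow> tame m X"
  by (auto simp: tame_def intro: poly_growth_mono)

text \<open>From 1 + S + t \<le> (1 + S) * (1 + t) for non-negative S and t: with all coordinates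
  but one frozen, the bound takes the one-variable form that \<open>gaussian_ibp\<close> expects,
  with a constant depending on \<open>w\<close>.\<close>

lemma growth_slice:
  fixes w :: "nat \<Rightarrow> real"
  assumes "C \<ge> 0" "\<And>w. \<bar>X w\<bar> \<le> C * (1 + (\<Sum>i<n. \<bar>w i\<bar>)) ^ m"
  shows "\<bar>X (w(k := t))\<bar> \<le> (C * (1 + (\<Sum>i<n. \<bar>w i\<bar>)) ^ m) * (1 + \<bar>t\<bar>) ^ m"
proof -
  define S where "S = (\<Sum>i<n. \<bar>w i\<bar>)"
  have S: "0 \<le> S" by (simp add: S_def sum_nonneg)
  have "(\<Sum>i<n. \<bar>(w(k := t)) i\<bar>) \<le> (\<Sum>i<n. \<bar>w i\<bar> + (if i = k then \<bar>t\<bar> else 0))"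
    by (intro sum_mono) auto
  also have "\<dots> \<le> S + \<bar>t\<bar>"
    unfolding S_def sum.distrib by (intro add_left_mono) (simp add: sum.delta)
  finally have "(\<Sum>i<n. \<bar>(w(k := t)) i\<bar>) \<le> S + \<bar>t\<bar>" .
  moreover have "1 + (S + \<bar>t\<bar>) \<le> (1 + S) * (1 + \<bar>t\<bar>)"
    using mult_nonneg_nonneg[OF S abs_ge_zero[of t]] by (simp add: algebra_simps)
  ultimately have le: "1 + (\<Sum>i<n. \<bar>(w(k := t)) i\<bar>) \<le> (1 + S) * (1 + \<bar>t\<bar>)"
    by (rule order_trans[OF add_left_mono])
  have "\<bar>X (w(k := t))\<bar> \<le> C * (1 + (\<Sum>i<n. \<bar>(w(k := t)) i\<bar>)) ^ m" by (rule assms(2))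
  also have "\<dots> \<le> C * ((1 + S) * (1 + \<bar>t\<bar>)) ^ m"
    using order_trans[OF zero_le_one growth_ge_1] by (rule mult_left_mono[OF power_mono[OF le] assms(1)])
  also have "\<dots> = (C * (1 + (\<Sum>i<n. \<bar>w i\<bar>)) ^ m) * (1 + \<bar>t\<bar>) ^ m"
    by (simp only: power_mult_distrib mult.assoc S_def)
  finally show ?thesis .
qed

lemma continuous_on_update: "continuous_on UNIV (\<lambda>t::real. w(k := t))"
proof (rule continuous_on_coordinatewise_then_product)
  show "continuous_on UNIV (\<lambda>t. (w(k := t)) i)" for i
    by (cases "i = k") auto
qed

lemma wiener_ibp:
  assumes X: "tame n X" and k: "k < n"
  shows "expect (\<lambda>w. w k * X w) = expect (partial k X)"
proof -
  have "expect (\<lambda>w. w k * X w) = expect (\<lambda>w. \<integral>t. (w(k := t)) k * X (w(k := t)) \<partial>gaussian)"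
    by (rule expect_resample) (rule tame_integrable[OF tame_mult[OF tame_coordinate[OF k] X]])
  also have "\<dots> = expect (\<lambda>w. \<integral>t. partial k X (w(k := t)) \<partial>gaussian)"
  proof (rule arg_cong[of _ _ expect], rule ext)
    fix w
    obtain C m where 1: "C \<ge> 0" "\<And>w. \<bar>X w\<bar> \<le> C * (1 + (\<Sum>i<n. \<bar>w i\<bar>)) ^ m"
      using tame_growth(1)[OF X] by (rule poly_growthE) blast
    obtain D l where 2: "D \<ge> 0" "\<And>w. \<bar>partial k X w\<bar> \<le> D * (1 + (\<Sum>i<n. \<bar>w i\<bar>)) ^ l"
      using tame_growth(2)[OF X] by (rule poly_growthE) blast
    have c: "continuous_on UNIV (\<lambda>t. partial k X (w(k := t)))"
      by (rule continuous_on_compose2[OF C1_fun_continuous(2)[OF tame_C1[OF X]] continuous_on_update]) simp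
    show "(\<integral>t. (w(k := t)) k * X (w(k := t)) \<partial>gaussian) = (\<integral>t. partial k X (w(k := t)) \<partial>gaussian)"
      using gaussian_ibp[OF C1_fun_has_partial[OF tame_C1[OF X]] c growth_slice[OF 1] growth_slice[OF 2]]
      by (simp only: fun_upd_same)
  qed
  also have "\<dots> = expect (partial k X)"
    by (rule expect_resample[symmetric]) (rule tame_integrable[OF X])
  finally show ?thesis .
qed

section \<open>Polynomials of Gaussian coordinates\<close>

text \<open>Polynomials in the first \<open>n\<close> coordinates, with \<open>d\<close> an upper
  bound for the degree. Generating them by one multiplication with a coordinate at a time gives an
  induction in which each step exposes a factor \<open>w i\<close>, ready for integration by
  parts.\<close>

inductive polyfun :: "nat \<Rightarrow> nat \<Rightarrow> ((nat \<Rightarrow> real) \<Rightarrow> real) \<Rightarrow> bool" for n where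
  const: "polyfun n d (\<lambda>_. c)"
| times: "polyfun n d X \<Longrightarrow> i < n \<Longrightarrow> polyfun n (Suc d) (\<lambda>w. w i * X w)"
| add: "polyfun n d X \<Longrightarrow> polyfun n d Y \<Longrightarrow> polyfun n d (\<lambda>w. X w + Y w)"

lemma polyfun_mono:
  assumes "polyfun n d X" "d \<le> e" "n \<le> m"
  shows "polyfun m e X"
  using assms
proof (induction arbitrary: e)
  case (times d X i)
  then obtain e' where "e = Suc e'" "d \<le> e'" using Suc_le_D by fastforce
  then show ?case using times by (auto intro!: polyfun.times)
qed (auto intro: polyfun.intros)

lemma polyfun_scale: "polyfun n d X \<Longrightarrow> polyfun n d (\<lambda>w. c * X w)"
proof (induction rule: polyfun.induct)
  case (times d X i)
  from polyfun.times[OF times.IH times.hyps(2)] show ?case by (simp add: mult_ac)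
qed (auto intro: polyfun.intros simp: distrib_left)

lemma polyfun_mult:
  assumes "polyfun n d X" "polyfun n e Y"
  shows "polyfun n (d + e) (\<lambda>w. X w * Y w)"
  using assms(1)
proof (induction rule: polyfun.induct)
  case (const d c)
  show ?case by (rule polyfun_mono[OF polyfun_scale[OF assms(2)]]) auto
next
  case (times d X i)
  from polyfun.times[OF times.IH times.hyps(2)] show ?case by (simp add: mult.assoc)
next
  case (add d X Y)
  then show ?case by (auto simp: distrib_right intro: polyfun.intros)
qed

lemma polyfun_diff: "polyfun n d X \<Longrightarrow> polyfun n d Y \<Longrightarrow> polyfun n d (\<lambda>w. X w - Y w)"
  using polyfun.add[OF _ polyfun_scale[where c = "-1"]] by fastforce

lemma polyfun_sum: "(\<And>i. i \<in> I \<Longrightarrow> polyfun n d (X i)) \<Longrightarrow> polyfun n d (\<lambda>w. \<Sum>i\<in>I. X i w)"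
  by (induction I rule: infinite_finite_induct) (auto intro: polyfun.intros)

lemma polyfun_power2: "polyfun n d X \<Longrightarrow> polyfun n (2 * d) (\<lambda>w. (X w)\<^sup>2)"
  using polyfun_mult[of n d X d X] by (simp add: power2_eq_square mult_2)

lemma polyfun_tame: "polyfun n d X \<Longrightarrow> tame n X"
  by (induction rule: polyfun.induct) (auto intro: tame_add tame_mult tame_const tame_coordinate)

lemmas polyfun_C1 = tame_C1[OF polyfun_tame]
lemmas polyfun_integrable = tame_integrable(1)[OF polyfun_tame]

lemma polyfun_0_const: "polyfun n d X \<Longrightarrow> d = 0 \<Longrightarrow> X = (\<lambda>_. X w)"
proof (induction rule: polyfun.induct)
  case (add d X Y)
  then have "X v + Y v = X w + Y w" for v by metis
  then show ?case by auto
qed auto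

lemma partial_times_coordinate:
  assumes "C1_fun X"
  shows "partial k (\<lambda>w. w i * X w) = (\<lambda>w. (if i = k then X w else 0) + w i * partial k X w)"
  by (subst C1_fun_mult(2)[OF C1_fun_coordinate(1) assms]) (auto simp: C1_fun_coordinate(2))

lemma partial_scale: "C1_fun X \<Longrightarrow> partial k (\<lambda>w. c * X w) = (\<lambda>w. c * partial k X w)"
  by (subst C1_fun_mult(2)[OF C1_fun_const(1)]) (auto simp: C1_fun_const(2))

lemma C1_fun_scale: "C1_fun X \<Longrightarrow> C1_fun (\<lambda>w. c * X w)"
  by (rule C1_fun_mult(1)[OF C1_fun_const(1)])

lemma C1_fun_diff:
  assumes "C1_fun X" "C1_fun Y"
  shows "C1_fun (\<lambda>w. X w - Y w)"
    and "partial k (\<lambda>w. X w - Y w) = (\<lambda>w. partial k X w - partial k Y w)"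
  using C1_fun_add(1)[OF assms(1) C1_fun_scale[OF assms(2), of "-1"]]
    C1_fun_add(2)[OF assms(1) C1_fun_scale[OF assms(2), of "-1"]] partial_scale[OF assms(2), of k "-1"]
  by simp_all

lemma C1_fun_sum:
  assumes "\<And>i. i \<in> I \<Longrightarrow> C1_fun (X i)"
  shows "C1_fun (\<lambda>w. \<Sum>i\<in>I. X i w)"
    and "partial k (\<lambda>w. \<Sum>i\<in>I. X i w) = (\<lambda>w. \<Sum>i\<in>I. partial k (X i) w)"
proof -
  have "C1_fun (\<lambda>w. \<Sum>i\<in>I. X i w) \<and> partial k (\<lambda>w. \<Sum>i\<in>I. X i w) = (\<lambda>w. \<Sum>i\<in>I. partial k (X i) w)"
    using assms
  proof (induction I rule: infinite_finite_induct)
    case (insert x F)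
    then show ?case by (simp add: C1_fun_add)
  qed (auto simp: C1_fun_const)
  then show "C1_fun (\<lambda>w. \<Sum>i\<in>I. X i w)"
    "partial k (\<lambda>w. \<Sum>i\<in>I. X i w) = (\<lambda>w. \<Sum>i\<in>I. partial k (X i) w)" by auto
qed

lemma polyfun_partial_aux:
  "polyfun n d X \<Longrightarrow> polyfun n (d - 1) (partial k X) \<and> (d = 0 \<longrightarrow> partial k X = (\<lambda>_. 0))"
proof (induction rule: polyfun.induct)
  case (const d c)
  then show ?case by (auto simp: C1_fun_const(2) intro: polyfun.const)
next
  case (times d X i)
  have 1: "polyfun n d (\<lambda>w. w i * partial k X w)"
  proof (cases d)
    case 0
    with times.IH show ?thesis by (simp add: polyfun.const)
  next
    case (Suc d')
    with times show ?thesis by (auto intro: polyfun.times)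
  qed
  have 2: "polyfun n d (\<lambda>w. if i = k then X w else 0)"
    using times.hyps polyfun.const[of n d 0] by (cases "i = k") auto
  show ?case
    using polyfun.add[OF 2 1] by (simp add: partial_times_coordinate[OF polyfun_C1[OF times.hyps(1)]])
next
  case (add d X Y)
  then show ?case by (auto simp: C1_fun_add(2)[OF polyfun_C1 polyfun_C1] intro!: polyfun.add)
qed

lemma polyfun_partial: "polyfun n d X \<Longrightarrow> polyfun n (d - 1) (partial k X)"
  using polyfun_partial_aux by blast

lemma polyfun_partial': "polyfun n d X \<Longrightarrow> polyfun n d (partial k X)"
  using polyfun_mono[OF polyfun_partial] by simp

lemma polyfun_0_partial: "polyfun n 0 X \<Longrightarrow> partial k X = (\<lambda>_. 0)"
  using polyfun_partial_aux by blast

lemma partial_outside: "polyfun n d X \<Longrightarrow> n \<le> k \<Longrightarrow> partial k X = (\<lambda>_. 0)"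
proof (induction rule: polyfun.induct)
  case (times d X i)
  then show ?case by (auto simp: partial_times_coordinate[OF polyfun_C1])
qed (auto simp: C1_fun_const(2) C1_fun_add(2)[OF polyfun_C1 polyfun_C1])

lemma partial_commute: "polyfun n d X \<Longrightarrow> partial k (partial l X) = partial l (partial k X)"
proof (induction rule: polyfun.induct)
  case (const d c)
  then show ?case by (simp add: C1_fun_const(2))
next
  case (add d X Y)
  then show ?case
    by (simp add: C1_fun_add(2)[OF polyfun_C1 polyfun_C1] C1_fun_add(2)[OF polyfun_C1[OF polyfun_partial] polyfun_C1[OF polyfun_partial]])
next
  case (times d X i)
  note C = polyfun_C1[OF times.hyps(1)] polyfun_C1[OF polyfun_partial[OF times.hyps(1)]]
  have C0: "C1_fun (\<lambda>w. if b then X w else 0)" "partial k (\<lambda>w. if b then X w else 0) = (\<lambda>w. if b then partial k X w else 0)" for b k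
    using C by (cases b; simp add: C1_fun_const)+
  have C1: "C1_fun (\<lambda>w. w i * partial k X w)" for k by (rule C1_fun_mult(1)[OF C1_fun_coordinate(1) C(2)])
  show ?case
    by (auto simp: partial_times_coordinate C C0 C1 C1_fun_add(2)[OF C0(1) C1] times.IH fun_eq_iff)
qed

text \<open>Feeds the induction on the degree in \<open>chaos_isometry\<close>, where the explicit
  factors \<open>w i\<close> are integrated away. The degree is a variable tied to
  \<open>Suc d\<close> by an equation so that rule induction applies.\<close>

lemma polyfun_decompose:
  "polyfun n k X \<Longrightarrow> k = Suc d \<Longrightarrow> \<exists>c Y. (\<forall>i<n. polyfun n d (Y i)) \<and> X = (\<lambda>w. c + (\<Sum>i<n. w i * Y i w))"
proof (induction rule: polyfun.induct)
  case (const k c)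
  have "(\<lambda>_. c) = (\<lambda>w. c + (\<Sum>i<n. w i * (\<lambda>_ _. 0) i w))" by simp
  then show ?case using polyfun.const[of n d 0] by (intro exI[of _ c] exI[of _ "\<lambda>_ _. 0"]) auto
next
  case (times k X i)
  have "w i * X w = (\<Sum>j<n. w j * (if j = i then X w else 0))" for w :: "nat \<Rightarrow> real"
    using times.hyps(2) by (simp add: if_distrib[of "\<lambda>x. _ * x"] sum.delta cong: if_cong)
  then have "(\<lambda>w. w i * X w) = (\<lambda>w. 0 + (\<Sum>j<n. w j * (if j = i then X w else 0)))" by auto
  moreover have "polyfun n d (\<lambda>w. if j = i then X w else 0)" for j
    using times polyfun.const[of n d 0] by (cases "j = i") auto
  ultimately show ?case
    by (intro exI[of _ 0] exI[of _ "\<lambda>j w. if j = i then X w else 0"] conjI) auto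
next
  case (add k X Y)
  then obtain c Z c' Z' where "\<forall>i<n. polyfun n d (Z i)" "X = (\<lambda>w. c + (\<Sum>i<n. w i * Z i w))"
    "\<forall>i<n. polyfun n d (Z' i)" "Y = (\<lambda>w. c' + (\<Sum>i<n. w i * Z' i w))" by blast
  then show ?case
    by (intro exI[of _ "c + c'"] exI[of _ "\<lambda>i w. Z i w + Z' i w"])
       (auto intro: polyfun.add simp: distrib_left sum.distrib)
qed

subsection \<open>Iterated derivatives\<close>

fun deriv_list :: "nat list \<Rightarrow> ((nat \<Rightarrow> real) \<Rightarrow> real) \<Rightarrow> (nat \<Rightarrow> real) \<Rightarrow> real" where
  "deriv_list [] X = X"
| "deriv_list (i # xs) X = deriv_list xs (partial i X)"

lemma deriv_list_append: "deriv_list (xs @ ys) X = deriv_list ys (deriv_list xs X)"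
  by (induction xs arbitrary: X) auto

lemma polyfun_deriv_list: "polyfun n d X \<Longrightarrow> polyfun n (d - length xs) (deriv_list xs X)"
proof (induction xs arbitrary: X d)
  case (Cons a xs)
  from Cons.IH[OF polyfun_partial[OF Cons.prems, of a]] show ?case by simp
qed simp

lemma polyfun_deriv_list': "polyfun n d X \<Longrightarrow> polyfun n d (deriv_list xs X)"
  using polyfun_mono[OF polyfun_deriv_list] by simp

lemma deriv_list_zero: "deriv_list xs (\<lambda>_. 0) = (\<lambda>_. 0)"
  by (induction xs) (auto simp: C1_fun_const(2))

lemma deriv_list_high: "polyfun n d X \<Longrightarrow> d < length xs \<Longrightarrow> deriv_list xs X = (\<lambda>_. 0)"
proof (induction xs arbitrary: X d)
  case (Cons a xs)
  show ?case
  proof (cases d)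
    case 0
    then show ?thesis using Cons.prems by (simp add: polyfun_0_partial deriv_list_zero)
  next
    case (Suc d')
    then show ?thesis using Cons.IH[OF polyfun_partial[OF Cons.prems(1), of a]] Cons.prems by simp
  qed
qed simp

lemma deriv_list_add:
  "polyfun n d X \<Longrightarrow> polyfun n e Y \<Longrightarrow> deriv_list xs (\<lambda>w. X w + Y w) = (\<lambda>w. deriv_list xs X w + deriv_list xs Y w)"
proof (induction xs arbitrary: X Y d e)
  case (Cons a xs)
  show ?case
    using Cons.IH[OF polyfun_partial[OF Cons.prems(1)] polyfun_partial[OF Cons.prems(2)]]
    by (simp add: C1_fun_add(2)[OF polyfun_C1[OF Cons.prems(1)] polyfun_C1[OF Cons.prems(2)]])
qed simp

lemma deriv_list_scale:
  "polyfun n d X \<Longrightarrow> deriv_list xs (\<lambda>w. c * X w) = (\<lambda>w. c * deriv_list xs X w)"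
proof (induction xs arbitrary: X d)
  case (Cons a xs)
  show ?case
    using Cons.IH[OF polyfun_partial[OF Cons.prems(1)]]
    by (simp add: partial_scale[OF polyfun_C1[OF Cons.prems(1)]])
qed simp

lemma deriv_list_sum:
  "(\<And>i. i \<in> I \<Longrightarrow> polyfun n d (X i)) \<Longrightarrow>
    deriv_list xs (\<lambda>w. \<Sum>i\<in>I. X i w) = (\<lambda>w. \<Sum>i\<in>I. deriv_list xs (X i) w)"
proof (induction I rule: infinite_finite_induct)
  case (insert x F)
  then show ?case
    using deriv_list_add[OF insert.prems polyfun_sum, of x F d X xs] by simp
qed (auto simp: deriv_list_zero)

lemma deriv_list_partial: "polyfun n d X \<Longrightarrow> deriv_list xs (partial i X) = partial i (deriv_list xs X)"
proof (induction xs arbitrary: X d)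
  case (Cons a xs)
  show ?case
    using Cons.IH[OF polyfun_partial[OF Cons.prems, of a]] partial_commute[OF Cons.prems] by simp
qed simp

lemma deriv_list_snoc: "deriv_list (xs @ [i]) X = partial i (deriv_list xs X)"
  by (simp add: deriv_list_append)

lemma deriv_list_mset:
  "mset xs = mset ys \<Longrightarrow> polyfun n d X \<Longrightarrow> deriv_list xs X = deriv_list ys X"
proof (induction xs arbitrary: ys X d)
  case (Cons a xs)
  then have "a \<in> set ys" using mset_eq_setD[OF Cons.prems(1)] by auto
  then obtain us vs where ys: "ys = us @ a # vs" by (meson split_list)
  with Cons.prems have m: "mset xs = mset (us @ vs)" by simp
  have "deriv_list ys X = deriv_list vs (partial a (deriv_list us X))" by (simp add: ys deriv_list_append)
  also have "\<dots> = deriv_list (us @ vs) (partial a X)"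
    by (simp only: deriv_list_partial[OF Cons.prems(2), symmetric] deriv_list_append)
  finally show ?case using Cons.IH[OF m polyfun_partial[OF Cons.prems(2)]] by simp
qed simp

text \<open>Index tuples instead of multi-indices: a sum over them is a full tensor contraction in
  which each multi-index is counted with its multiplicity, so no multi-index factorials
  occur.\<close>

definition index_lists :: "nat \<Rightarrow> nat \<Rightarrow> nat list set" where
  "index_lists n m = {xs. set xs \<subseteq> {..<n} \<and> length xs = m}"

lemma finite_index_lists [simp]: "finite (index_lists n m)"
  unfolding index_lists_def by (rule finite_lists_length_eq) simp

lemma index_lists_0 [simp]: "index_lists n 0 = {[]}"
  by (auto simp: index_lists_def)

lemma length_index_lists: "xs \<in> index_lists n m \<Longrightarrow> length xs = m"
  by (simp add: index_lists_def)

lemma sum_index_lists_Suc: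
  "(\<Sum>xs\<in>index_lists n (Suc m). f xs) = (\<Sum>i<n. \<Sum>xs\<in>index_lists n m. f (i # xs))"
proof -
  have "index_lists n (Suc m) = (\<lambda>(i, xs). i # xs) ` ({..<n} \<times> index_lists n m)"
  proof (intro equalityI subsetI)
    fix x assume "x \<in> index_lists n (Suc m)"
    then show "x \<in> (\<lambda>(i, xs). i # xs) ` ({..<n} \<times> index_lists n m)"
      by (cases x) (auto simp: index_lists_def image_iff)
  qed (auto simp: index_lists_def)
  moreover have "inj_on (\<lambda>(i, xs). i # xs) ({..<n} \<times> index_lists n m)" by (auto simp: inj_on_def)
  ultimately show ?thesis
    by (simp add: sum.reindex sum.cartesian_product case_prod_beta')
qed

lemma sum_index_lists_add:
  "(\<Sum>xs\<in>index_lists n (a + b). f xs) = (\<Sum>xs\<in>index_lists n a. \<Sum>ys\<in>index_lists n b. f (xs @ ys))"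
  by (induction a arbitrary: f) (simp_all add: sum_index_lists_Suc)

lemma sum_index_lists_1: "(\<Sum>xs\<in>index_lists n (Suc 0). f xs) = (\<Sum>i<n. f [i])"
  by (simp add: sum_index_lists_Suc)

text \<open>Symmetric tensors. Summing derivatives against one of them makes the order of
  differentiation irrelevant, which turns the product rule into a binomial formula.\<close>

definition sym_weight :: "(nat list \<Rightarrow> real) \<Rightarrow> bool" where
  "sym_weight c \<longleftrightarrow> (\<forall>xs ys. mset xs = mset ys \<longrightarrow> c xs = c ys)"

lemma sym_weight_eq: "sym_weight c \<Longrightarrow> mset xs = mset ys \<Longrightarrow> c xs = c ys"
  unfolding sym_weight_def by blast

lemma sym_weight_append:
  assumes "sym_weight c"
  shows "sym_weight (\<lambda>xs. c (ys @ xs))"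
  unfolding sym_weight_def
proof (intro allI impI)
  fix xs zs :: "nat list" assume "mset xs = mset zs"
  then show "c (ys @ xs) = c (ys @ zs)" by (intro sym_weight_eq[OF assms]) simp
qed

lemma sym_weight_Cons: "sym_weight c \<Longrightarrow> sym_weight (\<lambda>xs. c (i # xs))"
  using sym_weight_append[of c "[i]"] by simp

lemma sym_weight_deriv: 
  assumes "polyfun n d X"
  shows "sym_weight (\<lambda>xs. f (deriv_list xs X))"
  unfolding sym_weight_def
proof (intro allI impI)
  fix xs ys assume "mset xs = mset (ys :: nat list)"
  then have "deriv_list xs X = deriv_list ys X" using assms by (rule deriv_list_mset)
  then show "f (deriv_list xs X) = f (deriv_list ys X)" by simp
qed

text \<open>At most one derivative can hit the factor \<open>w i\<close>, and by symmetry of the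
  weight the \<open>m\<close> choices of that derivative contribute equally. For
  \<open>m = 0\<close> the truncated \<open>m - 1\<close> is harmless because of the factor
  \<open>real m\<close>.\<close>

lemma weighted_leibniz_coordinate:
  assumes "polyfun n d X" "sym_weight c" "i < n"
  shows "(\<Sum>xs\<in>index_lists n m. c xs * deriv_list xs (\<lambda>w. w i * X w) w) =
     w i * (\<Sum>xs\<in>index_lists n m. c xs * deriv_list xs X w) +
     real m * (\<Sum>xs\<in>index_lists n (m - 1). c (i # xs) * deriv_list xs X w)"
  using assms(1,2)
proof (induction m arbitrary: X c d)
  case 0
  then show ?case by simp
next
  case (Suc m)
  note X = Suc.prems(1)
  have swap: "c (j # i # xs) = c (i # j # xs)" for j xs
    by (rule sym_weight_eq[OF Suc.prems(2)]) simp
  have st: "deriv_list xs (partial j (\<lambda>w. w i * X w)) w =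
      (if j = i then deriv_list xs X w else 0) + deriv_list xs (\<lambda>w. w i * partial j X w) w" for xs j
  proof -
    have p: "polyfun n (Suc d) (\<lambda>w. w i * partial j X w)" by (rule polyfun.times[OF polyfun_partial'[OF X] assms(3)])
    have q: "polyfun n d (\<lambda>w. if i = j then X w else 0)" using X polyfun.const[of n d 0] by (cases "i = j") auto
    have r: "deriv_list xs (\<lambda>w. if i = j then X w else 0) w = (if j = i then deriv_list xs X w else 0)"
      by (cases "i = j") (simp_all add: deriv_list_zero)
    have "deriv_list xs (partial j (\<lambda>w. w i * X w)) = deriv_list xs (\<lambda>w. (if i = j then X w else 0) + w i * partial j X w)"
      by (simp only: partial_times_coordinate[OF polyfun_C1[OF X]])
    also have "\<dots> = (\<lambda>w. deriv_list xs (\<lambda>w. if i = j then X w else 0) w + deriv_list xs (\<lambda>w. w i * partial j X w) w)"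
      by (rule deriv_list_add[OF q p])
    finally show ?thesis by (simp only: r)
  qed
  have "(\<Sum>xs\<in>index_lists n (Suc m). c xs * deriv_list xs (\<lambda>w. w i * X w) w) =
     (\<Sum>j<n. \<Sum>xs\<in>index_lists n m. c (j # xs) * ((if j = i then deriv_list xs X w else 0) + deriv_list xs (\<lambda>w. w i * partial j X w) w))"
    by (simp only: sum_index_lists_Suc deriv_list.simps st)
  also have "\<dots> = (\<Sum>j<n. if j = i then \<Sum>xs\<in>index_lists n m. c (j # xs) * deriv_list xs X w else 0) +
      (\<Sum>j<n. \<Sum>xs\<in>index_lists n m. c (j # xs) * deriv_list xs (\<lambda>w. w i * partial j X w) w)"
    unfolding sum.distrib[symmetric]
  proof (intro sum.cong refl)
    fix j
    show "(\<Sum>xs\<in>index_lists n m. c (j # xs) * ((if j = i then deriv_list xs X w else 0) + deriv_list xs (\<lambda>w. w i * partial j X w) w)) =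
      (if j = i then \<Sum>xs\<in>index_lists n m. c (j # xs) * deriv_list xs X w else 0) +
      (\<Sum>xs\<in>index_lists n m. c (j # xs) * deriv_list xs (\<lambda>w. w i * partial j X w) w)"
      by (simp add: distrib_left sum.distrib)
  qed
  also have "(\<Sum>j<n. if j = i then \<Sum>xs\<in>index_lists n m. c (j # xs) * deriv_list xs X w else 0)
      = (\<Sum>xs\<in>index_lists n m. c (i # xs) * deriv_list xs X w)"
    using assms(3) by (simp add: sum.delta)
  also have "(\<Sum>j<n. \<Sum>xs\<in>index_lists n m. c (j # xs) * deriv_list xs (\<lambda>w. w i * partial j X w) w) =
     (\<Sum>j<n. w i * (\<Sum>xs\<in>index_lists n m. c (j # xs) * deriv_list xs (partial j X) w) +
     real m * (\<Sum>xs\<in>index_lists n (m - 1). c (j # i # xs) * deriv_list xs (partial j X) w))"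
    by (rule sum.cong[OF refl], rule Suc.IH[OF polyfun_partial'[OF X] sym_weight_Cons[OF Suc.prems(2)]])
  also have "\<dots> = w i * (\<Sum>xs\<in>index_lists n (Suc m). c xs * deriv_list xs X w) +
     real m * (\<Sum>j<n. \<Sum>xs\<in>index_lists n (m - 1). c (i # j # xs) * deriv_list (j # xs) X w)"
    unfolding sum.distrib sum_distrib_left[symmetric] sum_index_lists_Suc deriv_list.simps
    by (simp only: swap)
  also have "real m * (\<Sum>j<n. \<Sum>xs\<in>index_lists n (m - 1). c (i # j # xs) * deriv_list (j # xs) X w)
      = real m * (\<Sum>xs\<in>index_lists n m. c (i # xs) * deriv_list xs X w)"
    by (cases m) (simp_all add: sum_index_lists_Suc)
  finally show ?case by (simp add: distrib_right)
qed

text \<open>All ways to choose which \<open>k\<close> of the \<open>m\<close> derivatives fall on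
  \<open>X\<close> give the same sum, because the weight is symmetric; hence the binomial
  coefficient.\<close>

lemma weighted_leibniz:
  assumes "polyfun n d X" "polyfun n e Y" "sym_weight c"
  shows "(\<Sum>us\<in>index_lists n m. c us * deriv_list us (\<lambda>w. X w * Y w) w) =
     (\<Sum>k\<le>m. real (m choose k) * (\<Sum>xs\<in>index_lists n k. \<Sum>ys\<in>index_lists n (m - k).
        c (xs @ ys) * deriv_list xs X w * deriv_list ys Y w))"
  using assms
proof (induction m arbitrary: X Y c d e)
  case 0
  then show ?case by simp
next
  case (Suc m)
  note X = Suc.prems(1) and Y = Suc.prems(2) and c = Suc.prems(3)
  define h where "h k = (\<Sum>xs\<in>index_lists n k. \<Sum>ys\<in>index_lists n (Suc m - k).
        c (xs @ ys) * deriv_list xs X w * deriv_list ys Y w)" for k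
  have st: "deriv_list us (partial i (\<lambda>w. X w * Y w)) w =
     deriv_list us (\<lambda>w. partial i X w * Y w) w + deriv_list us (\<lambda>w. X w * partial i Y w) w" for us i
    unfolding C1_fun_mult(2)[OF polyfun_C1[OF X] polyfun_C1[OF Y]]
    by (subst deriv_list_add[OF polyfun_mult[OF polyfun_partial[OF X] Y] polyfun_mult[OF X polyfun_partial[OF Y]]]) simp
  have swap: "c (i # xs @ ys) = c (xs @ i # ys)" for i xs ys
    by (rule sym_weight_eq[OF c]) simp
  have "(\<Sum>us\<in>index_lists n (Suc m). c us * deriv_list us (\<lambda>w. X w * Y w) w) =
     (\<Sum>i<n. (\<Sum>us\<in>index_lists n m. c (i # us) * deriv_list us (\<lambda>w. partial i X w * Y w) w) +
            (\<Sum>us\<in>index_lists n m. c (i # us) * deriv_list us (\<lambda>w. X w * partial i Y w) w))"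
    by (simp add: sum_index_lists_Suc st distrib_left sum.distrib)
  also have "\<dots> = (\<Sum>i<n. (\<Sum>k\<le>m. real (m choose k) * (\<Sum>xs\<in>index_lists n k. \<Sum>ys\<in>index_lists n (m - k).
        c (i # xs @ ys) * deriv_list xs (partial i X) w * deriv_list ys Y w)) +
      (\<Sum>k\<le>m. real (m choose k) * (\<Sum>xs\<in>index_lists n k. \<Sum>ys\<in>index_lists n (m - k).
        c (i # xs @ ys) * deriv_list xs X w * deriv_list ys (partial i Y) w)))"
    by (intro sum.cong refl arg_cong2[where f = "(+)"] Suc.IH[OF polyfun_partial[OF X] Y sym_weight_Cons[OF c]]
       Suc.IH[OF X polyfun_partial[OF Y] sym_weight_Cons[OF c]])
  also have "\<dots> = (\<Sum>k\<le>m. real (m choose k) * (\<Sum>i<n. \<Sum>xs\<in>index_lists n k. \<Sum>ys\<in>index_lists n (m - k).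
        c (i # xs @ ys) * deriv_list xs (partial i X) w * deriv_list ys Y w)) +
      (\<Sum>k\<le>m. real (m choose k) * (\<Sum>xs\<in>index_lists n k. \<Sum>i<n. \<Sum>ys\<in>index_lists n (m - k).
        c (i # xs @ ys) * deriv_list xs X w * deriv_list ys (partial i Y) w))"
    unfolding sum.distrib sum_distrib_left
    by (intro arg_cong2[where f = "(+)"]; subst sum.swap; intro sum.cong refl; subst (2) sum.swap; simp)
  also have "\<dots> = (\<Sum>k\<le>m. real (m choose k) * h (Suc k)) + (\<Sum>k\<le>m. real (m choose k) * h k)"
    unfolding h_def
    by (intro arg_cong2[where f = "(+)"] sum.cong refl)
       (simp_all add: sum_index_lists_Suc Suc_diff_le swap)
  \<comment> \<open>Pascal's rule merges the two sums: the additional derivative went either to X or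
    to Y.\<close>
  also have "\<dots> = (\<Sum>k\<le>Suc m. real (Suc m choose k) * h k)"
  proof -
    have "(\<Sum>k\<le>Suc m. real (Suc m choose k) * h k) = h 0 + (\<Sum>k\<le>m. real (Suc m choose Suc k) * h (Suc k))"
      by (simp only: sum.atMost_Suc_shift; simp)
    also have "\<dots> = h 0 + (\<Sum>k\<le>m. real (m choose Suc k) * h (Suc k)) + (\<Sum>k\<le>m. real (m choose k) * h (Suc k))"
      by (simp only: binomial_Suc_Suc of_nat_add distrib_right sum.distrib; simp)
    also have "h 0 + (\<Sum>k\<le>m. real (m choose Suc k) * h (Suc k)) = (\<Sum>k\<le>Suc m. real (m choose k) * h k)"
      by (simp only: sum.atMost_Suc_shift; simp)
    finally show ?thesis by simp
  qed
  finally show ?case unfolding h_def .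
qed

subsection \<open>Chaos coefficients and the Poincare inequality\<close>

text \<open>By Stroock's formula the m-th chaos kernel of a polynomial is its expected m-fold
  derivative over m!. Divided by \<open>fact m\<close>, this form is therefore the scalar product of
  the m-th chaos components of X and Y.\<close>

definition chaos_form :: "nat \<Rightarrow> nat \<Rightarrow> ((nat \<Rightarrow> real) \<Rightarrow> real) \<Rightarrow> ((nat \<Rightarrow> real) \<Rightarrow> real) \<Rightarrow> real" where
  "chaos_form n m X Y = (\<Sum>xs\<in>index_lists n m. expect (deriv_list xs X) * expect (deriv_list xs Y))"

lemma chaos_form_0: "chaos_form n 0 X Y = expect X * expect Y"
  by (simp add: chaos_form_def)

lemma chaos_form_nonneg: "0 \<le> chaos_form n m X X"
  unfolding chaos_form_def by (intro sum_nonneg) simp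

lemma chaos_form_partial: "(\<Sum>i<n. chaos_form n m (partial i X) (partial i Y)) = chaos_form n (Suc m) X Y"
  by (simp add: chaos_form_def sum_index_lists_Suc)

lemma chaos_form_high: "polyfun n d X \<Longrightarrow> d < m \<Longrightarrow> chaos_form n m X Y = 0"
  unfolding chaos_form_def by (intro sum.neutral ballI) (simp add: deriv_list_high length_index_lists)

lemma chaos_form_add:
  assumes "polyfun n d X" "polyfun n e Y"
  shows "chaos_form n m (\<lambda>w. X w + Y w) Z = chaos_form n m X Z + chaos_form n m Y Z"
  unfolding chaos_form_def deriv_list_add[OF assms]
  by (simp add: polyfun_integrable[OF polyfun_deriv_list[OF assms(1)]]
      polyfun_integrable[OF polyfun_deriv_list[OF assms(2)]] distrib_right sum.distrib)

lemma chaos_form_sum: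
  assumes "\<And>i. i \<in> I \<Longrightarrow> polyfun n d (X i)"
  shows "chaos_form n m (\<lambda>w. \<Sum>i\<in>I. X i w) Z = (\<Sum>i\<in>I. chaos_form n m (X i) Z)"
  using assms
proof (induction I rule: infinite_finite_induct)
  case (insert x F)
  then show ?case using chaos_form_add[OF insert.prems polyfun_sum, of x F d X m Z] by simp
qed (simp_all add: chaos_form_def deriv_list_zero)

text \<open>Leibniz' rule against the symmetric weight formed by the expected derivatives of Y:
  where \<open>w i\<close> is left undifferentiated, integration by parts replaces it by a
  derivative of X; elsewhere it absorbs one index, which passes to Y.\<close>

lemma chaos_form_times:
  assumes X: "polyfun n d X" and Y: "polyfun n e Y" and i: "i < n"
  shows "chaos_form n m (\<lambda>w. w i * X w) Y = chaos_form n m (partial i X) Y + real m * chaos_form n (m - 1) X (partial i Y)"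
proof -
  note int = polyfun_integrable[OF polyfun_deriv_list[OF polyfun.times[OF X i]]]
    polyfun_integrable[OF polyfun.times[OF polyfun_deriv_list[OF X] i]] polyfun_integrable[OF polyfun_deriv_list[OF X]]
  have "chaos_form n m (\<lambda>w. w i * X w) Y =
     expect (\<lambda>w. \<Sum>xs\<in>index_lists n m. expect (deriv_list xs Y) * deriv_list xs (\<lambda>w. w i * X w) w)"
    using int unfolding chaos_form_def by (simp add: mult.commute)
  also have "\<dots> = expect (\<lambda>w. (\<Sum>xs\<in>index_lists n m. expect (deriv_list xs Y) * (w i * deriv_list xs X w)) +
     (\<Sum>xs\<in>index_lists n (m - 1). real m * (expect (deriv_list (i # xs) Y) * deriv_list xs X w)))"
    by (subst weighted_leibniz_coordinate[OF X _ i])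
       (auto intro: sym_weight_deriv[OF Y] simp: sum_distrib_left mult_ac)
  also have "\<dots> = (\<Sum>xs\<in>index_lists n m. expect (deriv_list xs Y) * expect (\<lambda>w. w i * deriv_list xs X w)) +
     (\<Sum>xs\<in>index_lists n (m - 1). real m * (expect (deriv_list (i # xs) Y) * expect (deriv_list xs X)))"
    using int by simp
  also have "\<dots> = chaos_form n m (partial i X) Y + real m * chaos_form n (m - 1) X (partial i Y)"
    unfolding chaos_form_def
    by (simp add: wiener_ibp[OF polyfun_tame[OF polyfun_deriv_list[OF X]] i] deriv_list_partial[OF X] sum_distrib_left mult_ac)
  finally show ?thesis .
qed

lemma chaos_form_const: "chaos_form n m (\<lambda>_. c) Y = (if m = 0 then c * expect Y else 0)"
proof (cases m)
  case 0
  then show ?thesis using wiener.prob_space by (simp add: chaos_form_0)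
next
  case (Suc k)
  then show ?thesis using chaos_form_high[OF polyfun.const[of n 0 c], of m Y] by simp
qed

text \<open>Both sides obey the same recursion when a factor \<open>w i\<close> is taken out of X:
  integration by parts on the left, \<open>chaos_form_times\<close> on the right. The free upper
  limit \<open>M\<close> is there because the induction hypothesis is applied with two different
  limits.\<close>

theorem chaos_isometry:
  assumes "polyfun n d X" "polyfun n e Y" "d \<le> M"
  shows "expect (\<lambda>w. X w * Y w) = (\<Sum>m\<le>M. chaos_form n m X Y / fact m)"
  using assms
proof (induction d arbitrary: X Y e M)
  case 0
  then obtain c where "X = (\<lambda>_. c)" using polyfun_0_const by blast
  moreover have "(\<Sum>m\<le>M. (if m = 0 then c * expect Y else 0) / fact m) = c * expect Y"
    by (subst sum.atMost_shift) simp
  ultimately show ?case by (simp add: chaos_form_const)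
next
  case (Suc d)
  note Y = Suc.prems(2)
  obtain c Z where Z: "\<And>i. i < n \<Longrightarrow> polyfun n d (Z i)" and X: "X = (\<lambda>w. c + (\<Sum>i<n. w i * Z i w))"
    using polyfun_decompose[OF Suc.prems(1) refl] by blast
  obtain M' where M: "M = Suc M'" "d \<le> M'" using Suc.prems(3) Suc_le_D by fastforce
  have st: "expect (\<lambda>w. (w i * Z i w) * Y w) = (\<Sum>m\<le>M. chaos_form n m (\<lambda>w. w i * Z i w) Y / fact m)" if i: "i < n" for i
  proof -
    note Zi = Z[OF i]
    have "expect (\<lambda>w. (w i * Z i w) * Y w) = expect (partial i (\<lambda>w. Z i w * Y w))"
      using wiener_ibp[OF polyfun_tame[OF polyfun_mult[OF Zi Y]] i] by (simp add: mult.assoc)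
    also have "\<dots> = expect (\<lambda>w. partial i (Z i) w * Y w) + expect (\<lambda>w. Z i w * partial i Y w)"
      unfolding C1_fun_mult(2)[OF polyfun_C1[OF Zi] polyfun_C1[OF Y]]
      by (intro Bochner_Integration.integral_add polyfun_integrable[OF polyfun_mult[OF polyfun_partial[OF Zi] Y]]
          polyfun_integrable[OF polyfun_mult[OF Zi polyfun_partial[OF Y]]])
    also have "\<dots> = (\<Sum>m\<le>M. chaos_form n m (partial i (Z i)) Y / fact m) + (\<Sum>m\<le>M'. chaos_form n m (Z i) (partial i Y) / fact m)"
      using Suc.IH[OF polyfun_partial'[OF Zi] Y, of M i] Suc.IH[OF Zi polyfun_partial[OF Y], of M' i] M by simp
    \<comment> \<open>Index shift with m / m! = 1 / (m - 1)!; the new term at 0 vanishes through its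
      factor \<open>real m\<close>.\<close>
    also have "(\<Sum>m\<le>M'. chaos_form n m (Z i) (partial i Y) / fact m) =
        (\<Sum>m\<le>M. real m * chaos_form n (m - 1) (Z i) (partial i Y) / fact m)"
      unfolding M(1) by (subst sum.atMost_Suc_shift) (simp add: field_simps del: of_nat_Suc)
    also have "(\<Sum>m\<le>M. chaos_form n m (partial i (Z i)) Y / fact m) + \<dots> = (\<Sum>m\<le>M. chaos_form n m (\<lambda>w. w i * Z i w) Y / fact m)"
      by (simp add: chaos_form_times[OF Zi Y i] add_divide_distrib sum.distrib)
    finally show ?thesis .
  qed
  have p: "polyfun n (Suc d) (\<lambda>w. w i * Z i w)" if "i < n" for i using polyfun.times[OF Z that] that by blast
  have "expect (\<lambda>w. X w * Y w) = expect (\<lambda>w. c * Y w + (\<Sum>i<n. (w i * Z i w) * Y w))"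
    by (simp add: X distrib_right sum_distrib_right)
  also have "\<dots> = c * expect Y + (\<Sum>i<n. expect (\<lambda>w. (w i * Z i w) * Y w))"
    using polyfun_integrable[OF polyfun_mult[OF p Y]] polyfun_integrable[OF Y]
    by (subst Bochner_Integration.integral_add) (auto intro!: Bochner_Integration.integral_sum)
  also have "(\<Sum>i<n. expect (\<lambda>w. (w i * Z i w) * Y w)) = (\<Sum>m\<le>M. (\<Sum>i<n. chaos_form n m (\<lambda>w. w i * Z i w) Y) / fact m)"
    by (simp add: st sum_divide_distrib) (rule sum.swap)
  also have "c * expect Y = (\<Sum>m\<le>M. chaos_form n m (\<lambda>_. c) Y / fact m)"
    unfolding chaos_form_const by (subst sum.atMost_shift) simp
  also have "(\<Sum>m\<le>M. chaos_form n m (\<lambda>_. c) Y / fact m) + (\<Sum>m\<le>M. (\<Sum>i<n. chaos_form n m (\<lambda>w. w i * Z i w) Y) / fact m)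
     = (\<Sum>m\<le>M. chaos_form n m X Y / fact m)"
  proof -
    have P: "polyfun n (Suc d) (\<lambda>w. \<Sum>i<n. w i * Z i w)" by (intro polyfun_sum p) simp
    have "chaos_form n m X Y = chaos_form n m (\<lambda>_. c) Y + chaos_form n m (\<lambda>w. \<Sum>i<n. w i * Z i w) Y" for m
      unfolding X by (rule chaos_form_add[OF polyfun.const P])
    moreover have "chaos_form n m (\<lambda>w. \<Sum>i<n. w i * Z i w) Y = (\<Sum>i<n. chaos_form n m (\<lambda>w. w i * Z i w) Y)" for m
      by (rule chaos_form_sum[of _ n "Suc d"]) (simp add: p)
    ultimately have "chaos_form n m X Y = chaos_form n m (\<lambda>_. c) Y + (\<Sum>i<n. chaos_form n m (\<lambda>w. w i * Z i w) Y)" for m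
      by simp
    then show ?thesis by (simp add: add_divide_distrib sum.distrib)
  qed
  finally show ?case .
qed

lemma expect_poly_add: "polyfun n d X \<Longrightarrow> polyfun m e Y \<Longrightarrow> expect (\<lambda>w. X w + Y w) = expect X + expect Y"
  by (intro Bochner_Integration.integral_add polyfun_integrable)

lemma expect_poly_diff: "polyfun n d X \<Longrightarrow> polyfun m e Y \<Longrightarrow> expect (\<lambda>w. X w - Y w) = expect X - expect Y"
  by (intro Bochner_Integration.integral_diff polyfun_integrable)

lemma measure_wiener_UNIV [simp]: "measure wiener UNIV = 1"
  using wiener.prob_space by simp

lemma expect_const [simp]: "expect (\<lambda>_. c) = c"
  using wiener.prob_space by simp

lemma chaos_norm:
  assumes "polyfun n d X"
  shows "expect (\<lambda>w. (X w)\<^sup>2) = (\<Sum>m\<le>d. chaos_form n m X X / fact m)"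
  using chaos_isometry[OF assms assms order_refl] by (simp add: power2_eq_square)

text \<open>A derivative lowers the chaos order by one, and the ratio of the two factorials produces
  the weight \<open>real m\<close>: the gradient norm is the quadratic form of the number
  operator.\<close>

lemma energy_chaos:
  assumes X: "polyfun n d X"
  shows "(\<Sum>i<n. expect (\<lambda>w. (partial i X w)\<^sup>2)) = (\<Sum>m\<le>d. real m * (chaos_form n m X X / fact m))"
proof -
  have "(\<Sum>i<n. expect (\<lambda>w. (partial i X w)\<^sup>2)) = (\<Sum>m\<le>d. (\<Sum>i<n. chaos_form n m (partial i X) (partial i X)) / fact m)"
    by (simp add: chaos_norm[OF polyfun_partial'[OF X]] sum_divide_distrib) (rule sum.swap)
  also have "\<dots> = (\<Sum>m\<le>d. chaos_form n (Suc m) X X / fact m)"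
    by (simp only: chaos_form_partial)
  also have "\<dots> = (\<Sum>m\<le>d. real (Suc m) * (chaos_form n (Suc m) X X / fact (Suc m)))"
    by (intro sum.cong refl) (simp add: field_simps del: of_nat_Suc)
  also have "\<dots> = (\<Sum>m\<le>Suc d. real m * (chaos_form n m X X / fact m))"
    by (simp only: sum.atMost_Suc_shift; simp)
  also have "\<dots> = (\<Sum>m\<le>d. real m * (chaos_form n m X X / fact m))"
    using chaos_form_high[OF X, of "Suc d" X] by simp
  finally show ?thesis .
qed

lemma chaos_norm_Suc:
  assumes "polyfun n d X"
  shows "expect (\<lambda>w. (X w)\<^sup>2) - (expect X)\<^sup>2 = (\<Sum>m\<le>d. if m = 0 then 0 else chaos_form n m X X / fact m)"
proof -
  have "(\<Sum>m\<le>d. chaos_form n m X X / fact m) = (\<Sum>m\<le>d. (if m = 0 then 0 else chaos_form n m X X / fact m) + (if m = 0 then (expect X)\<^sup>2 else 0))"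
    by (intro sum.cong refl) (auto simp: chaos_form_0 power2_eq_square)
  then show ?thesis by (simp add: chaos_norm[OF assms] sum.distrib sum.delta)
qed

text \<open>Outside chaos 0 the weight \<open>real m\<close> in \<open>energy_chaos\<close> is at
  least 1. For a polynomial of degree d it is at most d, which gives the reverse inequality that
  follows.\<close>

lemma poincare:
  assumes "polyfun n d X"
  shows "expect (\<lambda>w. (X w)\<^sup>2) \<le> (expect X)\<^sup>2 + (\<Sum>i<n. expect (\<lambda>w. (partial i X w)\<^sup>2))"
proof -
  have "expect (\<lambda>w. (X w)\<^sup>2) - (expect X)\<^sup>2 \<le> (\<Sum>i<n. expect (\<lambda>w. (partial i X w)\<^sup>2))"
    unfolding chaos_norm_Suc[OF assms] energy_chaos[OF assms]
  proof (intro sum_mono)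
    fix m
    have "0 \<le> chaos_form n m X X / fact m" using chaos_form_nonneg by simp
    then show "(if m = 0 then 0 else chaos_form n m X X / fact m) \<le> real m * (chaos_form n m X X / fact m)"
      using mult_right_mono[of 1 "real m" "chaos_form n m X X / fact m"] by (cases m) auto
  qed
  then show ?thesis by simp
qed

lemma inverse_poincare:
  assumes "polyfun n d X"
  shows "(\<Sum>i<n. expect (\<lambda>w. (partial i X w)\<^sup>2)) \<le> real d * (expect (\<lambda>w. (X w)\<^sup>2) - (expect X)\<^sup>2)"
  unfolding chaos_norm_Suc[OF assms] energy_chaos[OF assms] sum_distrib_left
proof (intro sum_mono)
  fix m assume "m \<in> {..d}"
  then show "real m * (chaos_form n m X X / fact m) \<le> real d * (if m = 0 then 0 else chaos_form n m X X / fact m)"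
    using chaos_form_nonneg[of n m X] by (auto intro!: divide_right_mono mult_right_mono)
qed

section \<open>Cauchy-Schwarz and hypercontractivity for polynomials\<close>

lemma expect_cauchy_schwarz:
  assumes X: "X \<in> borel_measurable wiener" "integrable wiener (\<lambda>w. (X w)\<^sup>2)"
    and Y: "Y \<in> borel_measurable wiener" "integrable wiener (\<lambda>w. (Y w)\<^sup>2)"
  shows "integrable wiener (\<lambda>w. X w * Y w)"
    and "(expect (\<lambda>w. X w * Y w))\<^sup>2 \<le> expect (\<lambda>w. (X w)\<^sup>2) * expect (\<lambda>w. (Y w)\<^sup>2)"
proof -
  note [measurable] = X(1) Y(1)
  show int: "integrable wiener (\<lambda>w. X w * Y w)"
  proof (rule Bochner_Integration.integrable_bound)
    show "integrable wiener (\<lambda>w. (X w)\<^sup>2 + (Y w)\<^sup>2)" using X Y by simp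
    have "norm (x * y) \<le> norm (x\<^sup>2 + y\<^sup>2)" for x y :: real
    proof -
      have "2 * (\<bar>x\<bar> * \<bar>y\<bar>) \<le> x\<^sup>2 + y\<^sup>2" using sum_squares_bound[of "\<bar>x\<bar>" "\<bar>y\<bar>"] by simp
      moreover have "0 \<le> \<bar>x\<bar> * \<bar>y\<bar>" by simp
      ultimately show ?thesis by (simp only: real_norm_def abs_mult; linarith)
    qed
    then show "AE w in wiener. norm (X w * Y w) \<le> norm ((X w)\<^sup>2 + (Y w)\<^sup>2)"
      by (intro AE_I2)
  qed measurable
  define A B C where "A = expect (\<lambda>w. (X w)\<^sup>2)" and "B = expect (\<lambda>w. (Y w)\<^sup>2)" and "C = expect (\<lambda>w. X w * Y w)"
  have A: "0 \<le> A" and B: "0 \<le> B" unfolding A_def B_def by simp_all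
  have q: "0 \<le> s\<^sup>2 * A + 2 * (s * t) * C + t\<^sup>2 * B" for s t
  proof -
    have "0 \<le> expect (\<lambda>w. (s * X w + t * Y w)\<^sup>2)" by simp
    also have "\<dots> = expect (\<lambda>w. s\<^sup>2 * (X w)\<^sup>2 + 2 * (s * t) * (X w * Y w) + t\<^sup>2 * (Y w)\<^sup>2)"
      by (simp add: power2_eq_square algebra_simps)
    also have "\<dots> = s\<^sup>2 * A + 2 * (s * t) * C + t\<^sup>2 * B"
      unfolding A_def B_def C_def using X Y int by simp
    finally show ?thesis .
  qed
  show "(expect (\<lambda>w. X w * Y w))\<^sup>2 \<le> expect (\<lambda>w. (X w)\<^sup>2) * expect (\<lambda>w. (Y w)\<^sup>2)"
  proof (cases "B = 0")
    case True
    \<comment> \<open>For B = 0 the quadratic form is affine in t; this pair (s, t) makes it equal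
      to a negative multiple of the square of C.\<close>
    have "0 \<le> - (C\<^sup>2 * (A + 2))" using q[of C "- (A + 1)"] True by (simp add: power2_eq_square algebra_simps)
    then have "C\<^sup>2 * (A + 2) \<le> 0" by simp
    then have "C\<^sup>2 = 0" using A by (simp add: mult_le_0_iff)
    then show ?thesis using A B by (simp add: A_def[symmetric] B_def[symmetric] C_def[symmetric])
  next
    case False
    then have "0 < B" using B by simp
    have "0 \<le> B * (A * B - C\<^sup>2)" using q[of B "- C"] by (simp add: power2_eq_square algebra_simps)
    then have "0 \<le> A * B - C\<^sup>2" using \<open>0 < B\<close> by (simp add: zero_le_mult_iff)
    then show ?thesis by (simp add: A_def[symmetric] B_def[symmetric] C_def[symmetric])
  qed
qed

lemma poly_cauchy_schwarz:
  assumes "polyfun n d X" "polyfun n e Y"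
  shows "(expect (\<lambda>w. X w * Y w))\<^sup>2 \<le> expect (\<lambda>w. (X w)\<^sup>2) * expect (\<lambda>w. (Y w)\<^sup>2)"
  by (intro expect_cauchy_schwarz polyfun_integrable[OF polyfun_power2] tame_measurable polyfun_tame) (fact assms)+

text \<open>Expanding the square leaves products of two squares, and Cauchy-Schwarz on each pair
  uses the scalar inequality twice. The constant is unchanged however large \<open>I\<close> is, so
  no dependence on the number of coordinates arises.\<close>

lemma hypercontractive_vector:
  assumes C: "C \<ge> 0" "\<And>X. polyfun n d X \<Longrightarrow> expect (\<lambda>w. (X w) ^ 4) \<le> C * (expect (\<lambda>w. (X w)\<^sup>2))\<^sup>2"
    and X: "\<And>i. i \<in> I \<Longrightarrow> polyfun n d (X i)"
  shows "expect (\<lambda>w. (\<Sum>i\<in>I. (X i w)\<^sup>2)\<^sup>2) \<le> C * (\<Sum>i\<in>I. expect (\<lambda>w. (X i w)\<^sup>2))\<^sup>2"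
proof -
  note p = polyfun_mult[OF polyfun_power2[OF X] polyfun_power2[OF X]]
  have "expect (\<lambda>w. (X i w)\<^sup>2 * (X j w)\<^sup>2) \<le> C * (expect (\<lambda>w. (X i w)\<^sup>2) * expect (\<lambda>w. (X j w)\<^sup>2))"
    if "i \<in> I" "j \<in> I" for i j
  proof (rule power2_le_imp_le)
    have "(expect (\<lambda>w. (X i w)\<^sup>2 * (X j w)\<^sup>2))\<^sup>2 \<le> expect (\<lambda>w. ((X i w)\<^sup>2)\<^sup>2) * expect (\<lambda>w. ((X j w)\<^sup>2)\<^sup>2)"
      by (rule poly_cauchy_schwarz) (rule polyfun_power2[OF X], fact)+
    also have "\<dots> \<le> (C * (expect (\<lambda>w. (X i w)\<^sup>2))\<^sup>2) * (C * (expect (\<lambda>w. (X j w)\<^sup>2))\<^sup>2)"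
      using C(2)[OF X[OF that(1)]] C(2)[OF X[OF that(2)]] C(1)
      by (intro mult_mono) (simp_all flip: power_mult)
    finally show "(expect (\<lambda>w. (X i w)\<^sup>2 * (X j w)\<^sup>2))\<^sup>2 \<le> (C * (expect (\<lambda>w. (X i w)\<^sup>2) * expect (\<lambda>w. (X j w)\<^sup>2)))\<^sup>2"
      by (simp add: power2_eq_square mult_ac)
    show "0 \<le> C * (expect (\<lambda>w. (X i w)\<^sup>2) * expect (\<lambda>w. (X j w)\<^sup>2))" using C(1) by simp
  qed
  then have "(\<Sum>i\<in>I. \<Sum>j\<in>I. expect (\<lambda>w. (X i w)\<^sup>2 * (X j w)\<^sup>2)) \<le> (\<Sum>i\<in>I. \<Sum>j\<in>I. C * (expect (\<lambda>w. (X i w)\<^sup>2) * expect (\<lambda>w. (X j w)\<^sup>2)))"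
    by (intro sum_mono)
  moreover have "expect (\<lambda>w. (\<Sum>i\<in>I. (X i w)\<^sup>2)\<^sup>2) = (\<Sum>i\<in>I. \<Sum>j\<in>I. expect (\<lambda>w. (X i w)\<^sup>2 * (X j w)\<^sup>2))"
    using polyfun_integrable[OF p] by (simp add: power2_eq_square sum_product)
  moreover have "C * (\<Sum>i\<in>I. a i)\<^sup>2 = (\<Sum>i\<in>I. \<Sum>j\<in>I. C * (a i * a j))" for a :: "_ \<Rightarrow> real"
    by (simp add: power2_eq_square flip: sum_distrib_left sum_distrib_right)
  ultimately show ?thesis by (simp only:)
qed

text \<open>Solves a quadratic self-bound. In \<open>hypercontractive\<close> the root of the fourth
  moment is estimated by an expression that contains it again, and this absorbs it.\<close>

lemma square_le_linear_imp_le: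
  fixes x z k :: real
  assumes "x\<^sup>2 \<le> k * x * z + z\<^sup>2" "0 \<le> k" "0 \<le> z"
  shows "x \<le> (k + 1) * z"
proof (rule ccontr)
  assume "\<not> x \<le> (k + 1) * z"
  then have x: "(k + 1) * z < x" by simp
  have "0 \<le> k * z" using assms by simp
  then have zx: "z \<le> x" and x0: "0 < x" using x assms(3) unfolding distrib_right by linarith+
  have "z\<^sup>2 \<le> x * z" using zx assms(3) by (simp add: power2_eq_square mult_right_mono)
  then have "x\<^sup>2 \<le> x * ((k + 1) * z)" using assms(1) by (simp add: algebra_simps)
  moreover have "x * ((k + 1) * z) < x * x" using x x0 by (rule mult_strict_left_mono)
  ultimately show False by (simp add: power2_eq_square)
qed

text \<open>Apply the Poincare inequality to the square of the centred polynomial; differentiation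
  lowers the degree, and its cost is controlled by the inverse Poincare inequality.\<close>

lemma hypercontractive:
  "\<exists>C\<ge>0. \<forall>n X. polyfun n d X \<longrightarrow> expect (\<lambda>w. (X w) ^ 4) \<le> C * (expect (\<lambda>w. (X w)\<^sup>2))\<^sup>2"
proof (induction d)
  case 0
  have "expect (\<lambda>w. (X w) ^ 4) \<le> 1 * (expect (\<lambda>w. (X w)\<^sup>2))\<^sup>2" if X: "polyfun n 0 X" for n X
  proof -
    obtain c where "X = (\<lambda>_. c)" using polyfun_0_const[OF X] by blast
    then show ?thesis by simp
  qed
  then show ?case by (intro exI[of _ 1]) auto
next
  case (Suc d)
  then obtain C where C: "C \<ge> 0" "\<And>n X. polyfun n d X \<Longrightarrow> expect (\<lambda>w. (X w) ^ 4) \<le> C * (expect (\<lambda>w. (X w)\<^sup>2))\<^sup>2"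
    by blast
  \<comment> \<open>The constant that \<open>square_le_linear_imp_le\<close> returns: 4 comes from
    squaring the derivative 2 Y Y', \<open>Suc d\<close> from the inverse Poincare inequality, and C
    from the induction hypothesis.\<close>
  define K where "K = 4 * sqrt C * real (Suc d) + 1"
  have K: "K \<ge> 0" using C(1) by (simp add: K_def)
  have "expect (\<lambda>w. (X w) ^ 4) \<le> (8 * K\<^sup>2 + 8) * (expect (\<lambda>w. (X w)\<^sup>2))\<^sup>2" if X: "polyfun n (Suc d) X" for n X
  proof -
    define a where "a = expect X"
    define Y where "Y w = X w - a" for w
    have Y: "polyfun n (Suc d) Y" unfolding Y_def by (rule polyfun_diff[OF X polyfun.const])
    have EY: "expect Y = 0" unfolding Y_def using expect_poly_diff[OF X polyfun.const[of n 0]] by (simp add: a_def)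
    define z where "z = expect (\<lambda>w. (Y w)\<^sup>2)"
    have z: "0 \<le> z" by (simp add: z_def)
    have X2: "expect (\<lambda>w. (X w)\<^sup>2) = z + a\<^sup>2"
    proof -
      have "expect (\<lambda>w. (X w)\<^sup>2) = expect (\<lambda>w. (Y w)\<^sup>2 + (2 * a * Y w + a\<^sup>2))"
        by (simp add: Y_def power2_eq_square algebra_simps)
      also have "\<dots> = z + (2 * a * expect Y + a\<^sup>2)"
        using polyfun_integrable[OF Y] polyfun_integrable[OF polyfun_power2[OF Y]] by (simp add: z_def wiener.prob_space[simplified])
      finally show ?thesis by (simp add: EY)
    qed
    have pow4: "((Y w)\<^sup>2)\<^sup>2 = (Y w) ^ 4" for w by simp
    define y where "y = expect (\<lambda>w. (Y w) ^ 4)"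
    have y: "0 \<le> y" by (simp add: y_def)
    have grad: "(\<Sum>i<n. expect (\<lambda>w. (partial i Y w)\<^sup>2)) \<le> real (Suc d) * z"
      using inverse_poincare[OF Y] by (simp add: EY z_def)
    have pd: "polyfun n d (partial i Y)" for i using polyfun_partial[OF Y] by simp
    define g where "g = expect (\<lambda>w. (\<Sum>i<n. (partial i Y w)\<^sup>2)\<^sup>2)"
    have "g \<le> C * (\<Sum>i<n. expect (\<lambda>w. (partial i Y w)\<^sup>2))\<^sup>2"
      unfolding g_def by (rule hypercontractive_vector[where n = n and d = d, OF C(1) C(2)]) (auto simp: pd)
    also have "\<dots> \<le> C * (real (Suc d) * z)\<^sup>2"
      using grad C(1) by (intro mult_left_mono power_mono) (auto intro: sum_nonneg)
    also have "\<dots> = (sqrt C * real (Suc d) * z)\<^sup>2" using C(1) by (simp add: power_mult_distrib)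
    finally have g: "g \<le> (sqrt C * real (Suc d) * z)\<^sup>2" .
    have par: "partial i (\<lambda>w. (Y w)\<^sup>2) = (\<lambda>w. 2 * (Y w * partial i Y w))" for i
      unfolding power2_eq_square C1_fun_mult(2)[OF polyfun_C1[OF Y] polyfun_C1[OF Y]] by (simp add: algebra_simps)
    have pS: "polyfun n (2 * d) (\<lambda>w. \<Sum>i<n. (partial i Y w)\<^sup>2)" by (intro polyfun_sum polyfun_power2 pd)
    have "y \<le> z\<^sup>2 + (\<Sum>i<n. expect (\<lambda>w. (2 * (Y w * partial i Y w))\<^sup>2))"
      using poincare[OF polyfun_power2[OF Y]] unfolding par by (simp add: y_def z_def flip: power_mult)
    also have "(\<Sum>i<n. expect (\<lambda>w. (2 * (Y w * partial i Y w))\<^sup>2)) = 4 * expect (\<lambda>w. (Y w)\<^sup>2 * (\<Sum>i<n. (partial i Y w)\<^sup>2))"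
      using polyfun_integrable[OF polyfun_mult[OF polyfun_power2[OF Y] polyfun_power2[OF pd]]]
      by (simp add: power_mult_distrib sum_distrib_left)
    also have "expect (\<lambda>w. (Y w)\<^sup>2 * (\<Sum>i<n. (partial i Y w)\<^sup>2)) \<le> sqrt y * (sqrt C * real (Suc d) * z)"
    proof -
      have "(expect (\<lambda>w. (Y w)\<^sup>2 * (\<Sum>i<n. (partial i Y w)\<^sup>2)))\<^sup>2 \<le> y * g"
        using poly_cauchy_schwarz[OF polyfun_power2[OF Y] pS] unfolding y_def g_def by (simp only: pow4)
      also have "\<dots> \<le> y * (sqrt C * real (Suc d) * z)\<^sup>2" using g y by (rule mult_left_mono)
      also have "\<dots> = (sqrt y * (sqrt C * real (Suc d) * z))\<^sup>2" using y by (simp add: power_mult_distrib)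
      finally show ?thesis by (rule power2_le_imp_le) (use C(1) y z in simp)
    qed
    finally have "y \<le> z\<^sup>2 + 4 * (sqrt y * (sqrt C * real (Suc d) * z))" by simp
    then have "(sqrt y)\<^sup>2 \<le> (4 * sqrt C * real (Suc d)) * sqrt y * z + z\<^sup>2"
      unfolding real_sqrt_pow2[OF y] by (simp only: mult_ac add_ac)
    then have "sqrt y \<le> K * z" unfolding K_def by (rule square_le_linear_imp_le) (use C(1) z in auto)
    then have "(sqrt y)\<^sup>2 \<le> (K * z)\<^sup>2" using y by (intro power_mono) auto
    then have yK: "y \<le> K\<^sup>2 * z\<^sup>2" using y by (simp add: power_mult_distrib)
    \<comment> \<open>Undoes the centring by applying (u + v)^2 \<le> 2 u^2 + 2 v^2 twice.\<close>
    have pt: "(X w) ^ 4 \<le> 8 * (Y w) ^ 4 + 8 * a ^ 4" for w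
    proof -
      have 1: "(u + v)\<^sup>2 \<le> 2 * u\<^sup>2 + 2 * v\<^sup>2" for u v :: real
        using zero_le_power2[of "u - v"] by (simp add: power2_eq_square algebra_simps)
      have "((Y w + a)\<^sup>2)\<^sup>2 \<le> (2 * (Y w)\<^sup>2 + 2 * a\<^sup>2)\<^sup>2" by (rule power_mono[OF 1]) simp
      also have "\<dots> \<le> 2 * (2 * (Y w)\<^sup>2)\<^sup>2 + 2 * (2 * a\<^sup>2)\<^sup>2" by (rule 1)
      finally show ?thesis by (simp add: Y_def power_mult_distrib flip: power_mult)
    qed
    have Y4: "integrable wiener (\<lambda>w. (Y w) ^ 4)" and X4: "integrable wiener (\<lambda>w. (X w) ^ 4)"
      using polyfun_integrable[OF polyfun_power2[OF polyfun_power2[OF Y]]] polyfun_integrable[OF polyfun_power2[OF polyfun_power2[OF X]]]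
      by (simp_all flip: power_mult)
    have "expect (\<lambda>w. (X w) ^ 4) \<le> expect (\<lambda>w. 8 * (Y w) ^ 4 + 8 * a ^ 4)"
      using Y4 X4 pt by (intro integral_mono) auto
    also have "\<dots> = 8 * y + 8 * a ^ 4" using Y4 wiener.prob_space by (simp add: y_def)
    also have "\<dots> \<le> 8 * (K\<^sup>2 * z\<^sup>2) + 8 * (a\<^sup>2)\<^sup>2" using yK by (simp flip: power_mult)
    also have "\<dots> \<le> (8 * K\<^sup>2 + 8) * (z + a\<^sup>2)\<^sup>2"
    proof -
      have 1: "z\<^sup>2 \<le> (z + a\<^sup>2)\<^sup>2" by (rule power_mono) (use z in auto)
      have 2: "(a\<^sup>2)\<^sup>2 \<le> (z + a\<^sup>2)\<^sup>2" by (rule power_mono) (use z in auto)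
      have 3: "K\<^sup>2 * z\<^sup>2 \<le> K\<^sup>2 * (z + a\<^sup>2)\<^sup>2" using 1 by (rule mult_left_mono) simp
      show ?thesis unfolding distrib_right using 2 3 by linarith
    qed
    finally show ?thesis unfolding X2 .
  qed
  then show ?case by (intro exI[of _ "8 * K\<^sup>2 + 8"]) auto
qed

section \<open>The Ornstein-Uhlenbeck operator\<close>

text \<open>The generator of the Ornstein-Uhlenbeck semigroup in the first \<open>n\<close>
  coordinates; it acts on the m-th chaos as multiplication by - m.\<close>

definition ou :: "nat \<Rightarrow> ((nat \<Rightarrow> real) \<Rightarrow> real) \<Rightarrow> (nat \<Rightarrow> real) \<Rightarrow> real" where
  "ou n X w = (\<Sum>i<n. partial i (partial i X) w - w i * partial i X w)"

lemma ou_ibp: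
  assumes X: "\<And>i. i < n \<Longrightarrow> tame n (partial i X)" and H: "tame n H"
  shows "expect (\<lambda>w. ou n X w * H w) = - (\<Sum>i<n. expect (\<lambda>w. partial i X w * partial i H w))"
proof -
  have *: "integrable wiener (\<lambda>w. (partial i (partial i X) w - w i * partial i X w) * H w)"
    "expect (\<lambda>w. (partial i (partial i X) w - w i * partial i X w) * H w) = - expect (\<lambda>w. partial i X w * partial i H w)"
    if i: "i < n" for i
  proof -
    note t = tame_mult[OF X[OF i] H]
    note [measurable] = tame_measurable[OF X[OF i]] tame_measurable[OF H]
    have 1: "integrable wiener (\<lambda>w. w i * (partial i X w * H w))"
      by (rule tame_integrable(1)[OF tame_mult[OF tame_coordinate[OF i] t]])
    have 2: "integrable wiener (\<lambda>w. partial i (partial i X) w * H w)" "integrable wiener (\<lambda>w. partial i X w * partial i H w)"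
      using integrable_poly_growth[OF poly_growth_mult[OF tame_growth(2)[OF X[OF i]] tame_growth(1)[OF H]], of i]
        integrable_poly_growth[OF poly_growth_mult[OF tame_growth(1)[OF X[OF i]] tame_growth(2)[OF H]], of i] by simp_all
    have "expect (\<lambda>w. w i * (partial i X w * H w)) = expect (\<lambda>w. partial i (partial i X) w * H w + partial i X w * partial i H w)"
      using wiener_ibp[OF t i] C1_fun_mult(2)[OF tame_C1[OF X[OF i]] tame_C1[OF H], of i] by simp
    also have "\<dots> = expect (\<lambda>w. partial i (partial i X) w * H w) + expect (\<lambda>w. partial i X w * partial i H w)"
      using 2 by simp
    finally show "expect (\<lambda>w. (partial i (partial i X) w - w i * partial i X w) * H w) = - expect (\<lambda>w. partial i X w * partial i H w)"
      using 1 2 by (simp add: left_diff_distrib mult.assoc)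
    show "integrable wiener (\<lambda>w. (partial i (partial i X) w - w i * partial i X w) * H w)"
      using 1 2 by (simp add: left_diff_distrib mult.assoc)
  qed
  have "expect (\<lambda>w. ou n X w * H w) = (\<Sum>i<n. expect (\<lambda>w. (partial i (partial i X) w - w i * partial i X w) * H w))"
    unfolding ou_def sum_distrib_right by (intro Bochner_Integration.integral_sum *) simp
  then show ?thesis using * by (simp add: sum_negf)
qed

lemma polyfun_ou_summand:
  assumes "polyfun n d X" "i < n"
  shows "polyfun n d (\<lambda>w. partial i (partial i X) w - w i * partial i X w)"
proof -
  have "polyfun n d (\<lambda>w. w i * partial i X w)"
  proof (cases d)
    case 0
    then show ?thesis using polyfun_0_partial assms(1) by (simp add: polyfun.const)
  next
    case (Suc d')
    then show ?thesis using polyfun.times[OF polyfun_partial[OF assms(1)] assms(2), of i] by simp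
  qed
  then show ?thesis using polyfun_diff polyfun_partial'[OF polyfun_partial'[OF assms(1)]] by blast
qed

lemma polyfun_ou: "polyfun n d X \<Longrightarrow> polyfun n d (ou n X)"
  unfolding ou_def[abs_def] by (intro polyfun_sum polyfun_ou_summand) auto

lemma ou_ibp_poly:
  assumes "polyfun n d X" "tame n H"
  shows "expect (\<lambda>w. ou n X w * H w) = - (\<Sum>i<n. expect (\<lambda>w. partial i X w * partial i H w))"
  by (rule ou_ibp[OF polyfun_tame[OF polyfun_partial[OF assms(1)]] assms(2)])

lemma expect_ou: "polyfun n d X \<Longrightarrow> expect (ou n X) = 0"
  using ou_ibp_poly[of n d X "\<lambda>_. 1"] by (simp add: tame_const C1_fun_const(2))

text \<open>The only non-constant coefficient of the operator is the drift \<open>w k\<close>, and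
  differentiating it costs \<open>partial k X\<close>. Each derivative therefore lowers the chaos
  order by one.\<close>

lemma partial_ou:
  assumes X: "polyfun n d X"
  shows "partial k (ou n X) = (\<lambda>w. ou n (partial k X) w - partial k X w)"
proof (cases "k < n")
  case False
  then have 1: "partial k X = (\<lambda>_. 0)" and 2: "partial k (ou n X) = (\<lambda>_. 0)"
    using partial_outside[OF X] partial_outside[OF polyfun_ou[OF X]] by auto
  show ?thesis unfolding 2 unfolding 1 ou_def by (simp add: C1_fun_const(2))
next
  case True
  have C: "C1_fun (partial i X)" "C1_fun (partial i (partial i X))" "C1_fun (\<lambda>w. w i * partial i X w)" for i
    using polyfun_C1[OF polyfun_partial[OF X]] polyfun_C1[OF polyfun_partial[OF polyfun_partial[OF X]]]
    by (auto intro: C1_fun_mult(1)[OF C1_fun_coordinate(1)])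
  have st: "partial k (\<lambda>w. partial i (partial i X) w - w i * partial i X w) =
     (\<lambda>w. (partial i (partial i (partial k X)) w - w i * partial i (partial k X) w) - (if i = k then partial k X w else 0))" for i
  proof -
    have "partial k (partial i (partial i X)) = partial i (partial i (partial k X))"
      using partial_commute[OF polyfun_partial[OF X], of k i i] partial_commute[OF X, of k i] by simp
    then show ?thesis
      unfolding C1_fun_diff(2)[OF C(2,3)] partial_times_coordinate[OF C(1)]
      using partial_commute[OF X, of k i] by (auto simp: fun_eq_iff)
  qed
  have "partial k (ou n X) = (\<lambda>w. \<Sum>i<n. partial k (\<lambda>w. partial i (partial i X) w - w i * partial i X w) w)"
    unfolding ou_def[abs_def] by (rule C1_fun_sum(2)) (intro C1_fun_diff C)
  also have "\<dots> = (\<lambda>w. ou n (partial k X) w - partial k X w)"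
    unfolding st ou_def using True by (simp add: sum_subtractf sum.delta fun_eq_iff)
  finally show ?thesis .
qed

lemma deriv_list_diff:
  assumes "polyfun n d X" "polyfun n e Y"
  shows "deriv_list xs (\<lambda>w. X w - Y w) = (\<lambda>w. deriv_list xs X w - deriv_list xs Y w)"
  using deriv_list_add[OF assms(1) polyfun_scale[OF assms(2)], of xs "-1"] deriv_list_scale[OF assms(2), of xs "-1"]
  by simp

lemma deriv_list_ou:
  "polyfun n d X \<Longrightarrow> deriv_list xs (ou n X) = (\<lambda>w. ou n (deriv_list xs X) w - real (length xs) * deriv_list xs X w)"
proof (induction xs arbitrary: X d)
  case (Cons a xs)
  note p = polyfun_partial[OF Cons.prems, of a]
  have "deriv_list (a # xs) (ou n X) = (\<lambda>w. deriv_list xs (ou n (partial a X)) w - deriv_list xs (partial a X) w)"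
    by (simp add: partial_ou[OF Cons.prems] deriv_list_diff[OF polyfun_ou[OF p] p])
  then show ?case by (simp add: Cons.IH[OF p] algebra_simps fun_eq_iff)
qed (simp add: fun_eq_iff)

text \<open>Stands in for membership in the chaos of order r, without reference to Hermite
  expansions. Since \<open>r\<close> is real, lowering it by the number of derivatives involves no
  truncated subtraction.\<close>

definition eigen :: "nat \<Rightarrow> real \<Rightarrow> ((nat \<Rightarrow> real) \<Rightarrow> real) \<Rightarrow> bool" where
  "eigen n r X \<longleftrightarrow> (\<exists>d. polyfun n d X) \<and> ou n X = (\<lambda>w. - r * X w)"

lemma ou_scale: "polyfun n d X \<Longrightarrow> ou n (\<lambda>w. c * X w) = (\<lambda>w. c * ou n X w)"
  unfolding ou_def by (auto simp: partial_scale polyfun_C1 polyfun_C1[OF polyfun_partial] sum_distrib_left algebra_simps fun_eq_iff)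

lemma eigen_deriv_list:
  assumes "eigen n r X"
  shows "eigen n (r - real (length xs)) (deriv_list xs X)"
proof -
  obtain d where X: "polyfun n d X" and e: "ou n X = (\<lambda>w. - r * X w)" using assms by (auto simp: eigen_def)
  have "(\<lambda>w. ou n (deriv_list xs X) w - real (length xs) * deriv_list xs X w) = (\<lambda>w. - r * deriv_list xs X w)"
    using deriv_list_ou[OF X, of xs] deriv_list_scale[OF X, of xs "- r"] by (simp add: e)
  then have "ou n (deriv_list xs X) w = - (r - real (length xs)) * deriv_list xs X w" for w
    by (auto simp: fun_eq_iff algebra_simps)
  then show ?thesis unfolding eigen_def using polyfun_deriv_list[OF X] by blast
qed

text \<open>The basic move of the proof: a factor from a chaos of positive order is exchanged for
  its gradient, contracted with the gradient of the rest of the expectation.\<close>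

lemma eigen_ibp:
  assumes "eigen n r X" "tame n H"
  shows "r * expect (\<lambda>w. X w * H w) = (\<Sum>i<n. expect (\<lambda>w. partial i X w * partial i H w))"
proof -
  obtain d where X: "polyfun n d X" and e: "ou n X = (\<lambda>w. - r * X w)" using assms by (auto simp: eigen_def)
  show ?thesis using ou_ibp_poly[OF X assms(2)] by (simp add: e mult.assoc)
qed

lemma eigen_expect: "eigen n r X \<Longrightarrow> r \<noteq> 0 \<Longrightarrow> expect X = 0"
  using eigen_ibp[of n r X "\<lambda>_. 1"] by (simp add: tame_const C1_fun_const(2))

text \<open>The gradient form is symmetric, so both eigenvalues multiply the same expectation to the
  same value.\<close>

lemma eigen_orthogonal:
  assumes "eigen n r X" "eigen n s Y" "r \<noteq> s"
  shows "expect (\<lambda>w. X w * Y w) = 0"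
proof -
  have t: "tame n X" "tame n Y" using assms(1,2) polyfun_tame by (auto simp: eigen_def)
  have "r * expect (\<lambda>w. X w * Y w) = s * expect (\<lambda>w. X w * Y w)"
    using eigen_ibp[OF assms(1) t(2)] eigen_ibp[OF assms(2) t(1)] by (simp add: mult.commute)
  then show ?thesis using assms(3) by simp
qed

lemma expect_sum_mult_le:
  assumes "\<And>i. i \<in> I \<Longrightarrow> polyfun n d (X i)" "\<And>i. i \<in> I \<Longrightarrow> polyfun n d (Y i)"
  shows "(\<Sum>i\<in>I. expect (\<lambda>w. X i w * Y i w))\<^sup>2 \<le> (\<Sum>i\<in>I. expect (\<lambda>w. (X i w)\<^sup>2)) * (\<Sum>i\<in>I. expect (\<lambda>w. (Y i w)\<^sup>2))"
proof -
  let ?x = "\<lambda>i. sqrt (expect (\<lambda>w. (X i w)\<^sup>2))" and ?y = "\<lambda>i. sqrt (expect (\<lambda>w. (Y i w)\<^sup>2))"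
  have "\<bar>expect (\<lambda>w. X i w * Y i w)\<bar> \<le> ?x i * ?y i" if "i \<in> I" for i
    unfolding real_sqrt_mult[symmetric] using poly_cauchy_schwarz[OF assms(1,2)[OF that]] by (intro real_le_rsqrt) simp
  then have "\<bar>\<Sum>i\<in>I. expect (\<lambda>w. X i w * Y i w)\<bar> \<le> (\<Sum>i\<in>I. ?x i * ?y i)"
    by (intro order_trans[OF sum_abs] sum_mono)
  also have "\<dots> = (\<Sum>i\<in>I. \<bar>?x i\<bar> * \<bar>?y i\<bar>)" by simp
  also have "\<dots> \<le> L2_set ?x I * L2_set ?y I" by (rule L2_set_mult_ineq)
  finally have "\<bar>\<Sum>i\<in>I. expect (\<lambda>w. X i w * Y i w)\<bar>\<^sup>2 \<le> (L2_set ?x I * L2_set ?y I)\<^sup>2"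
    by (intro power_mono) auto
  then show ?thesis by (simp add: L2_set_def power_mult_distrib sum_nonneg)
qed

section \<open>Contractions of a normalised element of a fixed chaos\<close>

locale unit_chaos =
  fixes n p :: nat and F :: "(nat \<Rightarrow> real) \<Rightarrow> real"
  assumes poly: "polyfun n p F" and eigenF: "eigen n p F"
    and norm1: "expect (\<lambda>w. (F w)\<^sup>2) = 1" and p: "1 \<le> p"
begin

abbreviation T :: "nat \<Rightarrow> nat list set" where "T m \<equiv> index_lists n m"

definition D :: "nat list \<Rightarrow> (nat \<Rightarrow> real) \<Rightarrow> real" where "D xs = deriv_list xs F"

lemma polyD: "polyfun n p (D xs)"
  unfolding D_def by (rule polyfun_deriv_list'[OF poly])

lemma D_Nil: "D [] = F" by (simp add: D_def)

lemma D_mset: "mset xs = mset ys \<Longrightarrow> D xs = D ys"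
  unfolding D_def by (rule deriv_list_mset[OF _ poly])

lemma partial_D: "partial i (D xs) = D (i # xs)"
  unfolding D_def by (subst deriv_list_snoc[symmetric]) (rule deriv_list_mset[OF _ poly], simp)

lemma partial_F: "partial i F = D [i]"
  using partial_D[of i "[]"] by (simp add: D_Nil)

lemma eigenD: "length xs = m \<Longrightarrow> eigen n (real p - real m) (D xs)"
  using eigen_deriv_list[OF eigenF, of xs] by (simp add: D_def)

lemma D_high: "p < length xs \<Longrightarrow> D xs = (\<lambda>_. 0)"
  unfolding D_def by (rule deriv_list_high[OF poly])

text \<open>For \<open>length xs = p\<close> these are p! times the entries of the kernel of F; for
  every other length they vanish.\<close>

definition f :: "nat list \<Rightarrow> real" where "f xs = expect (D xs)"

lemma D_top:
  assumes "length xs = p"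
  shows "D xs = (\<lambda>_. f xs)"
proof -
  have "polyfun n 0 (D xs)" using polyfun_deriv_list[OF poly, of xs] assms by (simp add: D_def)
  then obtain c where "D xs = (\<lambda>_. c)" using polyfun_0_const by blast
  then show ?thesis by (simp add: f_def)
qed

lemma f_mset: "mset xs = mset ys \<Longrightarrow> f xs = f ys"
  unfolding f_def by (drule D_mset) simp

lemma sym_f: "sym_weight f"
  unfolding sym_weight_def using f_mset by blast

lemma expect_D_low: "length xs < p \<Longrightarrow> expect (D xs) = 0"
  using eigen_expect[OF eigenD[OF refl]] by simp

lemma sum_f_square: "(\<Sum>xs\<in>T p. (f xs)\<^sup>2) = fact p"
proof -
  have "1 = (\<Sum>m\<le>p. chaos_form n m F F / fact m)" using norm1 chaos_norm[OF poly] by simp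
  also have "\<dots> = (\<Sum>m\<le>p. if m = p then chaos_form n p F F / fact p else 0)"
  proof (intro sum.cong refl)
    fix m assume "m \<in> {..p}"
    have "chaos_form n m F F = 0" if "m < p"
      unfolding chaos_form_def using expect_D_low that by (intro sum.neutral) (auto simp: D_def length_index_lists)
    then show "chaos_form n m F F / fact m = (if m = p then chaos_form n p F F / fact p else 0)"
      using \<open>m \<in> {..p}\<close> by (cases "m < p") auto
  qed
  also have "\<dots> = chaos_form n p F F / fact p" by (simp add: sum.delta)
  finally have "chaos_form n p F F = fact p" by (simp add: field_simps)
  then show ?thesis by (simp add: chaos_form_def f_def D_def power2_eq_square)
qed

section \<open>Chaos expansions of the square of F and of \<open>\<Gamma>\<close>; the fourth
  moment\<close>

definition \<Gamma> :: "(nat \<Rightarrow> real) \<Rightarrow> real" where "\<Gamma> w = (\<Sum>i<n. (D [i] w)\<^sup>2)"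

text \<open>The variance of \<open>\<Gamma>\<close>, since its mean is \<open>p\<close> by
  \<open>expect_\<Gamma>\<close>.\<close>

definition V :: real where "V = expect (\<lambda>w. (\<Gamma> w - p)\<^sup>2)"

text \<open>The covariance of the square of F with \<open>\<Gamma>\<close>, since these have means 1
  and \<open>p\<close>. It is the coefficient of the main term in
  \<open>cov_cos_bound\<close>.\<close>

definition W :: real where "W = expect (\<lambda>w. (F w)\<^sup>2 * \<Gamma> w) - p"

lemma V_nonneg: "0 \<le> V" by (simp add: V_def)

lemma poly\<Gamma>: "polyfun n (2 * p) \<Gamma>"
  unfolding \<Gamma>_def[abs_def] by (intro polyfun_sum polyfun_power2 polyD)

lemma polyF2: "polyfun n (2 * p) (\<lambda>w. (F w)\<^sup>2)"
  by (rule polyfun_power2[OF poly])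

lemma partial_F2: "partial i (\<lambda>w. (F w)\<^sup>2) = (\<lambda>w. 2 * (F w * D [i] w))"
  unfolding power2_eq_square C1_fun_mult(2)[OF polyfun_C1[OF poly] polyfun_C1[OF poly]] partial_F by (simp add: algebra_simps)

lemma ou_F2: "ou n (\<lambda>w. (F w)\<^sup>2) w = 2 * \<Gamma> w - 2 * p * (F w)\<^sup>2"
proof -
  have F: "ou n F w = - real p * F w" using eigenF by (simp add: eigen_def)
  have pp: "partial i (partial i (\<lambda>w. (F w)\<^sup>2)) w = 2 * (D [i] w)\<^sup>2 + 2 * F w * D [i, i] w" for i
    unfolding partial_F2 partial_scale[OF polyfun_C1[OF polyfun_mult[OF poly polyD]]]
      C1_fun_mult(2)[OF polyfun_C1[OF poly] polyfun_C1[OF polyD]] partial_F partial_D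
    by (simp add: power2_eq_square algebra_simps)
  have "ou n (\<lambda>w. (F w)\<^sup>2) w = (\<Sum>i<n. 2 * (D [i] w)\<^sup>2 + 2 * F w * (D [i, i] w - w i * D [i] w))"
    unfolding ou_def by (simp only: pp) (simp add: partial_F2 algebra_simps)
  also have "\<dots> = 2 * \<Gamma> w + 2 * F w * ou n F w"
    by (simp add: sum.distrib sum_distrib_left \<Gamma>_def ou_def partial_F partial_D)
  finally show ?thesis by (simp add: F power2_eq_square)
qed

text \<open>The product rule L(F^2) = 2 \<Gamma> + 2 F L F together with L F = - p F, where L is
  \<open>ou n\<close>. Hence the chaos components of \<open>\<Gamma>\<close> are scalar multiples of
  those of F^2.\<close>

lemma \<Gamma>_eq: "\<Gamma> = (\<lambda>w. p * (F w)\<^sup>2 + 1 / 2 * ou n (\<lambda>w. (F w)\<^sup>2) w)"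
  by (simp add: ou_F2 fun_eq_iff field_simps)

text \<open>The squared norm of the m-th chaos component of F^2.\<close>

definition v :: "nat \<Rightarrow> real" where
  "v m = chaos_form n m (\<lambda>w. (F w)\<^sup>2) (\<lambda>w. (F w)\<^sup>2) / fact m"

lemma v_nonneg: "0 \<le> v m"
  unfolding v_def by (simp add: chaos_form_nonneg)

lemma v_0: "v 0 = 1"
  by (simp add: v_def chaos_form_0 norm1)

text \<open>Moving the operator in \<open>\<Gamma>_eq\<close> out past m derivatives costs m times
  the derivative, and what then stands under the operator has mean zero.\<close>

lemma expect_deriv_\<Gamma>:
  assumes "length xs = m"
  shows "expect (deriv_list xs \<Gamma>) = (real p - real m / 2) * expect (deriv_list xs (\<lambda>w. (F w)\<^sup>2))"
proof -
  note q = polyfun_deriv_list[OF polyF2, of xs]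
  have "deriv_list xs \<Gamma> = (\<lambda>w. p * deriv_list xs (\<lambda>w. (F w)\<^sup>2) w + 1 / 2 * deriv_list xs (ou n (\<lambda>w. (F w)\<^sup>2)) w)"
    unfolding \<Gamma>_eq
    by (subst deriv_list_add[OF polyfun_scale[OF polyF2] polyfun_scale[OF polyfun_ou[OF polyF2]]])
       (simp only: deriv_list_scale[OF polyF2] deriv_list_scale[OF polyfun_ou[OF polyF2]])
  also have "\<dots> = (\<lambda>w. (p - m / 2) * deriv_list xs (\<lambda>w. (F w)\<^sup>2) w + 1 / 2 * ou n (deriv_list xs (\<lambda>w. (F w)\<^sup>2)) w)"
    unfolding deriv_list_ou[OF polyF2] assms by (simp add: algebra_simps fun_eq_iff)
  finally have "expect (deriv_list xs \<Gamma>) = expect (\<lambda>w. (p - m / 2) * deriv_list xs (\<lambda>w. (F w)\<^sup>2) w) +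
      expect (\<lambda>w. 1 / 2 * ou n (deriv_list xs (\<lambda>w. (F w)\<^sup>2)) w)"
    by (simp only: expect_poly_add[OF polyfun_scale[OF q] polyfun_scale[OF polyfun_ou[OF q]]])
  then show ?thesis by (simp add: expect_ou[OF q])
qed

lemma chaos_form_\<Gamma>:
  "chaos_form n m (\<lambda>w. (F w)\<^sup>2) \<Gamma> / fact m = (real p - real m / 2) * v m"
  "chaos_form n m \<Gamma> \<Gamma> / fact m = (real p - real m / 2)\<^sup>2 * v m"
proof -
  show "chaos_form n m (\<lambda>w. (F w)\<^sup>2) \<Gamma> / fact m = (real p - real m / 2) * v m"
    unfolding chaos_form_def v_def sum_distrib_left sum_divide_distrib
    by (intro sum.cong refl) (simp add: expect_deriv_\<Gamma>[OF length_index_lists])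
  show "chaos_form n m \<Gamma> \<Gamma> / fact m = (real p - real m / 2)\<^sup>2 * v m"
    unfolding chaos_form_def v_def sum_distrib_left sum_divide_distrib
    by (intro sum.cong refl) (simp add: expect_deriv_\<Gamma>[OF length_index_lists] power2_eq_square)
qed

lemma expect_\<Gamma>: "expect \<Gamma> = p"
  using expect_deriv_\<Gamma>[of "[]" 0] norm1 by simp

lemma sum_split_0: "(\<Sum>m\<le>2 * p. g m) = g 0 + (\<Sum>m = 1..2 * p. g m)" for g :: "nat \<Rightarrow> real"
  by (simp add: atMost_atLeast0 sum.atLeast_Suc_atMost)

text \<open>In chaos m the component of \<open>\<Gamma>\<close> is p - m / 2 times that of F^2, so
  the variance carries the squares of these factors and the covariance \<open>W\<close> the factors
  themselves. The terms of chaos 0 cancel against the means.\<close>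

lemma V_eq: "V = (\<Sum>m=1..2 * p. (real p - real m / 2)\<^sup>2 * v m)"
proof -
  have "V = expect (\<lambda>w. (\<Gamma> w)\<^sup>2 + ((- 2 * p) * \<Gamma> w + p\<^sup>2))"
    unfolding V_def by (simp add: power2_eq_square algebra_simps)
  also have "\<dots> = expect (\<lambda>w. (\<Gamma> w)\<^sup>2) + ((- 2 * p) * expect \<Gamma> + p\<^sup>2)"
    using polyfun_integrable[OF poly\<Gamma>] polyfun_integrable[OF polyfun_power2[OF poly\<Gamma>]] by simp
  also have "expect (\<lambda>w. (\<Gamma> w)\<^sup>2) = (\<Sum>m\<le>2 * p. (real p - real m / 2)\<^sup>2 * v m)"
    unfolding chaos_norm[OF poly\<Gamma>] chaos_form_\<Gamma> ..
  finally show ?thesis unfolding sum_split_0 by (simp add: expect_\<Gamma> v_0 power2_eq_square)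
qed

lemma W_eq: "W = (\<Sum>m=1..2 * p. (real p - real m / 2) * v m)"
proof -
  have "expect (\<lambda>w. (F w)\<^sup>2 * \<Gamma> w) = (\<Sum>m\<le>2 * p. (real p - real m / 2) * v m)"
    unfolding chaos_isometry[OF polyF2 poly\<Gamma> order_refl] chaos_form_\<Gamma> ..
  then show ?thesis unfolding W_def sum_split_0 by (simp add: v_0)
qed

text \<open>The factor p - m / 2 lies between 0 and p, so its square is at most p times itself. This
  makes the main term of order \<open>V\<close>.\<close>

lemma V_le_W: "V \<le> p * W"
  unfolding V_eq W_eq sum_distrib_left
proof (intro sum_mono)
  fix m assume m: "m \<in> {1..2 * p}"
  have "(real p - real m / 2)\<^sup>2 \<le> real p * (real p - real m / 2)"
    using m by (simp add: power2_eq_square mult_right_mono)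
  from mult_right_mono[OF this v_nonneg[of m]] show "(real p - real m / 2)\<^sup>2 * v m \<le> real p * ((real p - real m / 2) * v m)"
    by (simp add: mult.assoc)
qed

text \<open>The factor p - m / 2 is zero at m = 2 p and otherwise at least 1 / 2, because m is an
  integer.\<close>

lemma W_le_V: "W \<le> 2 * V"
  unfolding V_eq W_eq sum_distrib_left
proof (intro sum_mono)
  fix m assume m: "m \<in> {1..2 * p}"
  have "real p - real m / 2 \<le> 2 * (real p - real m / 2)\<^sup>2"
  proof (cases "m = 2 * p")
    case False
    then have "Suc m \<le> 2 * p" using m by auto
    then have "real m + 1 \<le> 2 * real p" by linarith
    then have "(real p - real m / 2) * (1 / 2) \<le> (real p - real m / 2) * (real p - real m / 2)"
      by (intro mult_left_mono) auto
    then show ?thesis by (simp add: power2_eq_square)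
  qed simp
  from mult_right_mono[OF this v_nonneg[of m]] show "(real p - real m / 2) * v m \<le> 2 * ((real p - real m / 2)\<^sup>2 * v m)"
    by (simp add: mult.assoc)
qed

text \<open>Integrating one of the four factors F by parts differentiates the remaining cube, hence
  the factor 3. The excess of the fourth moment over 3 is thus 3 W / p.\<close>

lemma fourth_moment: "p * expect (\<lambda>w. ((F w)\<^sup>2)\<^sup>2) = 3 * (W + p)"
proof -
  have t: "tame n (\<lambda>w. F w * (F w)\<^sup>2)" by (rule polyfun_tame[OF polyfun_mult[OF poly polyF2]])
  have "p * expect (\<lambda>w. ((F w)\<^sup>2)\<^sup>2) = (\<Sum>i<n. expect (\<lambda>w. partial i F w * partial i (\<lambda>w. F w * (F w)\<^sup>2) w))"
    using eigen_ibp[OF eigenF t] by (simp add: power2_eq_square mult.assoc)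
  also have "\<dots> = (\<Sum>i<n. expect (\<lambda>w. 3 * ((F w)\<^sup>2 * (D [i] w)\<^sup>2)))"
    unfolding C1_fun_mult(2)[OF polyfun_C1[OF poly] polyfun_C1[OF polyF2]] partial_F2 partial_F
    by (simp add: power2_eq_square algebra_simps)
  also have "\<dots> = 3 * expect (\<lambda>w. (F w)\<^sup>2 * \<Gamma> w)"
    using polyfun_integrable[OF polyfun_mult[OF polyF2 polyfun_power2[OF polyD]]] by (simp add: \<Gamma>_def sum_distrib_left)
  finally show ?thesis by (simp add: W_def)
qed

text \<open>The chaos norms of F^2 add up to the fourth moment; only chaos 0, which contributes 1,
  and the top chaos are kept. The number 2 matters: it is exactly the contribution of the two
  trivial contractions in \<open>v_top_eq\<close>.\<close>

lemma v_top_le: "v (2 * p) \<le> 2 + 6 * V"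
proof -
  have "v 0 + v (2 * p) \<le> (\<Sum>m\<le>2 * p. v m)"
  proof -
    have "sum v {0, 2 * p} \<le> (\<Sum>m\<le>2 * p. v m)" by (rule sum_mono2) (auto simp: v_nonneg)
    then show ?thesis using p by simp
  qed
  also have "\<dots> = expect (\<lambda>w. ((F w)\<^sup>2)\<^sup>2)" unfolding chaos_norm[OF polyF2] v_def ..
  also have "\<dots> = 3 * (W + p) / p" using fourth_moment p by (simp add: field_simps)
  also have "\<dots> = 3 + 3 * W / p" using p by (simp add: field_simps)
  also have "\<dots> \<le> 3 + 6 * V"
  proof -
    have "3 * W / p \<le> 3 * (2 * V) / p" using W_le_V by (intro divide_right_mono) auto
    also have "\<dots> \<le> 6 * V"
      using p mult_right_mono[of 1 "real p" V] V_nonneg by (simp add: field_simps)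
    finally show ?thesis by simp
  qed
  finally show ?thesis by (simp add: v_0)
qed

section \<open>Contractions of the kernel with itself\<close>

text \<open>For j + b = p this is the squared Hilbert-Schmidt norm of the contraction of
  \<open>f\<close> with itself over \<open>j\<close> indices.\<close>

definition Q :: "nat \<Rightarrow> nat \<Rightarrow> real" where
  "Q j b = (\<Sum>y\<in>T b. \<Sum>z\<in>T b. (\<Sum>x\<in>T j. f (x @ y) * f (x @ z))\<^sup>2)"

lemma Q_nonneg: "0 \<le> Q j b"
  unfolding Q_def by (intro sum_nonneg) simp

lemma Q_ends: "Q p 0 = (fact p)\<^sup>2" "Q 0 p = (fact p)\<^sup>2"
proof -
  show "Q p 0 = (fact p)\<^sup>2"
    using sum_f_square by (simp add: Q_def power2_eq_square)
  have "Q 0 p = (\<Sum>y\<in>T p. (f y)\<^sup>2) * (\<Sum>z\<in>T p. (f z)\<^sup>2)"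
    by (simp add: Q_def power_mult_distrib sum_product)
  then show "Q 0 p = (fact p)\<^sup>2" unfolding sum_f_square by (simp add: power2_eq_square)
qed

text \<open>Counting degrees: a derivative of F of order above p vanishes, so in the Leibniz
  expansion of the p further derivatives exactly p - k must fall on the first factor and k on the
  second. Both factors are then constants.\<close>

lemma contract_square:
  assumes "k \<le> p"
  shows "(\<Sum>x1\<in>T k. \<Sum>x2\<in>T (p - k). f (x1 @ x2) *
      (\<Sum>ys\<in>T p. f ys * deriv_list ys (\<lambda>w. D x1 w * D x2 w) w)) = real (p choose k) * Q (p - k) k"
proof -
  have "(\<Sum>ys\<in>T p. f ys * deriv_list ys (\<lambda>w. D x1 w * D x2 w) w) =
    real (p choose k) * (\<Sum>y1\<in>T (p - k). \<Sum>y2\<in>T k. f (y1 @ y2) * f (x1 @ y1) * f (x2 @ y2))"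
    if "x1 \<in> T k" "x2 \<in> T (p - k)" for x1 x2
  proof -
    have "(\<Sum>ys\<in>T p. f ys * deriv_list ys (\<lambda>w. D x1 w * D x2 w) w) =
      (\<Sum>l\<le>p. real (p choose l) * (\<Sum>y1\<in>T l. \<Sum>y2\<in>T (p - l). f (y1 @ y2) * D (x1 @ y1) w * D (x2 @ y2) w))"
      by (subst weighted_leibniz[OF polyD polyD sym_f]) (simp add: D_def deriv_list_append)
    also have "\<dots> = (\<Sum>l\<le>p. if l = p - k then real (p choose l) * (\<Sum>y1\<in>T l. \<Sum>y2\<in>T (p - l). f (y1 @ y2) * f (x1 @ y1) * f (x2 @ y2)) else 0)"
    proof (intro sum.cong refl)
      fix l assume l: "l \<in> {..p}"
      show "real (p choose l) * (\<Sum>y1\<in>T l. \<Sum>y2\<in>T (p - l). f (y1 @ y2) * D (x1 @ y1) w * D (x2 @ y2) w) =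
        (if l = p - k then real (p choose l) * (\<Sum>y1\<in>T l. \<Sum>y2\<in>T (p - l). f (y1 @ y2) * f (x1 @ y1) * f (x2 @ y2)) else 0)"
      proof (cases "l = p - k")
        case True
        have "D (x1 @ y1) w = f (x1 @ y1)" "D (x2 @ y2) w = f (x2 @ y2)" if "y1 \<in> T l" "y2 \<in> T (p - l)" for y1 y2
          using that \<open>x1 \<in> T k\<close> \<open>x2 \<in> T (p - k)\<close> True assms by (auto simp: D_top length_index_lists)
        with True show ?thesis by simp
      next
        case False
        have "D (x1 @ y1) w = 0 \<or> D (x2 @ y2) w = 0" if "y1 \<in> T l" "y2 \<in> T (p - l)" for y1 y2
        proof (cases "p < k + l")
          case True
          then show ?thesis using that \<open>x1 \<in> T k\<close> by (subst D_high) (auto simp: length_index_lists)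
        next
          case False
          then have "D (x2 @ y2) = (\<lambda>_. 0)" using \<open>l \<noteq> p - k\<close> that \<open>x2 \<in> T (p - k)\<close> l assms
            by (intro D_high) (auto simp: length_index_lists)
          then show ?thesis by simp
        qed
        then have "(\<Sum>y1\<in>T l. \<Sum>y2\<in>T (p - l). f (y1 @ y2) * D (x1 @ y1) w * D (x2 @ y2) w) = 0"
          by (intro sum.neutral ballI) auto
        with False show ?thesis by simp
      qed
    qed
    also have "\<dots> = real (p choose k) * (\<Sum>y1\<in>T (p - k). \<Sum>y2\<in>T k. f (y1 @ y2) * f (x1 @ y1) * f (x2 @ y2))"
      using assms by (simp add: sum.delta binomial_symmetric[of k p])
    finally show ?thesis .
  qed
  then have "(\<Sum>x1\<in>T k. \<Sum>x2\<in>T (p - k). f (x1 @ x2) *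
      (\<Sum>ys\<in>T p. f ys * deriv_list ys (\<lambda>w. D x1 w * D x2 w) w)) =
    (\<Sum>x1\<in>T k. \<Sum>x2\<in>T (p - k). f (x1 @ x2) *
      (real (p choose k) * (\<Sum>y1\<in>T (p - k). \<Sum>y2\<in>T k. f (y1 @ y2) * f (x1 @ y1) * f (x2 @ y2))))"
    by (intro sum.cong refl) simp
  \<comment> \<open>The four copies of \<open>f\<close> form a cycle through x1, x2, y2, y1. Summing
    out x2 and y1 independently leaves the square of a contraction with free indices x1 and
    y2.\<close>
  also have "\<dots> = real (p choose k) * (\<Sum>x1\<in>T k. \<Sum>x2\<in>T (p - k). \<Sum>y1\<in>T (p - k). \<Sum>y2\<in>T k.
      (f (x2 @ x1) * f (x2 @ y2)) * (f (y1 @ x1) * f (y1 @ y2)))"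
    unfolding sum_distrib_left
  proof (intro sum.cong refl)
    fix x1 x2 y1 y2
    have "f (x1 @ x2) = f (x2 @ x1)" "f (x1 @ y1) = f (y1 @ x1)" by (rule f_mset, simp)+
    then show "f (x1 @ x2) * (real (p choose k) * (f (y1 @ y2) * f (x1 @ y1) * f (x2 @ y2))) =
      real (p choose k) * ((f (x2 @ x1) * f (x2 @ y2)) * (f (y1 @ x1) * f (y1 @ y2)))"
      by (simp only: mult_ac)
  qed
  also have "(\<Sum>x1\<in>T k. \<Sum>x2\<in>T (p - k). \<Sum>y1\<in>T (p - k). \<Sum>y2\<in>T k.
      (f (x2 @ x1) * f (x2 @ y2)) * (f (y1 @ x1) * f (y1 @ y2))) = Q (p - k) k"
    unfolding Q_def
  proof (rule sum.cong[OF refl])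
    fix x1
    have "(\<Sum>x2\<in>T (p - k). \<Sum>y1\<in>T (p - k). \<Sum>y2\<in>T k. (f (x2 @ x1) * f (x2 @ y2)) * (f (y1 @ x1) * f (y1 @ y2)))
      = (\<Sum>x2\<in>T (p - k). \<Sum>y2\<in>T k. \<Sum>y1\<in>T (p - k). (f (x2 @ x1) * f (x2 @ y2)) * (f (y1 @ x1) * f (y1 @ y2)))"
      by (intro sum.cong refl sum.swap)
    also have "\<dots> = (\<Sum>y2\<in>T k. \<Sum>x2\<in>T (p - k). \<Sum>y1\<in>T (p - k). (f (x2 @ x1) * f (x2 @ y2)) * (f (y1 @ x1) * f (y1 @ y2)))"
      by (rule sum.swap)
    also have "\<dots> = (\<Sum>z\<in>T k. (\<Sum>x\<in>T (p - k). f (x @ x1) * f (x @ z))\<^sup>2)"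
      by (intro sum.cong refl) (simp only: power2_eq_square sum_product)
    finally show "(\<Sum>x2\<in>T (p - k). \<Sum>y1\<in>T (p - k). \<Sum>y2\<in>T k. (f (x2 @ x1) * f (x2 @ y2)) * (f (y1 @ x1) * f (y1 @ y2)))
      = (\<Sum>z\<in>T k. (\<Sum>x\<in>T (p - k). f (x @ x1) * f (x @ z))\<^sup>2)" .
  qed
  finally show ?thesis .
qed

text \<open>The top chaos coefficient of \<open>F\<^sup>2\<close> is the symmetrisation of the tensor \<open>f \<otimes> f\<close>; expanding its
  squared norm produces the contractions of \<open>f\<close> with non-negative weights.\<close>

lemma v_top_eq: "(fact p)\<^sup>2 * v (2 * p) = (\<Sum>k\<le>p. (real (p choose k))\<^sup>2 * Q (p - k) k)"
proof -
  \<comment> \<open>An arbitrary point of evaluation: derivatives of order 2 p of a polynomial of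
    degree 2 p are constant, so their values at \<open>w\<close> replace expectations.\<close>
  fix w :: "nat \<Rightarrow> real"
  define t where "t us = expect (deriv_list us (\<lambda>w. (F w)\<^sup>2))" for us
  have sym_t: "sym_weight t" unfolding t_def by (rule sym_weight_deriv[OF polyF2])
  have t: "deriv_list us (\<lambda>w. F w * F w) w = t us" if "length us = 2 * p" for us
  proof -
    have "polyfun n 0 (deriv_list us (\<lambda>w. (F w)\<^sup>2))" using polyfun_deriv_list[OF polyF2, of us] that by simp
    then obtain c where "deriv_list us (\<lambda>w. (F w)\<^sup>2) = (\<lambda>_. c)" using polyfun_0_const by blast
    then show ?thesis by (simp add: t_def power2_eq_square)
  qed
  have "chaos_form n (2 * p) (\<lambda>w. (F w)\<^sup>2) (\<lambda>w. (F w)\<^sup>2) = (\<Sum>us\<in>T (2 * p). t us * deriv_list us (\<lambda>w. F w * F w) w)"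
    unfolding chaos_form_def by (intro sum.cong refl) (simp add: t length_index_lists, simp add: t_def)
  also have "\<dots> = (\<Sum>k\<le>2 * p. real (2 * p choose k) * (\<Sum>xs\<in>T k. \<Sum>ys\<in>T (2 * p - k). t (xs @ ys) * D xs w * D ys w))"
    by (subst weighted_leibniz[OF poly poly sym_t]) (simp add: D_def)
  \<comment> \<open>Each factor F survives at most p derivatives, so 2 p of them have to split
    evenly.\<close>
  also have "\<dots> = (\<Sum>k\<le>2 * p. if k = p then real (2 * p choose p) * (\<Sum>xs\<in>T p. \<Sum>ys\<in>T p. t (xs @ ys) * f xs * f ys) else 0)"
  proof (intro sum.cong refl)
    fix k assume k: "k \<in> {..2 * p}"
    show "real (2 * p choose k) * (\<Sum>xs\<in>T k. \<Sum>ys\<in>T (2 * p - k). t (xs @ ys) * D xs w * D ys w) =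
      (if k = p then real (2 * p choose p) * (\<Sum>xs\<in>T p. \<Sum>ys\<in>T p. t (xs @ ys) * f xs * f ys) else 0)"
    proof (cases "k = p")
      case True
      have "(\<Sum>xs\<in>T p. \<Sum>ys\<in>T p. t (xs @ ys) * D xs w * D ys w) = (\<Sum>xs\<in>T p. \<Sum>ys\<in>T p. t (xs @ ys) * f xs * f ys)"
        by (intro sum.cong refl) (simp add: D_top length_index_lists)
      with True show ?thesis by simp
    next
      case False
      have "D xs w = 0 \<or> D ys w = 0" if "xs \<in> T k" "ys \<in> T (2 * p - k)" for xs ys
      proof (cases "p < k")
        case True
        then show ?thesis using that by (subst D_high) (auto simp: length_index_lists)
      next
        case False
        then have "D ys = (\<lambda>_. 0)" using \<open>k \<noteq> p\<close> that by (intro D_high) (auto simp: length_index_lists)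
        then show ?thesis by simp
      qed
      then have "(\<Sum>xs\<in>T k. \<Sum>ys\<in>T (2 * p - k). t (xs @ ys) * D xs w * D ys w) = 0"
        by (intro sum.neutral ballI) auto
      with False show ?thesis by simp
    qed
  qed
  also have "\<dots> = real (2 * p choose p) * (\<Sum>xs\<in>T p. \<Sum>ys\<in>T p. t (xs @ ys) * f xs * f ys)"
    by (simp add: sum.delta)
  also have "(\<Sum>xs\<in>T p. \<Sum>ys\<in>T p. t (xs @ ys) * f xs * f ys) =
    (\<Sum>ys\<in>T p. f ys * deriv_list ys (\<lambda>w. \<Sum>xs\<in>T p. f xs * deriv_list xs (\<lambda>w. F w * F w) w) w)"
  proof -
    have "deriv_list ys (\<lambda>w. \<Sum>xs\<in>T p. f xs * deriv_list xs (\<lambda>w. F w * F w) w) w = (\<Sum>xs\<in>T p. f xs * t (xs @ ys))"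
      if "ys \<in> T p" for ys
    proof -
      note q = polyfun_deriv_list'[OF polyfun_mult[OF poly poly]]
      have "deriv_list ys (\<lambda>w. \<Sum>xs\<in>T p. f xs * deriv_list xs (\<lambda>w. F w * F w) w) w =
        (\<Sum>xs\<in>T p. f xs * deriv_list ys (deriv_list xs (\<lambda>w. F w * F w)) w)"
        by (subst deriv_list_sum[OF polyfun_scale[OF q]]) (simp add: deriv_list_scale[OF q])
      also have "\<dots> = (\<Sum>xs\<in>T p. f xs * t (xs @ ys))"
        using that by (intro sum.cong refl) (simp add: t length_index_lists flip: deriv_list_append)
      finally show ?thesis .
    qed
    then show ?thesis by (subst sum.swap) (simp add: sum_distrib_left mult_ac)
  qed
  also have "(\<lambda>w. \<Sum>xs\<in>T p. f xs * deriv_list xs (\<lambda>w. F w * F w) w) =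
    (\<lambda>w. \<Sum>k\<le>p. \<Sum>x1\<in>T k. \<Sum>x2\<in>T (p - k). (real (p choose k) * f (x1 @ x2)) * (D x1 w * D x2 w))"
    by (subst weighted_leibniz[OF poly poly sym_f]) (simp add: D_def sum_distrib_left mult_ac)
  also have "(\<Sum>ys\<in>T p. f ys * deriv_list ys (\<lambda>w. \<Sum>k\<le>p. \<Sum>x1\<in>T k. \<Sum>x2\<in>T (p - k). (real (p choose k) * f (x1 @ x2)) * (D x1 w * D x2 w)) w)
    = (\<Sum>k\<le>p. real (p choose k) * (\<Sum>x1\<in>T k. \<Sum>x2\<in>T (p - k). f (x1 @ x2) *
      (\<Sum>ys\<in>T p. f ys * deriv_list ys (\<lambda>w. D x1 w * D x2 w) w)))"
  proof -
    note q = polyfun_mult[OF polyD polyD]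
    have "deriv_list ys (\<lambda>w. \<Sum>k\<le>p. \<Sum>x1\<in>T k. \<Sum>x2\<in>T (p - k). (real (p choose k) * f (x1 @ x2)) * (D x1 w * D x2 w)) w
      = (\<Sum>k\<le>p. \<Sum>x1\<in>T k. \<Sum>x2\<in>T (p - k). (real (p choose k) * f (x1 @ x2)) * deriv_list ys (\<lambda>w. D x1 w * D x2 w) w)" for ys
      by (simp only: deriv_list_sum[OF polyfun_sum[OF polyfun_sum[OF polyfun_scale[OF q]]]]
           deriv_list_sum[OF polyfun_sum[OF polyfun_scale[OF q]]] deriv_list_sum[OF polyfun_scale[OF q]] deriv_list_scale[OF q])
    then have "(\<Sum>ys\<in>T p. f ys * deriv_list ys (\<lambda>w. \<Sum>k\<le>p. \<Sum>x1\<in>T k. \<Sum>x2\<in>T (p - k). (real (p choose k) * f (x1 @ x2)) * (D x1 w * D x2 w)) w)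
      = (\<Sum>ys\<in>T p. \<Sum>k\<le>p. \<Sum>x1\<in>T k. \<Sum>x2\<in>T (p - k). real (p choose k) * (f (x1 @ x2) * (f ys * deriv_list ys (\<lambda>w. D x1 w * D x2 w) w)))"
      by (simp add: sum_distrib_left mult_ac)
    also have "\<dots> = (\<Sum>k\<le>p. \<Sum>x1\<in>T k. \<Sum>x2\<in>T (p - k). \<Sum>ys\<in>T p. real (p choose k) * (f (x1 @ x2) * (f ys * deriv_list ys (\<lambda>w. D x1 w * D x2 w) w)))"
      by (rule trans[OF sum.swap], rule sum.cong[OF refl], rule trans[OF sum.swap], rule sum.cong[OF refl], rule sum.swap)
    finally show ?thesis by (simp only: sum_distrib_left)
  qed
  also have "\<dots> = (\<Sum>k\<le>p. (real (p choose k))\<^sup>2 * Q (p - k) k)"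
    by (intro sum.cong refl) (simp add: contract_square power2_eq_square)
  finally have "chaos_form n (2 * p) (\<lambda>w. (F w)\<^sup>2) (\<lambda>w. (F w)\<^sup>2) = real (2 * p choose p) * (\<Sum>k\<le>p. (real (p choose k))\<^sup>2 * Q (p - k) k)" .
  moreover have "real (2 * p choose p) * (fact p)\<^sup>2 = fact (2 * p)"
    by (simp add: binomial_fact power2_eq_square)
  ultimately show ?thesis unfolding v_def by (simp add: field_simps)
qed

text \<open>In \<open>v_top_eq\<close> the terms k = 0 and k = p together give exactly 2 times the
  square of p!. By \<open>v_top_le\<close> all proper contractions have to share the excess, which
  is at most a multiple of \<open>V\<close>.\<close>

lemma Q_le:
  assumes "0 < k" "k < p"
  shows "Q (p - k) k \<le> 6 * (fact p)\<^sup>2 * V"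
proof -
  have c: "1 \<le> (real (p choose k))\<^sup>2"
    using assms by (simp add: one_le_power Suc_le_eq)
  have "(\<Sum>k\<in>{0, k, p}. (real (p choose k))\<^sup>2 * Q (p - k) k) \<le> (\<Sum>k\<le>p. (real (p choose k))\<^sup>2 * Q (p - k) k)"
    using assms by (intro sum_mono2) (auto simp: Q_nonneg)
  then have "2 * (fact p)\<^sup>2 + (real (p choose k))\<^sup>2 * Q (p - k) k \<le> (fact p)\<^sup>2 * v (2 * p)"
    using assms by (simp add: v_top_eq Q_ends)
  also have "\<dots> \<le> (fact p)\<^sup>2 * (2 + 6 * V)" by (intro mult_left_mono v_top_le) simp
  finally have "(real (p choose k))\<^sup>2 * Q (p - k) k \<le> 6 * (fact p)\<^sup>2 * V" by (simp add: algebra_simps)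
  moreover have "1 * Q (p - k) k \<le> (real (p choose k))\<^sup>2 * Q (p - k) k" by (intro mult_right_mono c Q_nonneg)
  ultimately show ?thesis by simp
qed

section \<open>Contractions of iterated derivatives\<close>

definition contr :: "nat \<Rightarrow> nat list \<Rightarrow> nat list \<Rightarrow> (nat \<Rightarrow> real) \<Rightarrow> real" where
  "contr j y z w = (\<Sum>x\<in>T j. D (x @ y) w * D (x @ z) w)"

text \<open>The mean squared norm of the contraction over \<open>j\<close> indices of the
  derivatives of orders j + b and j + c.\<close>

definition R :: "nat \<Rightarrow> nat \<Rightarrow> nat \<Rightarrow> real" where
  "R j b c = (\<Sum>y\<in>T b. \<Sum>z\<in>T c. expect (\<lambda>w. (contr j y z w)\<^sup>2))"

lemma poly_contr: "polyfun n (2 * p) (contr j y z)"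
  unfolding contr_def[abs_def] mult_2 by (intro polyfun_sum polyfun_mult polyD)

lemma R_nonneg: "0 \<le> R j b c"
  unfolding R_def by (intro sum_nonneg) simp

lemma partial_contr: "partial i (contr j y z) = (\<lambda>w. contr j (i # y) z w + contr j y (i # z) w)"
proof -
  note C = polyfun_C1[OF polyD]
  have "partial i (contr j y z) = (\<lambda>w. \<Sum>x\<in>T j. D (i # x @ y) w * D (x @ z) w + D (x @ y) w * D (i # x @ z) w)"
    unfolding contr_def[abs_def] by (simp add: C1_fun_sum(2)[OF C1_fun_mult(1)[OF C C]] C1_fun_mult(2)[OF C C] partial_D)
  moreover have "D (i # x @ y) = D (x @ i # y)" for x y by (rule D_mset) simp
  ultimately show ?thesis by (simp add: contr_def sum.distrib fun_eq_iff)
qed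

lemma contr_high: "p < j + length y \<or> p < j + length z \<Longrightarrow> contr j y z = (\<lambda>_. 0)"
  unfolding contr_def[abs_def] by (auto simp: D_high length_index_lists fun_eq_iff intro!: sum.neutral)

text \<open>Derivatives of different orders lie in different chaoses and are orthogonal. For equal
  orders, \<open>eigen_ibp\<close> exchanges the mean for that of the contraction over one more
  index, up to a factor \<open>r\<close> that is at least 1; Cauchy-Schwarz then bounds the squared
  mean.\<close>

lemma expect_contr:
  assumes "j + length y < p" "j + length z \<le> p"
  shows "(expect (contr j y z))\<^sup>2 \<le> (if length y = length z then expect (\<lambda>w. (contr (Suc j) y z w)\<^sup>2) else 0)"
proof -
  note int = polyfun_integrable[OF polyfun_mult[OF polyD polyD]]
  have e: "expect (contr j y z) = (\<Sum>x\<in>T j. expect (\<lambda>w. D (x @ y) w * D (x @ z) w))"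
    unfolding contr_def[abs_def] using int by simp
  show ?thesis
  proof (cases "length y = length z")
    case False
    have "expect (\<lambda>w. D (x @ y) w * D (x @ z) w) = 0" if "x \<in> T j" for x
      by (rule eigen_orthogonal[OF eigenD[OF refl] eigenD[OF refl]]) (use False in simp)
    then show ?thesis using False by (simp add: e)
  next
    case True
    define r where "r = real p - real (j + length y)"
    have r: "1 \<le> r" using assms(1) unfolding r_def by linarith
    have "r * expect (\<lambda>w. D (x @ y) w * D (x @ z) w) = (\<Sum>i<n. expect (\<lambda>w. D (i # x @ y) w * D (i # x @ z) w))" if "x \<in> T j" for x
      using eigen_ibp[OF eigenD[of "x @ y" "j + length y"] polyfun_tame[OF polyD]] that
      by (simp add: length_index_lists partial_D r_def)
    then have "r * expect (contr j y z) = (\<Sum>x\<in>T j. \<Sum>i<n. expect (\<lambda>w. D (i # x @ y) w * D (i # x @ z) w))"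
      by (simp add: e sum_distrib_left)
    also have "\<dots> = expect (contr (Suc j) y z)"
      unfolding contr_def[abs_def] sum_index_lists_Suc using int by (subst sum.swap) simp
    finally have eq: "r * expect (contr j y z) = expect (contr (Suc j) y z)" .
    have "(expect (contr j y z))\<^sup>2 \<le> (r * expect (contr j y z))\<^sup>2"
      using r by (simp add: power_mult_distrib mult_le_cancel_right1 one_le_power)
    also have "\<dots> \<le> expect (\<lambda>w. (contr (Suc j) y z w)\<^sup>2)"
      using poly_cauchy_schwarz[OF poly_contr polyfun.const[of n 0 1], of "Suc j" y z] by (simp add: eq)
    finally show ?thesis using True by simp
  qed
qed

text \<open>The Poincare inequality for each \<open>contr j y z\<close>: the means lead to
  \<open>R (Suc j) b c\<close>, and the gradient falls on either factor, giving the other two terms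
  with the coefficient 2 of (u + v)^2 \<le> 2 u^2 + 2 v^2.\<close>

lemma R_step:
  assumes "j + b < p" "j + c \<le> p"
  shows "R j b c \<le> R (Suc j) b c + 2 * R j (Suc b) c + 2 * R j b (Suc c)"
proof -
  have st: "expect (\<lambda>w. (contr j y z w)\<^sup>2) \<le> expect (\<lambda>w. (contr (Suc j) y z w)\<^sup>2) +
     (\<Sum>i<n. 2 * expect (\<lambda>w. (contr j (i # y) z w)\<^sup>2) + 2 * expect (\<lambda>w. (contr j y (i # z) w)\<^sup>2))"
    if "y \<in> T b" "z \<in> T c" for y z
  proof -
    have sq: "(u + v)\<^sup>2 \<le> 2 * u\<^sup>2 + 2 * v\<^sup>2" for u v :: real
      using zero_le_power2[of "u - v"] by (simp add: power2_eq_square algebra_simps)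
    note int = polyfun_integrable[OF polyfun_power2[OF poly_contr]]
    have "expect (\<lambda>w. (partial i (contr j y z) w)\<^sup>2) \<le> expect (\<lambda>w. 2 * (contr j (i # y) z w)\<^sup>2 + 2 * (contr j y (i # z) w)\<^sup>2)" for i
      using sq int polyfun_integrable[OF polyfun_power2[OF polyfun_partial[OF poly_contr]]]
      unfolding partial_contr by (intro integral_mono) auto
    also have "\<dots> i = 2 * expect (\<lambda>w. (contr j (i # y) z w)\<^sup>2) + 2 * expect (\<lambda>w. (contr j y (i # z) w)\<^sup>2)" for i
      using int by simp
    finally have "(\<Sum>i<n. expect (\<lambda>w. (partial i (contr j y z) w)\<^sup>2)) \<le>
       (\<Sum>i<n. 2 * expect (\<lambda>w. (contr j (i # y) z w)\<^sup>2) + 2 * expect (\<lambda>w. (contr j y (i # z) w)\<^sup>2))"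
      by (rule sum_mono)
    moreover have "(expect (contr j y z))\<^sup>2 \<le> expect (\<lambda>w. (contr (Suc j) y z w)\<^sup>2)"
      using expect_contr[of j y z] assms that by (auto simp: length_index_lists split: if_splits)
    ultimately show ?thesis using poincare[OF poly_contr, of j y z] by linarith
  qed
  have "R j b c \<le> (\<Sum>y\<in>T b. \<Sum>z\<in>T c. expect (\<lambda>w. (contr (Suc j) y z w)\<^sup>2) +
     (\<Sum>i<n. 2 * expect (\<lambda>w. (contr j (i # y) z w)\<^sup>2) + 2 * expect (\<lambda>w. (contr j y (i # z) w)\<^sup>2)))"
    unfolding R_def by (intro sum_mono st)
  also have "\<dots> = R (Suc j) b c + 2 * (\<Sum>y\<in>T b. \<Sum>z\<in>T c. \<Sum>i<n. expect (\<lambda>w. (contr j (i # y) z w)\<^sup>2)) +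
     2 * (\<Sum>y\<in>T b. \<Sum>z\<in>T c. \<Sum>i<n. expect (\<lambda>w. (contr j y (i # z) w)\<^sup>2))"
    unfolding R_def by (simp add: sum.distrib sum_distrib_left)
  also have "(\<Sum>y\<in>T b. \<Sum>z\<in>T c. \<Sum>i<n. expect (\<lambda>w. (contr j (i # y) z w)\<^sup>2)) = R j (Suc b) c"
    unfolding R_def sum_index_lists_Suc
    by (subst (2) sum.swap, subst sum.swap) (rule refl)
  also have "(\<Sum>y\<in>T b. \<Sum>z\<in>T c. \<Sum>i<n. expect (\<lambda>w. (contr j y (i # z) w)\<^sup>2)) = R j b (Suc c)"
    unfolding R_def sum_index_lists_Suc by (intro sum.cong refl sum.swap)
  finally show ?thesis .
qed

lemma R_sym: "R j b c = R j c b"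
  unfolding R_def contr_def by (subst sum.swap) (simp add: mult.commute)

lemma R_high: "p < j + b \<or> p < j + c \<Longrightarrow> R j b c = 0"
  unfolding R_def by (intro sum.neutral ballI) (auto simp: contr_high length_index_lists)

text \<open>Each use of \<open>R_step\<close> raises the total order 2 j + b + c and costs the
  factor 5 = 1 + 2 + 2. The recursion ends when a factor has been differentiated more than p times,
  or when both have order p and the contraction is one of the kernel.\<close>

lemma R_le:
  assumes "1 \<le> j" "1 \<le> b + c"
  shows "R j b c \<le> 5 ^ (2 * p - (2 * j + b + c)) * (6 * (fact p)\<^sup>2 * V)"
  using assms
proof (induction "2 * p - (2 * j + b + c)" arbitrary: j b c rule: less_induct)
  case less
  let ?K = "6 * (fact p)\<^sup>2 * V"
  have K: "0 \<le> ?K" using V_nonneg by simp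
  consider "p < j + b \<or> p < j + c" | "j + b = p" "j + c = p" | "j + b < p" "j + c \<le> p" | "j + c < p" "j + b \<le> p" by linarith
  then show ?case
  proof cases
    case 1
    then show ?thesis using K by (simp add: R_high)
  next
    case 2
    \<comment> \<open>The hypotheses on j, b and c exclude b = 0 and b = p here, the two trivial
      contractions, which are not small.\<close>
    then have bc: "c = b" "j = p - b" "0 < b" "b < p" using less.prems by auto
    have "contr j y z w = (\<Sum>x\<in>T j. f (x @ y) * f (x @ z))" if "y \<in> T b" "z \<in> T b" for y z w
      unfolding contr_def using that 2 bc(1) by (intro sum.cong refl) (simp add: D_top length_index_lists)
    then have "R j b c = Q (p - b) b" unfolding R_def Q_def using bc by simp
    also have "\<dots> \<le> ?K" by (rule Q_le) (use bc in auto)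
    finally show ?thesis using 2 bc by simp
  next
    case 3
    let ?N = "2 * p - (2 * j + b + c)"
    have N: "0 < ?N" using 3 by linarith
    then obtain M where M: "?N = Suc M" using gr0_conv_Suc by blast
    have le: "2 * p - (2 * j' + b' + c') \<le> M \<Longrightarrow> (5::real) ^ (2 * p - (2 * j' + b' + c')) * ?K \<le> 5 ^ M * ?K" for j' b' c'
      by (intro mult_right_mono power_increasing K) auto
    have "R (Suc j) b c \<le> 5 ^ M * ?K" using less.hyps[of "Suc j" b c] N less.prems M by (intro order_trans[OF _ le[of "Suc j" b c]]) auto
    moreover have "R j (Suc b) c \<le> 5 ^ M * ?K" using less.hyps[of j "Suc b" c] N less.prems M by (intro order_trans[OF _ le[of j "Suc b" c]]) auto
    moreover have "R j b (Suc c) \<le> 5 ^ M * ?K" using less.hyps[of j b "Suc c"] N less.prems M by (intro order_trans[OF _ le[of j b "Suc c"]]) auto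
    ultimately have "R j b c \<le> 5 * (5 ^ M * ?K)" using R_step[OF 3] by linarith
    then show ?thesis unfolding M by simp
  next
    case 4
    let ?N = "2 * p - (2 * j + b + c)"
    have N: "0 < ?N" using 4 by linarith
    then obtain M where M: "?N = Suc M" using gr0_conv_Suc by blast
    have le: "2 * p - (2 * j' + b' + c') \<le> M \<Longrightarrow> (5::real) ^ (2 * p - (2 * j' + b' + c')) * ?K \<le> 5 ^ M * ?K" for j' b' c'
      by (intro mult_right_mono power_increasing K) auto
    have "R (Suc j) c b \<le> 5 ^ M * ?K" using less.hyps[of "Suc j" b c] N less.prems M by (subst R_sym) (intro order_trans[OF _ le[of "Suc j" b c]], auto)
    moreover have "R j (Suc c) b \<le> 5 ^ M * ?K" using less.hyps[of j b "Suc c"] N less.prems M by (subst R_sym) (intro order_trans[OF _ le[of j b "Suc c"]], auto)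
    moreover have "R j c (Suc b) \<le> 5 ^ M * ?K" using less.hyps[of j "Suc b" c] N less.prems M by (subst R_sym) (intro order_trans[OF _ le[of j "Suc b" c]], auto)
    ultimately have "R j c b \<le> 5 * (5 ^ M * ?K)" using R_step[OF 4] by linarith
    then show ?thesis unfolding M by (subst R_sym) simp
  qed
qed

end

section \<open>Comparison of characteristic functions\<close>

text \<open>Quadratic growth is allowed because the test functions include the Taylor remainder 1 -
  cos (s x) - s^2 x^2 / 2.\<close>

definition quad_C1 :: "(real \<Rightarrow> real) \<Rightarrow> (real \<Rightarrow> real) \<Rightarrow> bool" where
  "quad_C1 h h' \<longleftrightarrow> (\<forall>x. (h has_real_derivative h' x) (at x)) \<and> continuous_on UNIV h' \<and>
     (\<exists>A. \<forall>x. \<bar>h x\<bar> \<le> A * (1 + x\<^sup>2) \<and> \<bar>h' x\<bar> \<le> A * (1 + x\<^sup>2))"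

lemma poly_growth_compose:
  assumes "poly_growth n X" "\<And>x. \<bar>h x\<bar> \<le> A * (1 + x\<^sup>2)"
  shows "poly_growth n (\<lambda>w. h (X w))"
proof (rule poly_growth_bound)
  show "poly_growth n (\<lambda>w. A * (1 + X w * X w))"
    by (intro poly_growth_mult poly_growth_add poly_growth_const assms(1))
  show "\<bar>h (X w)\<bar> \<le> \<bar>A * (1 + X w * X w)\<bar>" for w
    using assms(2)[of "X w"] by (simp add: power2_eq_square)
qed

lemma tame_compose:
  assumes X: "tame n X" and h: "quad_C1 h h'"
  shows "tame n (\<lambda>w. h (X w))" "partial k (\<lambda>w. h (X w)) = (\<lambda>w. h' (X w) * partial k X w)"
    "poly_growth n (\<lambda>w. h' (X w))" "(\<lambda>w. h' (X w)) \<in> borel_measurable wiener"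
proof -
  obtain A where A: "\<And>x. \<bar>h x\<bar> \<le> A * (1 + x\<^sup>2)" "\<And>x. \<bar>h' x\<bar> \<le> A * (1 + x\<^sup>2)"
    using h by (auto simp: quad_C1_def)
  have d: "\<And>x. (h has_real_derivative h' x) (at x)" and c: "continuous_on UNIV h'"
    using h by (auto simp: quad_C1_def)
  note C = C1_fun_compose[OF tame_C1[OF X] d c]
  show g: "poly_growth n (\<lambda>w. h' (X w))" by (rule poly_growth_compose[OF tame_growth(1)[OF X] A(2)])
  show p: "partial k (\<lambda>w. h (X w)) = (\<lambda>w. h' (X w) * partial k X w)" for k by (rule C(2))
  show "tame n (\<lambda>w. h (X w))"
    unfolding tame_def p
    by (intro conjI allI C(1) poly_growth_mult g tame_growth(2)[OF X] poly_growth_compose[OF tame_growth(1)[OF X] A(1)])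
  show "(\<lambda>w. h' (X w)) \<in> borel_measurable wiener"
    by (intro continuous_measurable_wiener continuous_on_compose2[OF c C1_fun_continuous(1)[OF tame_C1[OF X]]]) simp
qed

text \<open>The hypercontractivity constant is a parameter, so that it can be fixed from
  \<open>p\<close> alone before \<open>n\<close> and \<open>F\<close> are chosen.\<close>

locale unit_chaos_hyper = unit_chaos +
  fixes H :: real
  assumes H_nonneg: "0 \<le> H"
    and hyper: "\<And>X. polyfun n (2 * p) X \<Longrightarrow> expect (\<lambda>w. (X w) ^ 4) \<le> H * (expect (\<lambda>w. (X w)\<^sup>2))\<^sup>2"
begin

lemma integrable_compose:
  assumes "polyfun n d X" "quad_C1 h h'"
  shows "integrable wiener (\<lambda>w. X w * h (F w))" "integrable wiener (\<lambda>w. X w * h' (F w))"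
proof -
  note t = tame_compose[OF polyfun_tame[OF poly] assms(2)] and X = polyfun_tame[OF assms(1)]
  note [measurable] = tame_measurable[OF X] t(4)
  show "integrable wiener (\<lambda>w. X w * h (F w))" by (rule tame_integrable[OF tame_mult[OF X t(1)]])
  show "integrable wiener (\<lambda>w. X w * h' (F w))"
    using integrable_poly_growth[OF poly_growth_mult[OF tame_growth(1)[OF X] t(3)]] by simp
qed

section \<open>Triangular contractions and their covariances with functions of F\<close>

text \<open>A triangle with three derivatives of F as vertices; \<open>a\<close>, \<open>b\<close>
  and \<open>c\<close> count the indices shared by the three pairs, so each vertex has the order
  given by its two edges.\<close>

definition B :: "nat \<Rightarrow> nat \<Rightarrow> nat \<Rightarrow> (nat \<Rightarrow> real) \<Rightarrow> real" where
  "B a b c w = (\<Sum>x\<in>T a. \<Sum>y\<in>T b. \<Sum>z\<in>T c. D (x @ y) w * D (x @ z) w * D (y @ z) w)"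

text \<open>The triangle of \<open>B\<close> with a gradient of F hung on its third vertex. Grouped
  in this way it is a sum of products of two contractions, both covered by \<open>R_le\<close> when
  \<open>1 \<le> a\<close> and \<open>1 \<le> b + c\<close>.\<close>

definition G :: "nat \<Rightarrow> nat \<Rightarrow> nat \<Rightarrow> (nat \<Rightarrow> real) \<Rightarrow> real" where
  "G a b c w = (\<Sum>y\<in>T b. \<Sum>z\<in>T c. contr a y z w * contr 1 (y @ z) [] w)"

lemma polyDDD: "polyfun n (p + p + p) (\<lambda>w. D x w * D y w * D z w)"
  by (intro polyfun_mult polyD)

lemma polyG: "polyfun n (2 * p + 2 * p) (G a b c)"
  unfolding G_def[abs_def] by (intro polyfun_sum polyfun_mult poly_contr)

lemma D_append_commute: "D (x @ y) = D (y @ x)"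
  by (rule D_mset) simp

text \<open>Relabelling of vertices, so that \<open>B_ibp\<close> becomes available at each of
  them.\<close>

lemma B_swap12: "B a b c = B b a c"
proof
  fix w
  have "B a b c w = (\<Sum>y\<in>T b. \<Sum>x\<in>T a. \<Sum>z\<in>T c. D (x @ y) w * D (x @ z) w * D (y @ z) w)"
    unfolding B_def by (rule sum.swap)
  also have "\<dots> = B b a c w"
    unfolding B_def
  proof (intro sum.cong refl)
    fix x y z
    show "D (x @ y) w * D (x @ z) w * D (y @ z) w = D (y @ x) w * D (y @ z) w * D (x @ z) w"
      using D_append_commute[of x y] by simp
  qed
  finally show "B a b c w = B b a c w" .
qed

lemma B_swap23: "B a b c = B a c b"
proof
  fix w
  have "B a b c w = (\<Sum>x\<in>T a. \<Sum>z\<in>T c. \<Sum>y\<in>T b. D (x @ y) w * D (x @ z) w * D (y @ z) w)"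
    unfolding B_def by (rule sum.cong[OF refl]) (rule sum.swap)
  also have "\<dots> = B a c b w"
    unfolding B_def
  proof (intro sum.cong refl)
    fix x y z
    show "D (x @ y) w * D (x @ z) w * D (y @ z) w = D (x @ z) w * D (x @ y) w * D (z @ y) w"
      using D_append_commute[of y z] by simp
  qed
  finally show "B a b c w = B a c b w" .
qed

lemma expect_B:
  assumes "quad_C1 h h'"
  shows "expect (\<lambda>w. B a b c w * h (F w)) =
    (\<Sum>x\<in>T a. \<Sum>y\<in>T b. \<Sum>z\<in>T c. expect (\<lambda>w. (D (x @ y) w * D (x @ z) w * D (y @ z) w) * h (F w)))"
  unfolding B_def using integrable_compose(1)[OF polyDDD assms]
  by (simp add: sum_distrib_right)

text \<open>Integration by parts on the third vertex. The derivative of the test function attaches a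
  fourth vertex to it, which leaves the other two vertices joined by \<open>a\<close> edges.\<close>

lemma B_ibp:
  assumes h: "quad_C1 h h'" and bc: "b + c < p"
  shows "(real p - real (b + c)) * expect (\<lambda>w. B a b c w * h (F w)) =
    expect (\<lambda>w. B a (Suc b) c w * h (F w)) + expect (\<lambda>w. B a b (Suc c) w * h (F w)) +
    expect (\<lambda>w. G a b c w * h' (F w))"
proof -
  \<comment> \<open>The new index \<open>i\<close> joins the third vertex to the first vertex, to
    the second vertex, or to the test function.\<close>
  define u1 u2 u3 where "u1 x y z i = expect (\<lambda>w. (D (x @ i # y) w * D (x @ z) w * D (i # y @ z) w) * h (F w))"
    and "u2 x y z i = expect (\<lambda>w. (D (x @ y) w * D (x @ i # z) w * D (i # y @ z) w) * h (F w))"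
    and "u3 x y z i = expect (\<lambda>w. (D (x @ y) w * D (x @ z) w * (D (i # y @ z) w * D [i] w)) * h' (F w))" for x y z i
  have st: "(real p - real (b + c)) * expect (\<lambda>w. (D (x @ y) w * D (x @ z) w * D (y @ z) w) * h (F w)) =
     (\<Sum>i<n. u1 x y z i + u2 x y z i + u3 x y z i)" if "y \<in> T b" "z \<in> T c" for x y z
  proof -
    note tp = polyfun_mult[OF polyD polyD]
    note th = tame_compose[OF polyfun_tame[OF poly] h]
    have "(real p - real (b + c)) * expect (\<lambda>w. D (y @ z) w * ((D (x @ y) w * D (x @ z) w) * h (F w))) =
      (\<Sum>i<n. expect (\<lambda>w. partial i (D (y @ z)) w * partial i (\<lambda>w. (D (x @ y) w * D (x @ z) w) * h (F w)) w))"
      by (rule eigen_ibp[OF eigenD tame_mult[OF polyfun_tame[OF tp] th(1)]])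
         (use that in \<open>simp add: length_index_lists\<close>)
    also have "\<dots> = (\<Sum>i<n. u1 x y z i + u2 x y z i + u3 x y z i)"
    proof (intro sum.cong refl)
      fix i
      have m: "D (i # x @ y) = D (x @ i # y)" "D (i # x @ z) = D (x @ i # z)" by (rule D_mset, simp)+
      have "(\<lambda>w. partial i (D (y @ z)) w * partial i (\<lambda>w. (D (x @ y) w * D (x @ z) w) * h (F w)) w) =
        (\<lambda>w. ((D (x @ i # y) w * D (x @ z) w * D (i # y @ z) w) * h (F w) +
          (D (x @ y) w * D (x @ i # z) w * D (i # y @ z) w) * h (F w)) +
          (D (x @ y) w * D (x @ z) w * (D (i # y @ z) w * D [i] w)) * h' (F w))"
        unfolding C1_fun_mult(2)[OF polyfun_C1[OF tp] tame_C1[OF th(1)]]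
          C1_fun_mult(2)[OF polyfun_C1[OF polyD] polyfun_C1[OF polyD]] th(2) partial_D partial_F m
        by (simp add: algebra_simps)
      then show "expect (\<lambda>w. partial i (D (y @ z)) w * partial i (\<lambda>w. (D (x @ y) w * D (x @ z) w) * h (F w)) w) =
          u1 x y z i + u2 x y z i + u3 x y z i"
        unfolding u1_def u2_def u3_def
        using integrable_compose(1)[OF polyDDD h] integrable_compose(2)[OF polyfun_mult[OF tp tp] h]
        by simp
    qed
    finally show ?thesis by (simp add: mult_ac)
  qed
  have "(real p - real (b + c)) * expect (\<lambda>w. B a b c w * h (F w)) =
     (\<Sum>x\<in>T a. \<Sum>y\<in>T b. \<Sum>z\<in>T c. \<Sum>i<n. u1 x y z i + u2 x y z i + u3 x y z i)"
    unfolding expect_B[OF h] sum_distrib_left by (intro sum.cong refl st)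
  also have "\<dots> = (\<Sum>x\<in>T a. \<Sum>y\<in>T b. \<Sum>z\<in>T c. \<Sum>i<n. u1 x y z i) + (\<Sum>x\<in>T a. \<Sum>y\<in>T b. \<Sum>z\<in>T c. \<Sum>i<n. u2 x y z i) +
     (\<Sum>x\<in>T a. \<Sum>y\<in>T b. \<Sum>z\<in>T c. \<Sum>i<n. u3 x y z i)"
    by (simp only: sum.distrib)
  also have "(\<Sum>x\<in>T a. \<Sum>y\<in>T b. \<Sum>z\<in>T c. \<Sum>i<n. u1 x y z i) = expect (\<lambda>w. B a (Suc b) c w * h (F w))"
  proof -
    have "expect (\<lambda>w. B a (Suc b) c w * h (F w)) = (\<Sum>x\<in>T a. \<Sum>i<n. \<Sum>y\<in>T b. \<Sum>z\<in>T c. u1 x y z i)"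
      unfolding expect_B[OF h] sum_index_lists_Suc u1_def by simp
    also have "\<dots> = (\<Sum>x\<in>T a. \<Sum>y\<in>T b. \<Sum>z\<in>T c. \<Sum>i<n. u1 x y z i)"
      by (rule sum.cong[OF refl], rule trans[OF sum.swap], rule sum.cong[OF refl], rule sum.swap)
    finally show ?thesis ..
  qed
  also have "(\<Sum>x\<in>T a. \<Sum>y\<in>T b. \<Sum>z\<in>T c. \<Sum>i<n. u2 x y z i) = expect (\<lambda>w. B a b (Suc c) w * h (F w))"
  proof -
    have m: "D (y @ i # z) = D (i # y @ z)" for y z i by (rule D_mset) simp
    have "expect (\<lambda>w. B a b (Suc c) w * h (F w)) = (\<Sum>x\<in>T a. \<Sum>y\<in>T b. \<Sum>i<n. \<Sum>z\<in>T c. u2 x y z i)"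
      unfolding expect_B[OF h] sum_index_lists_Suc u2_def by (simp only: m[of y i z for y z i])
    also have "\<dots> = (\<Sum>x\<in>T a. \<Sum>y\<in>T b. \<Sum>z\<in>T c. \<Sum>i<n. u2 x y z i)"
      by (rule sum.cong[OF refl], rule sum.cong[OF refl], rule sum.swap)
    finally show ?thesis ..
  qed
  also have "(\<Sum>x\<in>T a. \<Sum>y\<in>T b. \<Sum>z\<in>T c. \<Sum>i<n. u3 x y z i) = expect (\<lambda>w. G a b c w * h' (F w))"
  proof -
    have cc: "contr a y z w * contr 1 (y @ z) [] w = (\<Sum>x\<in>T a. \<Sum>i<n. D (x @ y) w * D (x @ z) w * (D (i # y @ z) w * D [i] w))" for y z w
      by (simp add: contr_def sum_index_lists_1 sum_product)
    have "G a b c w * h' (F w) = (\<Sum>y\<in>T b. \<Sum>z\<in>T c. \<Sum>x\<in>T a. \<Sum>i<n.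
       (D (x @ y) w * D (x @ z) w * (D (i # y @ z) w * D [i] w)) * h' (F w))" for w
      by (simp only: G_def cc sum_distrib_right)
    then have "expect (\<lambda>w. G a b c w * h' (F w)) = (\<Sum>y\<in>T b. \<Sum>z\<in>T c. \<Sum>x\<in>T a. \<Sum>i<n. u3 x y z i)"
      unfolding u3_def using integrable_compose(2)[OF polyfun_mult[OF polyfun_mult[OF polyD polyD] polyfun_mult[OF polyD polyD]] h]
      by simp
    also have "\<dots> = (\<Sum>y\<in>T b. \<Sum>x\<in>T a. \<Sum>z\<in>T c. \<Sum>i<n. u3 x y z i)"
      by (rule sum.cong[OF refl], rule sum.swap)
    also have "\<dots> = (\<Sum>x\<in>T a. \<Sum>y\<in>T b. \<Sum>z\<in>T c. \<Sum>i<n. u3 x y z i)" by (rule sum.swap)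
    finally show ?thesis ..
  qed
  finally show ?thesis .
qed

text \<open>The constant of \<open>R_le\<close> made uniform in the orders of the
  contraction.\<close>

definition K :: real where "K = 5 ^ (2 * p) * (6 * (fact p)\<^sup>2)"

lemma K_pos: "0 < K" by (simp add: K_def)

lemma R_le_K: "1 \<le> j \<Longrightarrow> 1 \<le> b + c \<Longrightarrow> R j b c \<le> K * V"
proof -
  assume "1 \<le> j" "1 \<le> b + c"
  then have "R j b c \<le> 5 ^ (2 * p - (2 * j + b + c)) * (6 * (fact p)\<^sup>2 * V)" by (rule R_le)
  also have "\<dots> \<le> 5 ^ (2 * p) * (6 * (fact p)\<^sup>2 * V)"
    by (intro mult_right_mono power_increasing) (use V_nonneg in auto)
  finally show ?thesis by (simp add: K_def mult_ac)
qed

text \<open>Cauchy-Schwarz over the index pairs bounds \<open>G\<close> by the norms of its two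
  families of contractions. Hypercontractivity controls the fourth moments of both by
  \<open>R\<close>, so the product is of size \<open>V\<close> in mean square; the remaining factor
  is at most L times F, which has norm 1.\<close>

lemma G_bound:
  assumes h: "quad_C1 h h'" and L: "\<And>x. \<bar>h' x\<bar> \<le> L * \<bar>x\<bar>" and a: "1 \<le> a" and bc: "1 \<le> b + c"
  shows "\<bar>expect (\<lambda>w. G a b c w * h' (F w))\<bar> \<le> L * (sqrt H * K * V)"
proof -
  have L0: "0 \<le> L" using order_trans[OF abs_ge_zero L[of 1]] by simp
  define I where "I = T b \<times> T c"
  define P S where "P w = (\<Sum>q\<in>I. (contr a (fst q) (snd q) w)\<^sup>2)" and "S w = (\<Sum>q\<in>I. (contr 1 (fst q @ snd q) [] w)\<^sup>2)" for w
  have polyP: "polyfun n (2 * (2 * p)) P" and polyS: "polyfun n (2 * (2 * p)) S"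
    unfolding P_def[abs_def] S_def[abs_def] by (intro polyfun_sum polyfun_power2 poly_contr)+
  have P: "expect (\<lambda>w. (P w)\<^sup>2) \<le> H * (K * V)\<^sup>2"
  proof -
    have "expect (\<lambda>w. (P w)\<^sup>2) \<le> H * (\<Sum>q\<in>I. expect (\<lambda>w. (contr a (fst q) (snd q) w)\<^sup>2))\<^sup>2"
      unfolding P_def by (rule hypercontractive_vector[where n = n and d = "2 * p", OF H_nonneg hyper]) (assumption | rule poly_contr)+
    also have "(\<Sum>q\<in>I. expect (\<lambda>w. (contr a (fst q) (snd q) w)\<^sup>2)) = R a b c"
      unfolding I_def R_def by (simp add: sum.cartesian_product case_prod_beta')
    also have "H * (R a b c)\<^sup>2 \<le> H * (K * V)\<^sup>2"
      using R_le_K[OF a bc] R_nonneg H_nonneg by (intro mult_left_mono power_mono)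
    finally show ?thesis .
  qed
  have S: "expect (\<lambda>w. (S w)\<^sup>2) \<le> H * (K * V)\<^sup>2"
  proof -
    have "expect (\<lambda>w. (S w)\<^sup>2) \<le> H * (\<Sum>q\<in>I. expect (\<lambda>w. (contr 1 (fst q @ snd q) [] w)\<^sup>2))\<^sup>2"
      unfolding S_def by (rule hypercontractive_vector[where n = n and d = "2 * p", OF H_nonneg hyper]) (assumption | rule poly_contr)+
    also have "(\<Sum>q\<in>I. expect (\<lambda>w. (contr 1 (fst q @ snd q) [] w)\<^sup>2)) = R 1 (b + c) 0"
      unfolding I_def R_def by (simp add: sum.cartesian_product case_prod_beta' sum_index_lists_add)
    also have "H * (R 1 (b + c) 0)\<^sup>2 \<le> H * (K * V)\<^sup>2"
      using R_le_K[of 1 "b + c" 0] bc R_nonneg H_nonneg by (intro mult_left_mono power_mono) auto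
    finally show ?thesis .
  qed
  have KV: "0 \<le> K * V" using K_pos V_nonneg by simp
  have PS: "expect (\<lambda>w. P w * S w) \<le> H * (K * V)\<^sup>2"
  proof (rule power2_le_imp_le)
    have "(expect (\<lambda>w. P w * S w))\<^sup>2 \<le> expect (\<lambda>w. (P w)\<^sup>2) * expect (\<lambda>w. (S w)\<^sup>2)"
      by (rule poly_cauchy_schwarz[OF polyP polyS])
    also have "\<dots> \<le> (H * (K * V)\<^sup>2) * (H * (K * V)\<^sup>2)"
      using P S H_nonneg by (intro mult_mono) auto
    finally show "(expect (\<lambda>w. P w * S w))\<^sup>2 \<le> (H * (K * V)\<^sup>2)\<^sup>2" by (simp only: power2_eq_square)
    show "0 \<le> H * (K * V)\<^sup>2" using H_nonneg by simp
  qed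
  have G2: "(G a b c w)\<^sup>2 \<le> P w * S w" for w
  proof -
    let ?u = "\<lambda>q. contr a (fst q) (snd q) w" and ?v = "\<lambda>q. contr 1 (fst q @ snd q) [] w"
    have "\<bar>G a b c w\<bar> = \<bar>\<Sum>q\<in>I. ?u q * ?v q\<bar>"
      unfolding G_def I_def by (simp add: sum.cartesian_product case_prod_beta')
    also have "\<dots> \<le> (\<Sum>q\<in>I. \<bar>?u q\<bar> * \<bar>?v q\<bar>)" unfolding abs_mult[symmetric] by (rule sum_abs)
    also have "\<dots> \<le> L2_set ?u I * L2_set ?v I" by (rule L2_set_mult_ineq)
    finally have "\<bar>G a b c w\<bar>\<^sup>2 \<le> (L2_set ?u I * L2_set ?v I)\<^sup>2" by (intro power_mono) auto
    then show ?thesis by (simp add: L2_set_def power_mult_distrib sum_nonneg P_def S_def)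
  qed
  have "expect (\<lambda>w. (G a b c w)\<^sup>2) \<le> expect (\<lambda>w. P w * S w)"
    using G2 polyfun_integrable[OF polyfun_power2[OF polyG]] polyfun_integrable[OF polyfun_mult[OF polyP polyS]]
    by (intro integral_mono) auto
  then have EG2: "expect (\<lambda>w. (G a b c w)\<^sup>2) \<le> (sqrt H * (K * V))\<^sup>2"
    using PS H_nonneg by (simp add: power_mult_distrib)
  have t: "tame n (G a b c)" "tame n F" by (rule polyfun_tame, rule polyG, rule polyfun_tame, rule poly)
  note [measurable] = tame_measurable(1)[OF t(1)] tame_measurable(1)[OF t(2)]
  have cs: "integrable wiener (\<lambda>w. \<bar>G a b c w\<bar> * \<bar>F w\<bar>)"
    "(expect (\<lambda>w. \<bar>G a b c w\<bar> * \<bar>F w\<bar>))\<^sup>2 \<le> expect (\<lambda>w. (G a b c w)\<^sup>2) * expect (\<lambda>w. (F w)\<^sup>2)"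
    using expect_cauchy_schwarz[of "\<lambda>w. \<bar>G a b c w\<bar>" "\<lambda>w. \<bar>F w\<bar>"]
      polyfun_integrable[OF polyfun_power2[OF polyG]] polyfun_integrable[OF polyF2] by auto
  have E1: "expect (\<lambda>w. \<bar>G a b c w\<bar> * \<bar>F w\<bar>) \<le> sqrt H * (K * V)"
  proof (rule power2_le_imp_le)
    show "(expect (\<lambda>w. \<bar>G a b c w\<bar> * \<bar>F w\<bar>))\<^sup>2 \<le> (sqrt H * (K * V))\<^sup>2"
      using order_trans[OF cs(2)] EG2 norm1 by simp
    show "0 \<le> sqrt H * (K * V)" using H_nonneg KV by simp
  qed
  have "\<bar>expect (\<lambda>w. G a b c w * h' (F w))\<bar> \<le> expect (\<lambda>w. L * (\<bar>G a b c w\<bar> * \<bar>F w\<bar>))"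
  proof (rule order_trans[OF integral_abs_bound integral_mono])
    show "integrable wiener (\<lambda>w. \<bar>G a b c w * h' (F w)\<bar>)"
      using integrable_compose(2)[OF polyG h] by simp
    show "integrable wiener (\<lambda>w. L * (\<bar>G a b c w\<bar> * \<bar>F w\<bar>))" using cs(1) by simp
    show "\<bar>G a b c w * h' (F w)\<bar> \<le> L * (\<bar>G a b c w\<bar> * \<bar>F w\<bar>)" for w
      using mult_left_mono[OF L[of "F w"], of "\<bar>G a b c w\<bar>"] by (simp add: abs_mult mult_ac)
  qed
  also have "\<dots> = L * expect (\<lambda>w. \<bar>G a b c w\<bar> * \<bar>F w\<bar>)" by simp
  also have "\<dots> \<le> L * (sqrt H * (K * V))" using E1 L0 by (rule mult_left_mono)
  finally show ?thesis by (simp only: mult.assoc)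
qed

text \<open>Subtracting the product of means gives the recursion a harmless end: a triangle with all
  three vertices of order p is constant, and its covariance vanishes however large it is.\<close>

definition covB :: "(real \<Rightarrow> real) \<Rightarrow> nat \<Rightarrow> nat \<Rightarrow> nat \<Rightarrow> real" where
  "covB h a b c = expect (\<lambda>w. B a b c w * h (F w)) - expect (B a b c) * expect (\<lambda>w. h (F w))"

lemma quad_C1_const: "quad_C1 (\<lambda>_. 1) (\<lambda>_. 0)"
  unfolding quad_C1_def by (auto intro: exI[of _ 1])

text \<open>\<open>B_ibp\<close> for \<open>h\<close>, minus \<open>B_ibp\<close> for the constant 1
  times the mean of h(F). The constant has derivative zero, so only one \<open>G\<close> term
  remains.\<close>

lemma covB_step:
  assumes h: "quad_C1 h h'" and bc: "b + c < p"
  shows "(real p - real (b + c)) * covB h a b c = covB h a (Suc b) c + covB h a b (Suc c) + expect (\<lambda>w. G a b c w * h' (F w))"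
proof -
  have "(real p - real (b + c)) * expect (B a b c) = expect (B a (Suc b) c) + expect (B a b (Suc c))"
    using B_ibp[OF quad_C1_const bc, of a] by simp
  then have "(real p - real (b + c)) * (expect (B a b c) * e) = expect (B a (Suc b) c) * e + expect (B a b (Suc c)) * e" for e
    by (simp only: mult.assoc[symmetric] distrib_right)
  note this[of "expect (\<lambda>w. h (F w))"]
  then show ?thesis unfolding covB_def right_diff_distrib B_ibp[OF h bc] by linarith
qed

lemma B_high: "p < a + b \<or> p < a + c \<or> p < b + c \<Longrightarrow> B a b c = (\<lambda>_. 0)"
  unfolding B_def[abs_def] by (intro ext sum.neutral ballI) (auto simp: D_high length_index_lists)

text \<open>Edges are added at a vertex of order below p until some vertex exceeds order p, where
  \<open>B\<close> vanishes, or all have order p. A step produces three terms, hence the powers of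
  3. Two non-empty edges guarantee that each \<open>G\<close> met on the way satisfies the
  hypotheses of \<open>G_bound\<close>.\<close>

lemma covB_bound:
  assumes h: "quad_C1 h h'" and L: "\<And>x. \<bar>h' x\<bar> \<le> L * \<bar>x\<bar>"
    and "(1 \<le> a \<and> 1 \<le> b) \<or> (1 \<le> a \<and> 1 \<le> c) \<or> (1 \<le> b \<and> 1 \<le> c)"
  shows "\<bar>covB h a b c\<bar> \<le> 3 ^ (3 * p - (a + b + c)) * (L * (sqrt H * K * V))"
  using assms(3)
proof (induction "3 * p - (a + b + c)" arbitrary: a b c rule: less_induct)
  case less
  let ?M = "L * (sqrt H * K * V)"
  have L0: "0 \<le> L" using order_trans[OF abs_ge_zero L[of 1]] by simp
  have M: "0 \<le> ?M" using L0 H_nonneg K_pos V_nonneg by simp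
  show ?case
  proof (cases "p < a + b \<or> p < a + c \<or> p < b + c")
    case True
    then show ?thesis using M by (simp add: covB_def B_high)
  next
    case False
    then have N: "a + b + c < 3 * p" using p by linarith
    have main: "\<bar>covB h a' b' c'\<bar> \<le> 3 ^ (3 * p - (a + b + c)) * ?M"
      if "1 \<le> a'" "1 \<le> b' + c'" "b' + c' < p" and s: "a' + b' + c' = a + b + c" for a' b' c'
    proof -
      obtain k where k: "3 * p - (a + b + c) = Suc k" using N by (metis Suc_diff_Suc)
      have k1: "3 * p - (a' + Suc b' + c') = k" "3 * p - (a' + b' + Suc c') = k" using k s by linarith+
      have 1: "\<bar>covB h a' (Suc b') c'\<bar> \<le> 3 ^ k * ?M"
        using less.hyps[of a' "Suc b'" c'] that(1-3) k1 k by auto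
      have 2: "\<bar>covB h a' b' (Suc c')\<bar> \<le> 3 ^ k * ?M"
        using less.hyps[of a' b' "Suc c'"] that(1-3) k1 k by auto
      have 3: "\<bar>expect (\<lambda>w. G a' b' c' w * h' (F w))\<bar> \<le> 3 ^ k * ?M"
        using G_bound[OF h L that(1,2)] mult_right_mono[of 1 "3 ^ k" ?M] M by simp
      have "1 * \<bar>covB h a' b' c'\<bar> \<le> (real p - real (b' + c')) * \<bar>covB h a' b' c'\<bar>"
        using that(3) by (intro mult_right_mono) linarith+
      also have "\<dots> = \<bar>(real p - real (b' + c')) * covB h a' b' c'\<bar>"
        using that(3) by (simp add: abs_mult)
      also have "\<dots> \<le> 3 * (3 ^ k * ?M)" unfolding covB_step[OF h that(3)] using 1 2 3 by linarith
      finally show ?thesis unfolding k by simp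
    qed
    \<comment> \<open>The vertex to be integrated by parts must face a non-empty edge. If a = 0 and
      b + c < p, then b and c are positive, and the vertex with edges a and c has order c < p and
      faces the edge b.\<close>
    consider "1 \<le> a" "b + c < p" | "1 \<le> b" "a + c < p" | "1 \<le> c" "a + b < p" | "a + b = p" "a + c = p" "b + c = p"
      using less.prems False by linarith
    then show ?thesis
    proof cases
      case 1
      then show ?thesis using main[of a b c] less.prems by auto
    next
      case 2
      have "covB h a b c = covB h b a c" unfolding covB_def by (simp only: B_swap12[of a b c])
      then show ?thesis using 2 main[of b a c] less.prems by auto
    next
      case 3
      have "covB h a b c = covB h c a b" unfolding covB_def by (simp only: B_swap23[of a b c] B_swap12[of a c b])
      then show ?thesis using 3 main[of c a b] less.prems by auto
    next
      case 4
      have "B a b c w = (\<Sum>x\<in>T a. \<Sum>y\<in>T b. \<Sum>z\<in>T c. f (x @ y) * f (x @ z) * f (y @ z))" for w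
        unfolding B_def using 4 by (intro sum.cong refl) (simp add: D_top length_index_lists)
      then obtain k where "B a b c = (\<lambda>_. k)" by blast
      then have "covB h a b c = 0" by (simp add: covB_def)
      then show ?thesis using M by simp
    qed
  qed
qed

section \<open>Norms of the iterated derivatives and their covariances\<close>

definition A :: "nat \<Rightarrow> (nat \<Rightarrow> real) \<Rightarrow> real" where "A j w = (\<Sum>x\<in>T j. (D x w)\<^sup>2)"

lemma A_1: "A 1 = \<Gamma>"
  by (simp add: A_def \<Gamma>_def sum_index_lists_1 fun_eq_iff)

lemma A_0: "A 0 w = (F w)\<^sup>2"
  by (simp add: A_def D_Nil)

text \<open>Integrating one of the two equal factors by parts raises the order of both derivatives;
  the derivative that falls on h(F) brings in the gradient of F and leaves the degenerate triangle
  \<open>B j 1 0\<close>.\<close>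

lemma A_ibp:
  assumes h: "quad_C1 h h'"
  shows "(real p - real j) * expect (\<lambda>w. A j w * h (F w)) =
    expect (\<lambda>w. A (Suc j) w * h (F w)) + expect (\<lambda>w. B j 1 0 w * h' (F w))"
proof -
  note th = tame_compose[OF polyfun_tame[OF poly] h] and tp = polyfun_mult[OF polyD polyD]
  note int = integrable_compose(1)[OF tp h] integrable_compose(2)[OF polyDDD h]
  have "(real p - real j) * expect (\<lambda>w. D x w * D x w * h (F w)) =
     (\<Sum>i<n. expect (\<lambda>w. D (i # x) w * D (i # x) w * h (F w)) + expect (\<lambda>w. D (i # x) w * D x w * D [i] w * h' (F w)))"
    if "x \<in> T j" for x
  proof -
    have "(real p - real j) * expect (\<lambda>w. D x w * (D x w * h (F w))) = (\<Sum>i<n. expect (\<lambda>w. partial i (D x) w * partial i (\<lambda>w. D x w * h (F w)) w))"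
      by (rule eigen_ibp[OF eigenD tame_mult[OF polyfun_tame[OF polyD] th(1)]]) (use that in \<open>simp add: length_index_lists\<close>)
    also have "\<dots> = (\<Sum>i<n. expect (\<lambda>w. D (i # x) w * D (i # x) w * h (F w) + D (i # x) w * D x w * D [i] w * h' (F w)))"
      unfolding C1_fun_mult(2)[OF polyfun_C1[OF polyD] tame_C1[OF th(1)]] th(2) partial_D partial_F by (simp add: algebra_simps)
    finally show ?thesis using int by (simp add: mult.assoc)
  qed
  then have "(real p - real j) * (\<Sum>x\<in>T j. expect (\<lambda>w. D x w * D x w * h (F w))) =
     (\<Sum>x\<in>T j. \<Sum>i<n. expect (\<lambda>w. D (i # x) w * D (i # x) w * h (F w))) +
     (\<Sum>x\<in>T j. \<Sum>i<n. expect (\<lambda>w. D (i # x) w * D x w * D [i] w * h' (F w)))"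
    unfolding sum_distrib_left sum.distrib[symmetric] by (intro sum.cong refl) simp
  moreover have "expect (\<lambda>w. A j w * h (F w)) = (\<Sum>x\<in>T j. expect (\<lambda>w. D x w * D x w * h (F w)))"
    for j unfolding A_def power2_eq_square sum_distrib_right using int by simp
  moreover have "(\<Sum>x\<in>T (Suc j). expect (\<lambda>w. D x w * D x w * h (F w))) = (\<Sum>x\<in>T j. \<Sum>i<n. expect (\<lambda>w. D (i # x) w * D (i # x) w * h (F w)))"
    unfolding sum_index_lists_Suc by (rule sum.swap)
  moreover have "expect (\<lambda>w. B j 1 0 w * h' (F w)) = (\<Sum>x\<in>T j. \<Sum>i<n. expect (\<lambda>w. D (i # x) w * D x w * D [i] w * h' (F w)))"
  proof -
    have "D (x @ [i]) = D (i # x)" for x i by (rule D_mset) simp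
    then have "B j 1 0 w * h' (F w) = (\<Sum>x\<in>T j. \<Sum>i<n. D (i # x) w * D x w * D [i] w * h' (F w))" for w
      by (simp add: B_def sum_index_lists_1 sum_distrib_right)
    then show ?thesis using int by simp
  qed
  ultimately show ?thesis by simp
qed

lemma expect_A_step: "(real p - real j) * expect (A j) = expect (A (Suc j))"
  using A_ibp[OF quad_C1_const, of j] by simp

lemma expect_A_le: "expect (A j) \<le> p ^ j"
proof (induction j)
  case 0
  then show ?case by (simp add: A_0 norm1)
next
  case (Suc j)
  have 0: "0 \<le> expect (A j)" unfolding A_def by (simp add: sum_nonneg)
  have "expect (A (Suc j)) = (real p - real j) * expect (A j)" by (simp add: expect_A_step)
  also have "\<dots> \<le> real p * real (p ^ j)" using Suc 0 by (intro mult_mono) auto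
  finally show ?case by simp
qed

text \<open>Summing out the single edge writes \<open>B j 1 0\<close> as a pairing of derivatives of
  bounded norm with contractions of size \<open>sqrt V\<close>. The uncentred mean is thus of that
  size, and \<open>covA_bound\<close> pairs it with a second mean of the same size.\<close>

lemma expect_B1_le:
  assumes "1 \<le> j" "j \<le> p"
  shows "(expect (B j 1 0))\<^sup>2 \<le> real (p ^ p) * (K * V)"
proof -
  have eq: "B j 1 0 w = (\<Sum>x\<in>T j. D x w * contr 1 x [] w)" for w
  proof -
    have m: "D (x @ [i]) = D (i # x)" for x i by (rule D_mset) simp
    show ?thesis by (simp add: B_def contr_def sum_index_lists_1 sum_distrib_left m mult_ac)
  qed
  have pD: "polyfun n (2 * p) (D x)" for x by (rule polyfun_mono[OF polyD]) auto
  have "expect (B j 1 0) = (\<Sum>x\<in>T j. expect (\<lambda>w. D x w * contr 1 x [] w))"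
    unfolding eq[abs_def] using polyfun_integrable[OF polyfun_mult[OF pD poly_contr]] by simp
  then have "(expect (B j 1 0))\<^sup>2 \<le> (\<Sum>x\<in>T j. expect (\<lambda>w. (D x w)\<^sup>2)) * (\<Sum>x\<in>T j. expect (\<lambda>w. (contr 1 x [] w)\<^sup>2))"
    using expect_sum_mult_le[of "T j" n "2 * p" D "\<lambda>x. contr 1 x []"] pD poly_contr by simp
  also have "(\<Sum>x\<in>T j. expect (\<lambda>w. (D x w)\<^sup>2)) = expect (A j)"
    unfolding A_def using polyfun_integrable[OF polyfun_power2[OF polyD]] by simp
  also have "(\<Sum>x\<in>T j. expect (\<lambda>w. (contr 1 x [] w)\<^sup>2)) = R 1 j 0" by (simp add: R_def)
  also have "expect (A j) * R 1 j 0 \<le> real (p ^ p) * (K * V)"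
  proof (rule mult_mono)
    have "expect (A j) \<le> real (p ^ j)" by (rule expect_A_le)
    also have "\<dots> \<le> real (p ^ p)" using assms p by (simp add: power_increasing)
    finally show "expect (A j) \<le> real (p ^ p)" .
    show "R 1 j 0 \<le> K * V" using assms by (intro R_le_K) auto
  qed (auto simp: R_nonneg)
  finally show ?thesis .
qed

definition covA :: "(real \<Rightarrow> real) \<Rightarrow> nat \<Rightarrow> real" where
  "covA h j = expect (\<lambda>w. A j w * h (F w)) - expect (A j) * expect (\<lambda>w. h (F w))"

lemma covA_step:
  assumes "quad_C1 h h'"
  shows "(real p - real j) * covA h j = covA h (Suc j) + expect (\<lambda>w. B j 1 0 w * h' (F w))"
proof -
  have "(real p - real j) * (expect (A j) * e) = expect (A (Suc j)) * e" for e
    by (simp add: expect_A_step flip: mult.assoc)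
  then show ?thesis unfolding covA_def right_diff_distrib A_ibp[OF assms] by simp
qed

text \<open>The recursion starts from \<open>A p\<close>, which is constant, and each step adds one
  expectation of \<open>B j 1 0\<close> against h'(F). Its covariance part is linear in
  \<open>V\<close> by \<open>covB_bound\<close>, and the product of means is at most a constant
  times L times \<open>sqrt V\<close> squared.\<close>

lemma covA_bound:
  assumes h: "quad_C1 h h'" "quad_C1 h' h''" and L: "\<And>x. \<bar>h'' x\<bar> \<le> L * \<bar>x\<bar>"
    and e: "\<bar>expect (\<lambda>w. h' (F w))\<bar> \<le> L * sqrt V"
  shows "\<bar>covA h 1\<bar> \<le> p * (L * ((3 ^ (3 * p) * sqrt H * K + sqrt (real (p ^ p) * K)) * V))"
proof -
  let ?E = "L * ((3 ^ (3 * p) * sqrt H * K + sqrt (real (p ^ p) * K)) * V)"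
  have L0: "0 \<le> L" using order_trans[OF abs_ge_zero L[of 1]] by simp
  have E: "\<bar>expect (\<lambda>w. B j 1 0 w * h' (F w))\<bar> \<le> ?E" if j: "1 \<le> j" "j \<le> p" for j
  proof -
    have "\<bar>covB h' j 1 0\<bar> \<le> 3 ^ (3 * p - (j + 1 + 0)) * (L * (sqrt H * K * V))"
      by (rule covB_bound[OF h(2) L]) (use j in auto)
    also have "\<dots> \<le> 3 ^ (3 * p) * (L * (sqrt H * K * V))"
      by (intro mult_right_mono power_increasing) (use L0 H_nonneg K_pos V_nonneg in auto)
    finally have 1: "\<bar>covB h' j 1 0\<bar> \<le> 3 ^ (3 * p) * (L * (sqrt H * K * V))" .
    have "\<bar>expect (B j 1 0)\<bar> \<le> sqrt (real (p ^ p) * K) * sqrt V"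
      using expect_B1_le[OF j] by (simp add: real_le_rsqrt mult.assoc flip: real_sqrt_mult)
    then have "\<bar>expect (B j 1 0)\<bar> * \<bar>expect (\<lambda>w. h' (F w))\<bar> \<le> (sqrt (real (p ^ p) * K) * sqrt V) * (L * sqrt V)"
      using e by (intro mult_mono) (auto intro!: mult_nonneg_nonneg simp: K_pos[THEN less_imp_le] V_nonneg)
    also have "\<dots> = L * (sqrt (real (p ^ p) * K) * (sqrt V * sqrt V))" by (simp only: mult_ac)
    also have "sqrt V * sqrt V = V" using V_nonneg by simp
    finally have 2: "\<bar>expect (B j 1 0) * expect (\<lambda>w. h' (F w))\<bar> \<le> L * (sqrt (real (p ^ p) * K) * V)" by (simp add: abs_mult)
    have "\<bar>expect (\<lambda>w. B j 1 0 w * h' (F w))\<bar> \<le> \<bar>covB h' j 1 0\<bar> + \<bar>expect (B j 1 0) * expect (\<lambda>w. h' (F w))\<bar>"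
      unfolding covB_def by linarith
    also have "\<dots> \<le> ?E" using 1 2 by (simp add: algebra_simps)
    finally show ?thesis .
  qed
  \<comment> \<open>The induction counts the distance from the top order p, because
    \<open>covA_step\<close> controls \<open>A j\<close> by \<open>A (Suc j)\<close>.\<close>
  have "j \<le> p - 1 \<Longrightarrow> \<bar>covA h (p - j)\<bar> \<le> real j * ?E" for j
  proof (induction j)
    case 0
    have "A p w = (\<Sum>x\<in>T p. (f x)\<^sup>2)" for w
      unfolding A_def by (intro sum.cong refl) (simp add: D_top length_index_lists)
    then obtain k where "A p = (\<lambda>_. k)" by blast
    then show ?case by (simp add: covA_def)
  next
    case (Suc j)
    let ?q = "p - Suc j"
    have q: "1 \<le> ?q" "?q \<le> p" "Suc ?q = p - j" "real p - real ?q = real (Suc j)" using Suc.prems p by auto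
    have "1 * \<bar>covA h ?q\<bar> \<le> (real p - real ?q) * \<bar>covA h ?q\<bar>" unfolding q(4) by (intro mult_right_mono) auto
    also have "\<dots> = \<bar>(real p - real ?q) * covA h ?q\<bar>" unfolding q(4) by (simp add: abs_mult)
    also have "\<dots> \<le> real j * ?E + ?E"
      unfolding covA_step[OF h(1)] q(3) using Suc.IH Suc.prems E[OF q(1,2)] by (intro order_trans[OF abs_triangle_ineq] add_mono) auto
    finally show ?case by (simp add: algebra_simps)
  qed
  from this[of "p - 1"] have "\<bar>covA h 1\<bar> \<le> real (p - 1) * ?E" using p by simp
  also have "\<dots> \<le> real p * ?E"
    by (intro mult_right_mono) (use L0 H_nonneg K_pos V_nonneg in \<open>auto intro!: mult_nonneg_nonneg add_nonneg_nonneg\<close>)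
  finally show ?thesis .
qed

end

section \<open>Taylor estimates for sine and cosine\<close>

text \<open>Lets expectations be differentiated without dominated convergence: a quadratic Taylor
  remainder survives integration, since F^2 has mean 1.\<close>

lemma DERIV_quadratic_remainder:
  fixes g :: "real \<Rightarrow> real"
  assumes "\<And>h. \<bar>g (u + h) - g u - h * d\<bar> \<le> h\<^sup>2"
  shows "(g has_real_derivative d) (at u)"
proof -
  have "((\<lambda>h. (g (u + h) - g u) / h - d) \<longlongrightarrow> 0) (at 0)"
  proof (rule Lim_null_comparison)
    show "\<forall>\<^sub>F h in at 0. norm ((g (u + h) - g u) / h - d) \<le> \<bar>h\<bar>"
      unfolding eventually_at_filter
    proof (intro always_eventually allI impI)
      fix h :: real assume h: "h \<noteq> 0"
      have "\<bar>(g (u + h) - g u) / h - d\<bar> = \<bar>g (u + h) - g u - h * d\<bar> / \<bar>h\<bar>"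
        using h by (simp add: field_simps flip: abs_divide)
      also have "\<dots> \<le> h\<^sup>2 / \<bar>h\<bar>" by (intro divide_right_mono assms) simp
      also have "\<dots> = \<bar>h\<bar>" using h by (simp add: power2_eq_square abs_if)
      finally show "norm ((g (u + h) - g u) / h - d) \<le> \<bar>h\<bar>" by simp
    qed
    show "((\<lambda>h::real. \<bar>h\<bar>) \<longlongrightarrow> 0) (at 0)" by (auto intro!: tendsto_eq_intros)
  qed
  then show ?thesis unfolding DERIV_def by (rule LIM_zero_cancel)
qed

lemma sin_minus_self_bound: "\<bar>sin b - b\<bar> \<le> b\<^sup>2 / 2" for b :: real
  using Maclaurin_sin_bound[of b 2] by (simp add: numeral_2_eq_2 sin_coeff_def power2_eq_square)

lemma cos_minus_one_bound: "\<bar>cos b - 1\<bar> \<le> b\<^sup>2 / 2" for b :: real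
proof -
  have "\<bar>cos b - 1\<bar> = 2 * (sin (b / 2))\<^sup>2" using cos_double_sin[of "b / 2"] by simp
  also have "\<dots> \<le> 2 * (b / 2)\<^sup>2"
    using abs_sin_x_le_abs_x[of "b / 2"] abs_le_square_iff[of "sin (b / 2)" "b / 2"] by (intro mult_left_mono) auto
  finally show ?thesis by (simp add: power2_eq_square)
qed

lemma one_minus_cos_bound: "\<bar>cos b - 1\<bar> \<le> \<bar>b\<bar>" for b :: real
proof -
  have "\<bar>cos b - 1\<bar> = 2 * (\<bar>sin (b / 2)\<bar> * \<bar>sin (b / 2)\<bar>)"
    using cos_double_sin[of "b / 2"] by (simp add: power2_eq_square flip: abs_mult)
  also have "\<dots> \<le> 2 * (1 * \<bar>b / 2\<bar>)"
    by (intro mult_left_mono mult_mono abs_sin_le_one abs_sin_x_le_abs_x) auto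
  finally show ?thesis by simp
qed

lemma cos_second_order: "\<bar>cos (a + b) - cos a - b * (- sin a)\<bar> \<le> b\<^sup>2" for a b :: real
proof -
  have "cos (a + b) - cos a - b * (- sin a) = cos a * (cos b - 1) - sin a * (sin b - b)"
    by (simp add: cos_add algebra_simps)
  also have "\<bar>\<dots>\<bar> \<le> \<bar>cos a\<bar> * \<bar>cos b - 1\<bar> + \<bar>sin a\<bar> * \<bar>sin b - b\<bar>"
    unfolding abs_mult[symmetric] by (rule abs_triangle_ineq4)
  also have "\<dots> \<le> 1 * (b\<^sup>2 / 2) + 1 * (b\<^sup>2 / 2)"
    by (intro add_mono mult_mono abs_sin_le_one abs_cos_le_one sin_minus_self_bound cos_minus_one_bound) auto
  finally show ?thesis by simp
qed

lemma sin_second_order: "\<bar>sin (a + b) - sin a - b * cos a\<bar> \<le> b\<^sup>2" for a b :: real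
proof -
  have "sin (a + b) - sin a - b * cos a = sin a * (cos b - 1) + cos a * (sin b - b)"
    by (simp add: sin_add algebra_simps)
  also have "\<bar>\<dots>\<bar> \<le> \<bar>sin a\<bar> * \<bar>cos b - 1\<bar> + \<bar>cos a\<bar> * \<bar>sin b - b\<bar>"
    unfolding abs_mult[symmetric] by (rule abs_triangle_ineq)
  also have "\<dots> \<le> 1 * (b\<^sup>2 / 2) + 1 * (b\<^sup>2 / 2)"
    by (intro add_mono mult_mono abs_sin_le_one abs_cos_le_one sin_minus_self_bound cos_minus_one_bound) auto
  finally show ?thesis by simp
qed

lemma le_quad: "\<bar>x\<bar> \<le> 1 + x\<^sup>2" for x :: real
  using zero_le_power2[of "\<bar>x\<bar> - 1"] zero_le_power2[of x] by (simp add: power2_eq_square algebra_simps)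

lemma quad_C1_cos: "quad_C1 (\<lambda>x. cos (u * x)) (\<lambda>x. - u * sin (u * x))"
  unfolding quad_C1_def
proof (intro conjI allI exI[of _ "1 + \<bar>u\<bar>"])
  fix x :: real
  show "((\<lambda>x. cos (u * x)) has_real_derivative - u * sin (u * x)) (at x)"
    by (auto intro!: derivative_eq_intros)
  have 1: "1 + \<bar>u\<bar> \<le> (1 + \<bar>u\<bar>) * (1 + x\<^sup>2)" using mult_left_mono[of 1 "1 + x\<^sup>2" "1 + \<bar>u\<bar>"] by simp
  show "\<bar>cos (u * x)\<bar> \<le> (1 + \<bar>u\<bar>) * (1 + x\<^sup>2)" using 1 abs_cos_le_one[of "u * x"] by linarith
  have "\<bar>u\<bar> * \<bar>sin (u * x)\<bar> \<le> \<bar>u\<bar> * 1" by (intro mult_left_mono abs_sin_le_one) simp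
  then show "\<bar>- u * sin (u * x)\<bar> \<le> (1 + \<bar>u\<bar>) * (1 + x\<^sup>2)" using 1 by (simp only: abs_mult abs_minus_cancel; linarith)
qed (intro continuous_intros)

lemma quad_C1_sin: "quad_C1 (\<lambda>x. sin (u * x)) (\<lambda>x. u * cos (u * x))"
  unfolding quad_C1_def
proof (intro conjI allI exI[of _ "1 + \<bar>u\<bar>"])
  fix x :: real
  show "((\<lambda>x. sin (u * x)) has_real_derivative u * cos (u * x)) (at x)"
    by (auto intro!: derivative_eq_intros)
  have 1: "1 + \<bar>u\<bar> \<le> (1 + \<bar>u\<bar>) * (1 + x\<^sup>2)" using mult_left_mono[of 1 "1 + x\<^sup>2" "1 + \<bar>u\<bar>"] by simp
  show "\<bar>sin (u * x)\<bar> \<le> (1 + \<bar>u\<bar>) * (1 + x\<^sup>2)" using 1 abs_sin_le_one[of "u * x"] by linarith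
  have "\<bar>u\<bar> * \<bar>cos (u * x)\<bar> \<le> \<bar>u\<bar> * 1" by (intro mult_left_mono abs_cos_le_one) simp
  then show "\<bar>u * cos (u * x)\<bar> \<le> (1 + \<bar>u\<bar>) * (1 + x\<^sup>2)" using 1 by (simp only: abs_mult; linarith)
qed (intro continuous_intros)

text \<open>The remainders of the second order Taylor expansion of \<open>1 - cos (s x)\<close> at 0.\<close>

lemma quad_C1_remainder:
  assumes "0 \<le> s" "s \<le> 1"
  shows "quad_C1 (\<lambda>x. 1 - cos (s * x) - s\<^sup>2 / 2 * x\<^sup>2) (\<lambda>x. s * sin (s * x) - s\<^sup>2 * x)"
    and "quad_C1 (\<lambda>x. s * sin (s * x) - s\<^sup>2 * x) (\<lambda>x. s\<^sup>2 * cos (s * x) - s\<^sup>2)"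
proof -
  have s2: "s\<^sup>2 \<le> 1" using assms by (simp add: power_le_one)
  have b0: "\<bar>1 - cos (s * x) - s\<^sup>2 / 2 * x\<^sup>2\<bar> \<le> 2 * (1 + x\<^sup>2)" for x
  proof -
    have *: "\<bar>1 - c - t\<bar> \<le> 2 * (1 + y)" if "\<bar>c\<bar> \<le> 1" "0 \<le> t" "t \<le> y" for c t y :: real
    proof -
      have "- 1 \<le> c" "c \<le> 1" using that(1) by auto
      then show ?thesis using that(2,3) unfolding abs_le_iff by (intro conjI; simp add: distrib_left; linarith)
    qed
    have "0 \<le> s\<^sup>2 / 2 * x\<^sup>2" by simp
    moreover have "s\<^sup>2 / 2 * x\<^sup>2 \<le> 1 * x\<^sup>2" by (rule mult_right_mono) (use s2 in auto)
    ultimately show ?thesis using *[OF abs_cos_le_one] by simp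
  qed
  have b1: "\<bar>s * sin (s * x) - s\<^sup>2 * x\<bar> \<le> 2 * (1 + x\<^sup>2)" for x
  proof -
    have "\<bar>s * sin (s * x) - s\<^sup>2 * x\<bar> \<le> \<bar>s\<bar> * \<bar>sin (s * x)\<bar> + \<bar>s\<^sup>2\<bar> * \<bar>x\<bar>"
      unfolding abs_mult[symmetric] by (rule abs_triangle_ineq4)
    also have "\<dots> \<le> 1 * 1 + 1 * (1 + x\<^sup>2)"
      using assms s2 by (intro add_mono mult_mono abs_sin_le_one le_quad) auto
    also have "\<dots> \<le> 2 * (1 + x\<^sup>2)" by simp
    finally show ?thesis .
  qed
  have b2: "\<bar>s\<^sup>2 * cos (s * x) - s\<^sup>2\<bar> \<le> 2 * (1 + x\<^sup>2)" for x
  proof -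
    have "\<bar>s\<^sup>2 * cos (s * x) - s\<^sup>2\<bar> \<le> \<bar>s\<^sup>2\<bar> * \<bar>cos (s * x)\<bar> + \<bar>s\<^sup>2\<bar>"
      unfolding abs_mult[symmetric] by (rule abs_triangle_ineq4)
    also have "\<dots> \<le> 1 * 1 + 1"
      using s2 by (intro add_mono mult_mono abs_cos_le_one) auto
    also have "\<dots> \<le> 2 * (1 + x\<^sup>2)" by simp
    finally show ?thesis .
  qed
  show "quad_C1 (\<lambda>x. 1 - cos (s * x) - s\<^sup>2 / 2 * x\<^sup>2) (\<lambda>x. s * sin (s * x) - s\<^sup>2 * x)"
    unfolding quad_C1_def
    by (intro conjI allI exI[of _ 2] b0 b1)
       (auto intro!: derivative_eq_intros continuous_intros simp: power2_eq_square)
  show "quad_C1 (\<lambda>x. s * sin (s * x) - s\<^sup>2 * x) (\<lambda>x. s\<^sup>2 * cos (s * x) - s\<^sup>2)"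
    unfolding quad_C1_def
    by (intro conjI allI exI[of _ 2] b1 b2)
       (auto intro!: derivative_eq_intros continuous_intros simp: power2_eq_square)
qed

context unit_chaos_hyper
begin

section \<open>Differential equations for the characteristic function of F\<close>

lemma integrable_cos: "integrable wiener (\<lambda>w. cos (u * F w))" "polyfun n d X \<Longrightarrow> integrable wiener (\<lambda>w. X w * cos (u * F w))"
  using integrable_compose(1)[OF polyfun.const[of n 0 1] quad_C1_cos] integrable_compose(1)[OF _ quad_C1_cos] by auto

lemma integrable_sin: "integrable wiener (\<lambda>w. sin (u * F w))" "polyfun n d X \<Longrightarrow> integrable wiener (\<lambda>w. X w * sin (u * F w))"
  using integrable_compose(1)[OF polyfun.const[of n 0 1] quad_C1_sin] integrable_compose(1)[OF _ quad_C1_sin] by auto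

text \<open>The gradient of h(F) is h'(F) times that of F, so \<open>eigen_ibp\<close> turns the
  factor F into \<open>\<Gamma>\<close>.\<close>

lemma stein:
  assumes h: "quad_C1 h h'"
  shows "p * expect (\<lambda>w. F w * h (F w)) = expect (\<lambda>w. \<Gamma> w * h' (F w))"
proof -
  note th = tame_compose[OF polyfun_tame[OF poly] h]
  have "p * expect (\<lambda>w. F w * h (F w)) = (\<Sum>i<n. expect (\<lambda>w. (D [i] w)\<^sup>2 * h' (F w)))"
    using eigen_ibp[OF eigenF th(1)] unfolding th(2) partial_F by (simp add: power2_eq_square mult_ac)
  also have "\<dots> = expect (\<lambda>w. \<Gamma> w * h' (F w))"
    unfolding \<Gamma>_def sum_distrib_right using integrable_compose(2)[OF polyfun_power2[OF polyD] h] by simp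
  finally show ?thesis .
qed

lemma DERIV_char:
  "((\<lambda>u. expect (\<lambda>w. cos (u * F w))) has_real_derivative - expect (\<lambda>w. F w * sin (u * F w))) (at u)"
  "((\<lambda>u. expect (\<lambda>w. sin (u * F w))) has_real_derivative expect (\<lambda>w. F w * cos (u * F w))) (at u)"
proof -
  note int = integrable_cos integrable_sin integrable_cos(2)[OF poly] integrable_sin(2)[OF poly] polyfun_integrable[OF polyF2]
  have bd: "\<bar>expect X\<bar> \<le> h\<^sup>2" if X: "integrable wiener X" and b: "\<And>w. \<bar>X w\<bar> \<le> (h * F w)\<^sup>2" for X h
  proof -
    have "\<bar>expect X\<bar> \<le> expect (\<lambda>w. \<bar>X w\<bar>)" by (rule integral_abs_bound)
    also have "\<dots> \<le> expect (\<lambda>w. h\<^sup>2 * (F w)\<^sup>2)"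
      using X b int(7) by (intro integral_mono) (auto simp: power_mult_distrib)
    also have "\<dots> = h\<^sup>2" by (simp add: norm1)
    finally show ?thesis .
  qed
  show "((\<lambda>u. expect (\<lambda>w. cos (u * F w))) has_real_derivative - expect (\<lambda>w. F w * sin (u * F w))) (at u)"
  proof (rule DERIV_quadratic_remainder)
    fix h
    have "expect (\<lambda>w. cos ((u + h) * F w)) - expect (\<lambda>w. cos (u * F w)) - h * - expect (\<lambda>w. F w * sin (u * F w)) =
      expect (\<lambda>w. cos (u * F w + h * F w) - cos (u * F w) - (h * F w) * (- sin (u * F w)))"
      using int by (simp add: distrib_right[symmetric] mult.assoc)
    also have "\<bar>\<dots>\<bar> \<le> h\<^sup>2"
    proof (rule bd)
      show "integrable wiener (\<lambda>w. cos (u * F w + h * F w) - cos (u * F w) - (h * F w) * (- sin (u * F w)))"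
        using int by (simp add: distrib_right[symmetric] mult.assoc)
    qed (rule cos_second_order)
    finally show "\<bar>expect (\<lambda>w. cos ((u + h) * F w)) - expect (\<lambda>w. cos (u * F w)) - h * - expect (\<lambda>w. F w * sin (u * F w))\<bar> \<le> h\<^sup>2" .
  qed
  show "((\<lambda>u. expect (\<lambda>w. sin (u * F w))) has_real_derivative expect (\<lambda>w. F w * cos (u * F w))) (at u)"
  proof (rule DERIV_quadratic_remainder)
    fix h
    have "expect (\<lambda>w. sin ((u + h) * F w)) - expect (\<lambda>w. sin (u * F w)) - h * expect (\<lambda>w. F w * cos (u * F w)) =
      expect (\<lambda>w. sin (u * F w + h * F w) - sin (u * F w) - (h * F w) * cos (u * F w))"
      using int by (simp add: distrib_right[symmetric] mult.assoc)
    also have "\<bar>\<dots>\<bar> \<le> h\<^sup>2"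
    proof (rule bd)
      show "integrable wiener (\<lambda>w. sin (u * F w + h * F w) - sin (u * F w) - (h * F w) * cos (u * F w))"
        using int by (simp add: distrib_right[symmetric] mult.assoc)
    qed (rule sin_second_order)
    finally show "\<bar>expect (\<lambda>w. sin ((u + h) * F w)) - expect (\<lambda>w. sin (u * F w)) - h * expect (\<lambda>w. F w * cos (u * F w))\<bar> \<le> h\<^sup>2" .
  qed
qed

lemma poly\<Gamma>p: "polyfun n (2 * p) (\<lambda>w. \<Gamma> w - p)"
  by (rule polyfun_diff[OF poly\<Gamma> polyfun.const])

text \<open>Writing \<open>\<Gamma>\<close> as p plus its deviation separates the Gaussian equation
  from the defect.\<close>

lemma F_cos_eq:
  "expect (\<lambda>w. F w * cos (u * F w)) = - u * expect (\<lambda>w. sin (u * F w)) - u / p * expect (\<lambda>w. (\<Gamma> w - p) * sin (u * F w))"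
proof -
  have "expect (\<lambda>w. \<Gamma> w * (- u * sin (u * F w))) = - u * (p * expect (\<lambda>w. sin (u * F w)) + expect (\<lambda>w. (\<Gamma> w - p) * sin (u * F w)))"
    using integrable_sin(1) integrable_sin(2)[OF poly\<Gamma>] by (simp add: left_diff_distrib mult.left_commute)
  then show ?thesis using stein[OF quad_C1_cos, of u] p by (simp add: field_simps)
qed

text \<open>The deviation of \<open>\<Gamma>\<close> from p has mean zero, so cos may be replaced by
  cos - 1 in the defect. This gains the two orders in u that the main term needs.\<close>

lemma F_sin_eq:
  "expect (\<lambda>w. F w * sin (u * F w)) = u * expect (\<lambda>w. cos (u * F w)) - u / p * expect (\<lambda>w. (\<Gamma> w - p) * (1 - cos (u * F w)))"
proof -
  define e where "e = expect (\<lambda>w. (\<Gamma> w - p) * (1 - cos (u * F w)))"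
  have "e = expect (\<lambda>w. (\<Gamma> w - p) - (\<Gamma> w * cos (u * F w) - p * cos (u * F w)))"
    by (simp add: e_def algebra_simps)
  also have "\<dots> = (expect \<Gamma> - p) - (expect (\<lambda>w. \<Gamma> w * cos (u * F w)) - p * expect (\<lambda>w. cos (u * F w)))"
    using integrable_cos(1) integrable_cos(2)[OF poly\<Gamma>] polyfun_integrable[OF poly\<Gamma>] by simp
  finally have "expect (\<lambda>w. \<Gamma> w * cos (u * F w)) = p * expect (\<lambda>w. cos (u * F w)) - e"
    by (simp add: expect_\<Gamma>)
  moreover have "p * expect (\<lambda>w. F w * sin (u * F w)) = u * expect (\<lambda>w. \<Gamma> w * cos (u * F w))"
    using stein[OF quad_C1_sin, of u] by (simp add: mult.left_commute)
  ultimately have "p * expect (\<lambda>w. F w * sin (u * F w)) = u * (p * expect (\<lambda>w. cos (u * F w)) - e)" by simp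
  then show ?thesis unfolding e_def[symmetric] using p by (simp add: field_simps)
qed

text \<open>Solves the equation \<open>F_cos_eq\<close>, whose defect is at most
  \<open>sqrt V\<close> by Cauchy-Schwarz. The result supplies the second mean in the uncentred term
  of \<open>covA_bound\<close>.\<close>

lemma expect_sin_bound:
  assumes "0 \<le> s"
  shows "\<bar>expect (\<lambda>w. sin (s * F w))\<bar> \<le> s\<^sup>2 / 2 * sqrt V"
proof -
  define e where "e u = expect (\<lambda>w. (\<Gamma> w - p) * sin (u * F w))" for u
  have e: "\<bar>e u\<bar> \<le> sqrt V" for u
  proof -
    have t: "tame n (\<lambda>w. sin (u * F w))" by (rule tame_compose(1)[OF polyfun_tame[OF poly] quad_C1_sin])
    have i2: "integrable wiener (\<lambda>w. (sin (u * F w))\<^sup>2)"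
      using tame_integrable(1)[OF tame_mult[OF t t]] by (simp add: power2_eq_square)
    have "(e u)\<^sup>2 \<le> V * expect (\<lambda>w. (sin (u * F w))\<^sup>2)"
      unfolding e_def V_def
      by (rule expect_cauchy_schwarz(2)[OF tame_measurable(1)[OF polyfun_tame[OF poly\<Gamma>p]] polyfun_integrable[OF polyfun_power2[OF poly\<Gamma>p]] tame_measurable(1)[OF t] i2])
    also have "\<dots> \<le> V * expect (\<lambda>w. 1)"
      using i2 V_nonneg by (intro mult_left_mono integral_mono) (auto simp: abs_square_le_1)
    finally show ?thesis by (simp add: real_le_rsqrt)
  qed
  \<comment> \<open>The integrating factor exp (u^2 / 2) removes the drift, and subtracting
    \<open>sqrt V\<close> inside the bracket dominates the defect. The signs 1 and -1 for \<sigma>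
    give the two one-sided bounds.\<close>
  define g where "g \<sigma> u = exp (u\<^sup>2 / 2) * (\<sigma> * expect (\<lambda>w. sin (u * F w)) - sqrt V)" for \<sigma> u
  have main: "\<sigma> * expect (\<lambda>w. sin (s * F w)) \<le> s\<^sup>2 / 2 * sqrt V" if \<sigma>: "\<bar>\<sigma>\<bar> = 1" for \<sigma>
  proof -
    have "g \<sigma> s \<le> g \<sigma> 0"
    proof (rule DERIV_nonpos_imp_nonincreasing[OF assms])
      fix u assume u: "0 \<le> u" "u \<le> s"
      have "(g \<sigma> has_real_derivative exp (u\<^sup>2 / 2) * (- (u / p) * (\<sigma> * e u) - u * sqrt V)) (at u)"
        unfolding g_def
        by (rule derivative_eq_intros DERIV_char refl | simp)+
           (simp add: F_cos_eq[folded e_def] algebra_simps)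
      moreover have "exp (u\<^sup>2 / 2) * (- (u / p) * (\<sigma> * e u) - u * sqrt V) \<le> 0"
      proof -
        have "- (u / p) * (\<sigma> * e u) \<le> \<bar>- (u / p) * (\<sigma> * e u)\<bar>" by (rule abs_ge_self)
        also have "\<dots> = (u / p) * \<bar>e u\<bar>" using \<sigma> u by (simp add: abs_mult)
        also have "\<dots> \<le> u * sqrt V"
        proof (rule mult_mono[OF _ e u(1)])
          show "u / p \<le> u" using mult_left_mono[of 1 "real p" u] u p by (simp add: divide_le_eq)
        qed simp
        finally show ?thesis by (intro mult_nonneg_nonpos) auto
      qed
      ultimately show "\<exists>y. (g \<sigma> has_real_derivative y) (at u) \<and> y \<le> 0" by blast
    qed
    then have "exp (s\<^sup>2 / 2) * (\<sigma> * expect (\<lambda>w. sin (s * F w)) - sqrt V) \<le> - sqrt V" by (simp add: g_def)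
    then have "\<sigma> * expect (\<lambda>w. sin (s * F w)) - sqrt V \<le> - sqrt V * exp (- (s\<^sup>2 / 2))"
      by (simp add: exp_minus field_simps)
    also have "\<dots> \<le> - sqrt V * (1 - s\<^sup>2 / 2)"
      using exp_ge_add_one_self[of "- (s\<^sup>2 / 2)"] V_nonneg by (intro mult_left_mono_neg) auto
    finally show ?thesis by (simp add: algebra_simps)
  qed
  show ?thesis using main[of 1] main[of "-1"] by (simp add: abs_le_iff)
qed

text \<open>The constant of \<open>covA_bound\<close>, stripped of its factors \<open>p\<close>,
  \<open>L\<close> and \<open>V\<close>.\<close>

definition C2 :: real where "C2 = 3 ^ (3 * p) * sqrt H * K + sqrt (real (p ^ p) * K)"

lemma C2_pos: "0 < C2"
  unfolding C2_def using H_nonneg K_pos p by (intro add_nonneg_pos) auto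

text \<open>The quadratic Taylor term contributes s^2 / 2 times \<open>W\<close>, hence at least s^2
  V / (2 p). The remainder satisfies \<open>covA_bound\<close> with L = s^3, and the smallness
  assumption on \<open>s\<close> makes it at most half of this.\<close>

lemma cov_cos_bound:
  assumes s: "0 \<le> s" "s \<le> 1" and s2: "s * (4 * p\<^sup>2 * C2) \<le> 1"
  shows "s\<^sup>2 * V / (4 * p) \<le> expect (\<lambda>w. (\<Gamma> w - p) * (1 - cos (s * F w)))"
proof -
  let ?h = "\<lambda>x. 1 - cos (s * x) - s\<^sup>2 / 2 * x\<^sup>2"
  note h = quad_C1_remainder[OF s]
  have "\<bar>covA ?h 1\<bar> \<le> p * (s ^ 3 * (C2 * V))"
    unfolding C2_def
  proof (rule covA_bound[OF h])
    fix x :: real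
    have "s\<^sup>2 * cos (s * x) - s\<^sup>2 = s\<^sup>2 * (cos (s * x) - 1)" by (simp add: algebra_simps)
    then have "\<bar>s\<^sup>2 * cos (s * x) - s\<^sup>2\<bar> = s\<^sup>2 * \<bar>cos (s * x) - 1\<bar>" by (simp only: abs_mult abs_power2)
    also have "\<dots> \<le> s\<^sup>2 * \<bar>s * x\<bar>" by (intro mult_left_mono one_minus_cos_bound) simp
    finally show "\<bar>s\<^sup>2 * cos (s * x) - s\<^sup>2\<bar> \<le> s ^ 3 * \<bar>x\<bar>" using s by (simp add: abs_mult power2_eq_square power3_eq_cube mult.assoc)
  next
    \<comment> \<open>The linear part of the derivative of the remainder has mean zero, which leaves
      s times the mean of sin (s F).\<close>
    have "expect F = 0" using eigen_expect[OF eigenF] p by simp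
    then have "expect (\<lambda>w. s * sin (s * F w) - s\<^sup>2 * F w) = s * expect (\<lambda>w. sin (s * F w))"
      using integrable_sin(1) polyfun_integrable[OF poly] by simp
    also have "\<bar>\<dots>\<bar> \<le> s * (s\<^sup>2 / 2 * sqrt V)"
      using s mult_left_mono[OF expect_sin_bound[OF s(1)] s(1)] by (simp add: abs_mult)
    also have "\<dots> \<le> s ^ 3 * sqrt V"
      using s V_nonneg by (simp add: power2_eq_square power3_eq_cube field_simps)
    finally show "\<bar>expect (\<lambda>w. s * sin (s * F w) - s\<^sup>2 * F w)\<bar> \<le> s ^ 3 * sqrt V" .
  qed
  then have cov: "- (p * (s ^ 3 * (C2 * V))) \<le> covA ?h 1" by linarith
  have "covA ?h 1 = expect (\<lambda>w. (\<Gamma> w - p) * (1 - cos (s * F w))) - s\<^sup>2 / 2 * W"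
  proof -
    have "covA ?h 1 = expect (\<lambda>w. \<Gamma> w * ?h (F w)) - p * expect (\<lambda>w. ?h (F w))"
      by (simp add: covA_def A_1[simplified] expect_\<Gamma>)
    also have "\<dots> = expect (\<lambda>w. \<Gamma> w * ?h (F w) - p * ?h (F w))"
      using integrable_compose(1)[OF poly\<Gamma> h(1)] integrable_compose(1)[OF polyfun.const[of n 0 1] h(1)] by simp
    also have "\<dots> = expect (\<lambda>w. (\<Gamma> w - p) * (1 - cos (s * F w)) - s\<^sup>2 / 2 * ((F w)\<^sup>2 * \<Gamma> w - p * (F w)\<^sup>2))"
      by (simp add: algebra_simps)
    also have "\<dots> = expect (\<lambda>w. (\<Gamma> w - p) * (1 - cos (s * F w))) - s\<^sup>2 / 2 * (expect (\<lambda>w. (F w)\<^sup>2 * \<Gamma> w) - p * expect (\<lambda>w. (F w)\<^sup>2))"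
    proof -
      have "integrable wiener (\<lambda>w. (\<Gamma> w - p) * (1 - cos (s * F w)))"
        using integrable_cos(2)[OF poly\<Gamma>p] polyfun_integrable[OF poly\<Gamma>p] by (simp add: right_diff_distrib)
      then show ?thesis
        using polyfun_integrable[OF polyF2] polyfun_integrable[OF polyfun_mult[OF polyF2 poly\<Gamma>]] by simp
    qed
    finally show ?thesis by (simp add: W_def norm1)
  qed
  then have 1: "s\<^sup>2 / 2 * W - p * (s ^ 3 * (C2 * V)) \<le> expect (\<lambda>w. (\<Gamma> w - p) * (1 - cos (s * F w)))"
    using cov by linarith
  have 2: "V / p \<le> W" using V_le_W p by (simp add: field_simps)
  have "s\<^sup>2 * V / (4 * p) * (s * (4 * p\<^sup>2 * C2)) \<le> s\<^sup>2 * V / (4 * p) * 1"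
    using s2 V_nonneg by (intro mult_left_mono) auto
  then have 3: "p * (s ^ 3 * (C2 * V)) \<le> s\<^sup>2 * V / (4 * p)"
    using p by (simp add: power2_eq_square power3_eq_cube field_simps)
  have "s\<^sup>2 * V / (4 * p) = s\<^sup>2 / 2 * (V / p) - s\<^sup>2 * V / (4 * p)" using p by (simp add: field_simps)
  also have "\<dots> \<le> s\<^sup>2 / 2 * W - p * (s ^ 3 * (C2 * V))"
    using 2 3 by (intro diff_mono mult_left_mono) auto
  finally show ?thesis using 1 by linarith
qed

text \<open>After multiplication by exp (u^2 / 2) the characteristic function has derivative at
  least u^3 V / (4 p^2), by \<open>F_sin_eq\<close> and \<open>cov_cos_bound\<close>. The function
  \<open>g\<close> subtracts the primitive of this bound and is therefore nondecreasing.\<close>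

lemma char_lower_bound:
  assumes s: "0 \<le> s" "s \<le> 1" and s2: "s * (4 * p\<^sup>2 * C2) \<le> 1"
  shows "exp (- (s\<^sup>2 / 2)) * (s ^ 4 / (16 * p\<^sup>2)) * V \<le> expect (\<lambda>w. cos (s * F w)) - exp (- (s\<^sup>2 / 2))"
proof -
  define g where "g u = exp (u\<^sup>2 / 2) * expect (\<lambda>w. cos (u * F w)) - u ^ 4 * (V / (16 * p\<^sup>2))" for u
  have "g 0 \<le> g s"
  proof (rule DERIV_nonneg_imp_nondecreasing[OF s(1)])
    fix u assume u: "0 \<le> u" "u \<le> s"
    define e where "e = expect (\<lambda>w. (\<Gamma> w - p) * (1 - cos (u * F w)))"
    have "(g has_real_derivative exp (u\<^sup>2 / 2) * (u / p * e) - 4 * u ^ 3 * (V / (16 * p\<^sup>2))) (at u)"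
      unfolding g_def
      by (rule derivative_eq_intros DERIV_char refl | simp)+
         (simp add: F_sin_eq[of u, folded e_def] algebra_simps)
    moreover have "0 \<le> exp (u\<^sup>2 / 2) * (u / p * e) - 4 * u ^ 3 * (V / (16 * p\<^sup>2))"
    proof -
      have "u * (4 * p\<^sup>2 * C2) \<le> s * (4 * p\<^sup>2 * C2)" using u C2_pos by (intro mult_right_mono) auto
      then have "u\<^sup>2 * V / (4 * p) \<le> e"
        unfolding e_def using u s s2 by (intro cov_cos_bound) auto
      then have "u / p * (u\<^sup>2 * V / (4 * p)) \<le> u / p * e" using u by (intro mult_left_mono) auto
      moreover have "4 * u ^ 3 * (V / (16 * p\<^sup>2)) = u / p * (u\<^sup>2 * V / (4 * p))"
        by (simp add: power2_eq_square power3_eq_cube)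
      moreover have "0 \<le> u / p * (u\<^sup>2 * V / (4 * p))" using u V_nonneg by simp
      moreover have "1 * (u / p * e) \<le> exp (u\<^sup>2 / 2) * (u / p * e)"
        using calculation by (intro mult_right_mono) auto
      ultimately show ?thesis by linarith
    qed
    ultimately show "\<exists>y. (g has_real_derivative y) (at u) \<and> 0 \<le> y" by blast
  qed
  then have "1 + s ^ 4 * (V / (16 * p\<^sup>2)) \<le> exp (s\<^sup>2 / 2) * expect (\<lambda>w. cos (s * F w))"
    by (simp add: g_def)
  then have "exp (- (s\<^sup>2 / 2)) * (1 + s ^ 4 * (V / (16 * p\<^sup>2))) \<le> exp (- (s\<^sup>2 / 2)) * (exp (s\<^sup>2 / 2) * expect (\<lambda>w. cos (s * F w)))"
    by (rule mult_left_mono) simp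
  also have "exp (- (s\<^sup>2 / 2)) * (exp (s\<^sup>2 / 2) * expect (\<lambda>w. cos (s * F w))) = expect (\<lambda>w. cos (s * F w))"
    by (simp flip: mult.assoc exp_add)
  finally show ?thesis by (simp add: algebra_simps)
qed

end

theorem polynomial_chaos_bound:
  assumes "1 \<le> p"
  shows "\<exists>c>0. \<exists>s. \<forall>n F. polyfun n p F \<longrightarrow> eigen n p F \<longrightarrow> expect (\<lambda>w. (F w)\<^sup>2) = 1 \<longrightarrow>
    c * expect (\<lambda>w. ((\<Sum>i<n. (partial i F w)\<^sup>2) - p)\<^sup>2) \<le> expect (\<lambda>w. cos (s * F w)) - exp (- (s\<^sup>2 / 2))"
proof -
  obtain H where H: "0 \<le> H" "\<And>n X. polyfun n (2 * p) X \<Longrightarrow> expect (\<lambda>w. (X w) ^ 4) \<le> H * (expect (\<lambda>w. (X w)\<^sup>2))\<^sup>2"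
    using hypercontractive by blast
  \<comment> \<open>Copies of \<open>K\<close> and \<open>C2\<close> outside the locale:
    \<open>s\<close> has to be fixed from \<open>p\<close> and \<open>H\<close> before
    \<open>n\<close> and \<open>F\<close> are given.\<close>
  define K' :: real where "K' = 5 ^ (2 * p) * (6 * (fact p)\<^sup>2)"
  define C' where "C' = 3 ^ (3 * p) * sqrt H * K' + sqrt (real (p ^ p) * K')"
  have K': "0 < K'" by (simp add: K'_def)
  have C': "0 < C'" unfolding C'_def using H K' assms by (intro add_nonneg_pos) auto
  define s where "s = min 1 (1 / (4 * p\<^sup>2 * C'))"
  have d: "0 < 4 * (real p)\<^sup>2 * C'" using C' assms by simp
  have s: "0 < s" "s \<le> 1" using d by (auto simp: s_def)
  have s2: "s * (4 * p\<^sup>2 * C') \<le> 1"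
  proof -
    define r where "r = 4 * (real p)\<^sup>2 * C'"
    have r: "0 < r" "s = min 1 (1 / r)" using d by (simp_all add: r_def s_def)
    then have "s * r \<le> 1 / r * r" by (intro mult_right_mono) auto
    moreover have "1 / r * r = 1" using r(1) by simp
    ultimately have "s * r \<le> 1" by simp
    then show ?thesis by (simp add: r_def)
  qed
  have "exp (- (s\<^sup>2 / 2)) * (s ^ 4 / (16 * p\<^sup>2)) * expect (\<lambda>w. ((\<Sum>i<n. (partial i F w)\<^sup>2) - p)\<^sup>2)
      \<le> expect (\<lambda>w. cos (s * F w)) - exp (- (s\<^sup>2 / 2))"
    if "polyfun n p F" "eigen n p F" "expect (\<lambda>w. (F w)\<^sup>2) = 1" for n F
  proof -
    interpret unit_chaos_hyper n p F H
      by unfold_locales (use that assms H in auto)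
    have "C2 = C'" unfolding C2_def C'_def K_def K'_def ..
    then show ?thesis
      using char_lower_bound[of s] s s2 unfolding V_def \<Gamma>_def D_def by simp
  qed
  moreover have "0 < exp (- (s\<^sup>2 / 2)) * (s ^ 4 / (16 * p\<^sup>2))" using s assms by simp
  ultimately show ?thesis by blast
qed

section \<open>Hermite polynomials and the algebraic chaoses\<close>

fun hermite_poly :: "nat \<Rightarrow> real poly" where
  "hermite_poly 0 = 1"
| "hermite_poly (Suc k) = pCons 0 (hermite_poly k) - pderiv (hermite_poly k)"

lemma deriv_exp_hermite:
  "(deriv ^^ k) (\<lambda>t::real. exp (- t\<^sup>2 / 2)) = (\<lambda>t. (-1) ^ k * poly (hermite_poly k) t * exp (- t\<^sup>2 / 2))"
proof (induction k)
  case (Suc k)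
  have "((\<lambda>t. (-1) ^ k * poly (hermite_poly k) t * exp (- t\<^sup>2 / 2)) has_real_derivative
      (-1) ^ Suc k * poly (hermite_poly (Suc k)) t * exp (- t\<^sup>2 / 2)) (at t)" for t
    by (auto intro!: derivative_eq_intros simp: algebra_simps)
  then show ?case using Suc by (auto intro!: DERIV_imp_deriv)
qed auto

lemma hermite_eq_poly: "hermite k x = poly (hermite_poly k) x"
proof -
  have "exp (x\<^sup>2 / 2) * exp (- x\<^sup>2 / 2) = 1" by (simp flip: exp_add)
  moreover have "((-1) ^ k * (-1) ^ k :: real) = 1" by (simp flip: power_mult_distrib)
  ultimately show ?thesis
    unfolding hermite_def deriv_exp_hermite by (simp add: algebra_simps)
qed

lemma degree_hermite_poly: "degree (hermite_poly k) \<le> k"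
proof (induction k)
  case (Suc k)
  have "degree (pCons 0 (hermite_poly k)) \<le> Suc k" using Suc by (simp add: degree_pCons_le le_trans[OF degree_pCons_le])
  moreover have "degree (pderiv (hermite_poly k)) \<le> Suc k" using Suc by (simp add: degree_pderiv)
  ultimately show ?case by (simp add: degree_diff_le)
qed simp

lemma pderiv_hermite_poly: "pderiv (hermite_poly (Suc k)) = smult (real (Suc k)) (hermite_poly k)"
proof (induction k)
  case 0
  then show ?case by (simp add: pderiv_pCons pderiv_1)
next
  case (Suc k)
  have "pderiv (hermite_poly (Suc (Suc k))) = hermite_poly (Suc k) + (pCons 0 (pderiv (hermite_poly (Suc k))) - pderiv (pderiv (hermite_poly (Suc k))))"
    by (simp only: hermite_poly.simps(2)[of "Suc k"] pderiv_diff pderiv_pCons add_diff_eq)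
  also have "pCons 0 (pderiv (hermite_poly (Suc k))) - pderiv (pderiv (hermite_poly (Suc k))) = smult (real (Suc k)) (hermite_poly (Suc k))"
    unfolding Suc.IH by (simp add: pderiv_smult smult_diff_right del: of_nat_Suc)
  also have "hermite_poly (Suc k) + smult (real (Suc k)) (hermite_poly (Suc k)) = smult (real (Suc (Suc k))) (hermite_poly (Suc k))"
    by (simp only: of_nat_Suc[of "Suc k"] smult_add_left smult_1_left)
  finally show ?case .
qed

text \<open>The one-dimensional eigenvalue equation, from H_k' = k H_(k-1) and the recursion for
  Hermite polynomials.\<close>

lemma hermite_ode: "poly (pderiv (pderiv (hermite_poly k))) x - x * poly (pderiv (hermite_poly k)) x = - real k * poly (hermite_poly k) x"
proof (cases k)
  case 0
  then show ?thesis by (simp add: pderiv_1)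
next
  case (Suc j)
  show ?thesis
    unfolding Suc pderiv_hermite_poly by (simp add: pderiv_smult algebra_simps del: of_nat_Suc)
qed

lemma polyfun_poly:
  assumes "j < n"
  shows "degree q \<le> d \<Longrightarrow> polyfun n d (\<lambda>w. poly q (w j))"
proof (induction q arbitrary: d)
  case 0
  then show ?case by (simp add: polyfun.const)
next
  case (pCons a q)
  show ?case
  proof (cases "q = 0")
    case True
    then show ?thesis by (simp add: polyfun.const)
  next
    case False
    then obtain d' where d: "d = Suc d'" "degree q \<le> d'" using pCons.prems by (cases d) auto
    have "polyfun n (Suc d') (\<lambda>w. a + w j * poly q (w j))"
      by (intro polyfun.add polyfun.const polyfun.times pCons.IH d assms)
    then show ?thesis by (simp add: d)
  qed
qed

lemma partial_poly: "partial i (\<lambda>w. poly q (w j)) = (\<lambda>w. if i = j then poly (pderiv q) (w j) else 0)"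
proof -
  have "partial i (\<lambda>w. poly q (w j)) = (\<lambda>w. poly (pderiv q) (w j) * partial i (\<lambda>w. w j) w)"
    by (rule C1_fun_compose(2)[OF C1_fun_coordinate(1) poly_DERIV]) (intro continuous_intros)
  then show ?thesis by (auto simp: C1_fun_coordinate(2))
qed

lemma eigen_hermite:
  assumes "j < n"
  shows "polyfun n k (\<lambda>w. hermite k (w j))" "eigen n k (\<lambda>w. hermite k (w j))"
proof -
  show 1: "polyfun n k (\<lambda>w. hermite k (w j))"
    unfolding hermite_eq_poly by (rule polyfun_poly[OF assms degree_hermite_poly])
  have "ou n (\<lambda>w. hermite k (w j)) w = - real k * hermite k (w j)" for w
  proof -
    have z: "partial i (\<lambda>w. 0 :: real) = (\<lambda>_. 0)" for i by (rule C1_fun_const(2))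
    have "ou n (\<lambda>w. hermite k (w j)) w = (\<Sum>i<n. if i = j then poly (pderiv (pderiv (hermite_poly k))) (w j) - w j * poly (pderiv (hermite_poly k)) (w j) else 0)"
      unfolding ou_def hermite_eq_poly partial_poly by (intro sum.cong refl) (auto simp: partial_poly z)
    then show ?thesis using assms by (simp add: hermite_ode hermite_eq_poly)
  qed
  then show "eigen n k (\<lambda>w. hermite k (w j))" unfolding eigen_def using 1 by blast
qed

lemma ou_mult:
  assumes X: "polyfun n d X" and Y: "polyfun n e Y"
  shows "ou n (\<lambda>w. X w * Y w) w = ou n X w * Y w + X w * ou n Y w + 2 * (\<Sum>i<n. partial i X w * partial i Y w)"
proof -
  note CX = polyfun_C1[OF X] polyfun_C1[OF polyfun_partial[OF X]] and CY = polyfun_C1[OF Y] polyfun_C1[OF polyfun_partial[OF Y]]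
  have "partial i (partial i (\<lambda>w. X w * Y w)) w - w i * partial i (\<lambda>w. X w * Y w) w =
    (partial i (partial i X) w - w i * partial i X w) * Y w + X w * (partial i (partial i Y) w - w i * partial i Y w) + 2 * (partial i X w * partial i Y w)" for i
    unfolding C1_fun_mult(2)[OF CX(1) CY(1)] C1_fun_add(2)[OF C1_fun_mult(1)[OF CX(2) CY(1)] C1_fun_mult(1)[OF CX(1) CY(2)]]
      C1_fun_mult(2)[OF CX(2) CY(1)] C1_fun_mult(2)[OF CX(1) CY(2)] by (simp add: algebra_simps)
  then show ?thesis by (simp add: ou_def sum.distrib sum_distrib_left sum_distrib_right)
qed

text \<open>The cross term of the product rule for the operator is the gradient pairing of the
  factors, which is assumed to vanish; the eigenvalues then add.\<close>

lemma eigen_mult: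
  assumes "eigen n a X" "eigen n b Y" "\<And>i w. partial i X w * partial i Y w = 0"
  shows "eigen n (a + b) (\<lambda>w. X w * Y w)"
proof -
  obtain d e where "polyfun n d X" "polyfun n e Y" using assms by (auto simp: eigen_def)
  then have "ou n (\<lambda>w. X w * Y w) w = - (a + b) * (X w * Y w)" "polyfun n (d + e) (\<lambda>w. X w * Y w)" for w
    using assms(1,2) by (simp_all only: ou_mult polyfun_mult eigen_def assms(3) sum.neutral_const) (simp add: algebra_simps)
  then show ?thesis unfolding eigen_def by blast
qed

text \<open>The claim about derivatives outside \<open>I\<close> carries the induction: it makes the
  gradients of the new factor and of the old product orthogonal, as \<open>eigen_mult\<close>
  requires.\<close>

lemma hermite_prod_chaos:
  assumes "finite I" "I \<subseteq> {..<n}"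
  shows "polyfun n (\<Sum>i\<in>I. k i) (\<lambda>w. \<Prod>i\<in>I. hermite (k i) (w i)) \<and>
    eigen n (real (\<Sum>i\<in>I. k i)) (\<lambda>w. \<Prod>i\<in>I. hermite (k i) (w i)) \<and>
    (\<forall>j. j \<notin> I \<longrightarrow> partial j (\<lambda>w. \<Prod>i\<in>I. hermite (k i) (w i)) = (\<lambda>_. 0))"
  using assms
proof (induction I rule: finite_induct)
  case empty
  have "ou n (\<lambda>_. 1) = (\<lambda>_. 0)" by (simp add: ou_def C1_fun_const(2) fun_eq_iff)
  then show ?case using polyfun.const[of n 0 1] by (auto simp: C1_fun_const(2) eigen_def)
next
  case (insert x I)
  let ?X = "\<lambda>w. hermite (k x) (w x)" and ?Y = "\<lambda>w. \<Prod>i\<in>I. hermite (k i) (w i)"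
  have x: "x < n" using insert.prems by simp
  note X = eigen_hermite[OF x, of "k x"]
  have Y: "polyfun n (\<Sum>i\<in>I. k i) ?Y" "eigen n (real (\<Sum>i\<in>I. k i)) ?Y" "\<And>j. j \<notin> I \<Longrightarrow> partial j ?Y = (\<lambda>_. 0)"
    using insert by auto
  have pX: "partial j ?X = (\<lambda>_. 0)" if "j \<noteq> x" for j using that by (simp add: hermite_eq_poly partial_poly)
  have "partial i ?X w * partial i ?Y w = 0" for i w
    using pX[of i] Y(3)[of i] insert.hyps by (cases "i = x") auto
  note E = eigen_mult[OF X(2) Y(2) this]
  have "partial j (\<lambda>w. ?X w * ?Y w) = (\<lambda>_. 0)" if "j \<notin> insert x I" for j
    using that pX[of j] Y(3)[of j] unfolding C1_fun_mult(2)[OF polyfun_C1[OF X(1)] polyfun_C1[OF Y(1)]] by simp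
  then show ?case using insert.hyps polyfun_mult[OF X(1) Y(1)] E by (simp add: add.commute)
qed

text \<open>Quantified over all large \<open>n\<close>, so that any two elements share a common
  number of coordinates and no element is tied to a particular one.\<close>

definition poly_chaos :: "nat \<Rightarrow> ((nat \<Rightarrow> real) \<Rightarrow> real) \<Rightarrow> bool" where
  "poly_chaos p F \<longleftrightarrow> (\<exists>N. \<forall>n\<ge>N. polyfun n p F \<and> eigen n p F)"

lemma poly_chaosE:
  assumes "poly_chaos p F" "poly_chaos q G"
  obtains n where "polyfun n p F" "eigen n p F" "polyfun n q G" "eigen n q G"
proof -
  obtain N M where "\<forall>n\<ge>N. polyfun n p F \<and> eigen n p F" "\<forall>n\<ge>M. polyfun n q G \<and> eigen n q G"
    using assms unfolding poly_chaos_def by blast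
  then have "polyfun (max N M) p F" "eigen (max N M) p F" "polyfun (max N M) q G" "eigen (max N M) q G" by auto
  then show thesis by (rule that)
qed

lemma poly_chaos_hermite_prod:
  assumes "k \<in> multi_indices p"
  shows "poly_chaos p (hermite_prod k)"
proof -
  let ?I = "{i. k i \<noteq> 0}"
  have I: "finite ?I" "(\<Sum>i\<in>?I. k i) = p" using assms by (auto simp: multi_indices_def)
  have "polyfun n p (hermite_prod k) \<and> eigen n p (hermite_prod k)" if "Suc (Max (insert 0 ?I)) \<le> n" for n
  proof -
    have "i \<le> Max (insert 0 ?I)" if "i \<in> ?I" for i using I(1) that by (intro Max_ge) auto
    then have "?I \<subseteq> {..<n}" using that by fastforce
    from hermite_prod_chaos[OF I(1) this, of k] show ?thesis
      unfolding I(2) hermite_prod_def[abs_def] by blast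
  qed
  then show ?thesis unfolding poly_chaos_def by blast
qed

lemma eigen_add:
  assumes "eigen n r X" "eigen n r Y"
  shows "eigen n r (\<lambda>w. X w + Y w)"
proof -
  obtain d e where p: "polyfun n d X" "polyfun n e Y" using assms by (auto simp: eigen_def)
  note C = polyfun_C1[OF p(1)] polyfun_C1[OF p(2)] polyfun_C1[OF polyfun_partial[OF p(1)]] polyfun_C1[OF polyfun_partial[OF p(2)]]
  have "ou n (\<lambda>w. X w + Y w) w = ou n X w + ou n Y w" for w
    by (simp add: ou_def C1_fun_add(2)[OF C(1,2)] C1_fun_add(2)[OF C(3,4)] algebra_simps sum.distrib sum_subtractf)
  moreover have "polyfun n (d + e) (\<lambda>w. X w + Y w)"
    using p by (auto intro!: polyfun.add intro: polyfun_mono)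
  ultimately show ?thesis using assms by (auto simp: eigen_def algebra_simps)
qed

lemma eigen_scale: "eigen n r X \<Longrightarrow> eigen n r (\<lambda>w. c * X w)"
  unfolding eigen_def by (auto simp: ou_scale fun_eq_iff mult.left_commute intro: polyfun_scale)

lemma poly_chaos_zero: "poly_chaos p (\<lambda>_. 0)"
  unfolding poly_chaos_def eigen_def using polyfun.const
  by (auto simp: ou_def C1_fun_const(2) fun_eq_iff)

lemma poly_chaos_add:
  assumes "poly_chaos p F" "poly_chaos p G"
  shows "poly_chaos p (\<lambda>w. F w + G w)"
proof -
  obtain N M where "\<forall>n\<ge>N. polyfun n p F \<and> eigen n p F" "\<forall>n\<ge>M. polyfun n p G \<and> eigen n p G"
    using assms unfolding poly_chaos_def by blast
  then have "\<forall>n\<ge>max N M. polyfun n p (\<lambda>w. F w + G w) \<and> eigen n p (\<lambda>w. F w + G w)"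
    by (auto intro: polyfun.add eigen_add)
  then show ?thesis unfolding poly_chaos_def by blast
qed

lemma poly_chaos_scale: "poly_chaos p F \<Longrightarrow> poly_chaos p (\<lambda>w. c * F w)"
  unfolding poly_chaos_def using polyfun_scale eigen_scale by blast

lemma poly_chaos_diff: "poly_chaos p F \<Longrightarrow> poly_chaos p G \<Longrightarrow> poly_chaos p (\<lambda>w. F w - G w)"
  using poly_chaos_add[OF _ poly_chaos_scale[of p G "-1"]] by simp

lemma hermite_span_poly_chaos:
  assumes "F \<in> hermite_span p"
  shows "poly_chaos p F"
proof -
  obtain A c where A: "finite A" "A \<subseteq> multi_indices p" and F: "F = (\<lambda>w. \<Sum>k\<in>A. c k * hermite_prod k w)"
    using assms unfolding hermite_span_def by blast
  have "poly_chaos p (\<lambda>w. \<Sum>k\<in>A. c k * hermite_prod k w)"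
    using A
  proof (induction A rule: finite_induct)
    case empty
    then show ?case by (simp add: poly_chaos_zero)
  next
    case (insert k A)
    then show ?case using poly_chaos_add[OF poly_chaos_scale[OF poly_chaos_hermite_prod[of k p]], of _ "c k"] by simp
  qed
  then show ?thesis by (simp add: F)
qed

lemma zero_in_hermite_span: "(\<lambda>_. 0) \<in> hermite_span p"
  unfolding hermite_span_def by (auto intro!: exI[of _ "{}"])

lemma poly_chaos_orthogonal:
  assumes "poly_chaos p F" "poly_chaos q G" "p \<noteq> q"
  shows "expect (\<lambda>w. F w * G w) = 0"
proof -
  obtain n where "eigen n p F" "eigen n q G" using assms(1,2) by (rule poly_chaosE)
  then show ?thesis by (rule eigen_orthogonal) (use assms(3) in simp)
qed

section \<open>Convergence in \<open>L\<^sup>2\<close>\<close>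

lemma square_integrableD:
  "X \<in> square_integrable \<Longrightarrow> X \<in> borel_measurable wiener"
  "X \<in> square_integrable \<Longrightarrow> integrable wiener (\<lambda>w. (X w)\<^sup>2)"
  by (auto simp: square_integrable_def)

lemma square_integrable_mult:
  assumes "X \<in> square_integrable" "Y \<in> square_integrable"
  shows "integrable wiener (\<lambda>w. X w * Y w)"
    and "(expect (\<lambda>w. X w * Y w))\<^sup>2 \<le> expect (\<lambda>w. (X w)\<^sup>2) * expect (\<lambda>w. (Y w)\<^sup>2)"
  using expect_cauchy_schwarz assms by (auto simp: square_integrable_def)

lemma square_integrable_const: "(\<lambda>_. c) \<in> square_integrable"
  by (simp add: square_integrable_def)

lemma square_integrable_integrable: "X \<in> square_integrable \<Longrightarrow> integrable wiener X"
  using square_integrable_mult(1)[OF _ square_integrable_const[of 1]] by simp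

lemma square_integrable_add:
  assumes X: "X \<in> square_integrable" and Y: "Y \<in> square_integrable"
  shows "(\<lambda>w. X w + Y w) \<in> square_integrable"
proof -
  have "(X w + Y w)\<^sup>2 = (X w)\<^sup>2 + 2 * (X w * Y w) + (Y w)\<^sup>2" for w
    by (simp add: power2_eq_square algebra_simps)
  then show ?thesis
    using square_integrableD[OF X] square_integrableD[OF Y] square_integrable_mult(1)[OF X Y]
    by (simp add: square_integrable_def)
qed

lemma square_integrable_scale: "X \<in> square_integrable \<Longrightarrow> (\<lambda>w. c * X w) \<in> square_integrable"
  unfolding square_integrable_def by (auto simp: power_mult_distrib)

lemma square_integrable_diff:
  "X \<in> square_integrable \<Longrightarrow> Y \<in> square_integrable \<Longrightarrow> (\<lambda>w. X w - Y w) \<in> square_integrable"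
  using square_integrable_add[OF _ square_integrable_scale[of Y "-1"]] by simp

lemma square_integrable_tame: "tame n X \<Longrightarrow> X \<in> square_integrable"
  using tame_integrable(1)[OF tame_mult[of n X X]] tame_measurable(1)[of n X]
  by (simp add: square_integrable_def power2_eq_square)

lemma expect_square_add_le:
  assumes X: "X \<in> square_integrable" and Y: "Y \<in> square_integrable"
  shows "expect (\<lambda>w. (X w + Y w)\<^sup>2) \<le> 2 * expect (\<lambda>w. (X w)\<^sup>2) + 2 * expect (\<lambda>w. (Y w)\<^sup>2)"
proof -
  have sq: "(u + v)\<^sup>2 \<le> 2 * u\<^sup>2 + 2 * v\<^sup>2" for u v :: real
    using zero_le_power2[of "u - v"] by (simp add: power2_eq_square algebra_simps)
  have "expect (\<lambda>w. (X w + Y w)\<^sup>2) \<le> expect (\<lambda>w. 2 * (X w)\<^sup>2 + 2 * (Y w)\<^sup>2)"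
    using square_integrableD[OF X] square_integrableD[OF Y] square_integrableD(2)[OF square_integrable_add[OF X Y]] sq
    by (intro integral_mono) auto
  then show ?thesis using square_integrableD[OF X] square_integrableD[OF Y] by simp
qed

lemma L2_tendstoD:
  assumes "L2_tendsto f F"
  shows "F \<in> square_integrable" "\<And>n. f n \<in> square_integrable"
    "(\<lambda>n. expect (\<lambda>w. (f n w - F w)\<^sup>2)) \<longlonglongrightarrow> 0"
  using assms by (auto simp: L2_tendsto_def)

lemma abs_le_sqrt_mult: "x\<^sup>2 \<le> a * b \<Longrightarrow> \<bar>x\<bar> \<le> sqrt a * sqrt b" for x a b :: real
  by (simp add: real_le_rsqrt flip: real_sqrt_mult)

lemma L2_tendsto_inner:
  assumes f: "L2_tendsto f F" and g: "L2_tendsto g G"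
  shows "(\<lambda>n. expect (\<lambda>w. f n w * g n w)) \<longlonglongrightarrow> expect (\<lambda>w. F w * G w)"
proof -
  note F = L2_tendstoD[OF f] and G = L2_tendstoD[OF g]
  let ?a = "\<lambda>n. expect (\<lambda>w. (f n w - F w)\<^sup>2)" and ?b = "\<lambda>n. expect (\<lambda>w. (g n w - G w)\<^sup>2)"
  let ?bd = "\<lambda>n. sqrt (?a n) * sqrt (?b n) + sqrt (?a n) * sqrt (expect (\<lambda>w. (G w)\<^sup>2)) + sqrt (expect (\<lambda>w. (F w)\<^sup>2)) * sqrt (?b n)"
  have "(\<lambda>n. expect (\<lambda>w. f n w * g n w) - expect (\<lambda>w. F w * G w)) \<longlonglongrightarrow> 0"
  proof (rule Lim_null_comparison)
    show "\<forall>\<^sub>F n in sequentially. norm (expect (\<lambda>w. f n w * g n w) - expect (\<lambda>w. F w * G w)) \<le> ?bd n"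
    proof (intro always_eventually allI)
      fix n
      have d: "(\<lambda>w. f n w - F w) \<in> square_integrable" "(\<lambda>w. g n w - G w) \<in> square_integrable"
        by (intro square_integrable_diff F(1,2) G(1,2))+
      note s = square_integrable_mult[OF d] square_integrable_mult[OF d(1) G(1)] square_integrable_mult[OF F(1) d(2)]
      have "expect (\<lambda>w. f n w * g n w) - expect (\<lambda>w. F w * G w) = expect (\<lambda>w. f n w * g n w - F w * G w)"
        using square_integrable_mult(1)[OF F(2)[of n] G(2)[of n]] square_integrable_mult(1)[OF F(1) G(1)] by simp
      also have "\<dots> = expect (\<lambda>w. (f n w - F w) * (g n w - G w) + (f n w - F w) * G w + F w * (g n w - G w))"
        by (simp add: algebra_simps)
      also have "\<dots> = expect (\<lambda>w. (f n w - F w) * (g n w - G w)) + expect (\<lambda>w. (f n w - F w) * G w) + expect (\<lambda>w. F w * (g n w - G w))"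
        using s(1,3,5) by simp
      finally have eq: "expect (\<lambda>w. f n w * g n w) - expect (\<lambda>w. F w * G w) = \<dots>" .
      show "norm (expect (\<lambda>w. f n w * g n w) - expect (\<lambda>w. F w * G w)) \<le> ?bd n"
        unfolding eq using abs_le_sqrt_mult[OF s(2)] abs_le_sqrt_mult[OF s(4)] abs_le_sqrt_mult[OF s(6)]
        unfolding real_norm_def by linarith
    qed
    have "?bd \<longlonglongrightarrow> sqrt 0 * sqrt 0 + sqrt 0 * sqrt (expect (\<lambda>w. (G w)\<^sup>2)) + sqrt (expect (\<lambda>w. (F w)\<^sup>2)) * sqrt 0"
      by (intro tendsto_intros F(3) G(3))
    then show "?bd \<longlonglongrightarrow> 0" by simp
  qed
  then show ?thesis by (rule LIM_zero_cancel)
qed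

lemma L2_tendsto_norm:
  assumes "L2_tendsto f F"
  shows "(\<lambda>n. expect (\<lambda>w. (f n w)\<^sup>2)) \<longlonglongrightarrow> expect (\<lambda>w. (F w)\<^sup>2)"
  using L2_tendsto_inner[OF assms assms] by (simp add: power2_eq_square)

lemma chaosE:
  assumes "F \<in> chaos p"
  obtains f where "\<And>n. f n \<in> hermite_span p" "\<And>n. poly_chaos p (f n)" "L2_tendsto f F"
proof -
  obtain f where "\<And>n. f n \<in> hermite_span p" "L2_tendsto f F" using assms unfolding chaos_def by blast
  then show thesis using that hermite_span_poly_chaos by blast
qed

lemma chaos_square_integrable: "F \<in> chaos p \<Longrightarrow> F \<in> square_integrable"
  by (auto simp: chaos_def L2_tendsto_def)

lemma chaos_orthogonal:
  assumes "F \<in> chaos p" "G \<in> chaos q" "p \<noteq> q"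
  shows "expect (\<lambda>w. F w * G w) = 0"
proof -
  obtain f where f: "\<And>n. poly_chaos p (f n)" "L2_tendsto f F" using assms(1) by (rule chaosE) blast
  obtain g where g: "\<And>n. poly_chaos q (g n)" "L2_tendsto g G" using assms(2) by (rule chaosE) blast
  have "expect (\<lambda>w. f n w * g n w) = 0" for n by (rule poly_chaos_orthogonal[OF f(1) g(1) assms(3)])
  then show ?thesis using L2_tendsto_inner[OF f(2) g(2)] by (simp add: LIMSEQ_const_iff)
qed

lemma zero_in_chaos: "(\<lambda>_. 0) \<in> chaos q"
  unfolding chaos_def
  by (auto intro!: exI[of _ "\<lambda>_ _. 0"] simp: zero_in_hermite_span L2_tendsto_def square_integrable_const)

text \<open>By orthogonality the projections to the other chaoses are zero almost surely, so the
  series in \<open>gamma_dom\<close> has at most one non-zero term.\<close>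

lemma chaos_gamma_dom:
  assumes F: "F \<in> chaos p"
  shows "F \<in> gamma_dom"
proof -
  have "expect (\<lambda>w. (chaos_proj q F w)\<^sup>2) = 0" if q: "q \<noteq> p" for q
  proof -
    let ?P = "\<lambda>G. G \<in> chaos q \<and> (\<forall>K\<in>chaos q. expect (\<lambda>w. (F w - G w) * K w) = 0)"
    \<comment> \<open>The zero function is a valid choice, so the \<open>SOME\<close> in
      \<open>chaos_proj\<close> is well defined. The chosen version is known only through the
      defining property, from which its norm is computed.\<close>
    have "?P (\<lambda>_. 0)" using zero_in_chaos chaos_orthogonal[OF F _ q[symmetric]] by simp
    then have "?P (chaos_proj q F)" unfolding chaos_proj_def by (rule someI[of ?P])
    then have G: "chaos_proj q F \<in> chaos q" and "expect (\<lambda>w. (F w - chaos_proj q F w) * chaos_proj q F w) = 0" by auto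
    then have "expect (\<lambda>w. F w * chaos_proj q F w) - expect (\<lambda>w. (chaos_proj q F w)\<^sup>2) = 0"
      using square_integrable_mult(1)[OF chaos_square_integrable[OF F] chaos_square_integrable[OF G]]
        square_integrableD(2)[OF chaos_square_integrable[OF G]]
      by (simp add: left_diff_distrib power2_eq_square)
    then show ?thesis using chaos_orthogonal[OF F G q[symmetric]] by simp
  qed
  then have "summable (\<lambda>q. real q * expect (\<lambda>w. (chaos_proj q F w)\<^sup>2))"
    by (intro summable_finite[of "{p}"]) auto
  then show ?thesis using chaos_square_integrable[OF F] by (simp add: gamma_dom_def)
qed

section \<open>Closability and the carre-du-champ operator on a chaos\<close>

text \<open>The smooth cylinder functions with their number of coordinates made explicit, phrased
  through \<open>tame\<close> so that integration by parts applies.\<close>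

definition cylinder :: "nat \<Rightarrow> ((nat \<Rightarrow> real) \<Rightarrow> real) \<Rightarrow> bool" where
  "cylinder n \<phi> \<longleftrightarrow> (\<forall>w w'. (\<forall>i<n. w i = w' i) \<longrightarrow> \<phi> w = \<phi> w') \<and> tame n \<phi> \<and> (\<forall>k. tame n (partial k \<phi>))"

lemma smooth_cylinder_iff: "\<phi> \<in> smooth_cylinder \<longleftrightarrow> (\<exists>n. cylinder n \<phi>)"
  unfolding smooth_cylinder_def cylinder_def tame_def by blast

lemma cylinder_tame: "cylinder n \<phi> \<Longrightarrow> tame n \<phi>" "cylinder n \<phi> \<Longrightarrow> tame n (partial k \<phi>)"
  by (auto simp: cylinder_def)

lemma cylinder_mono:
  assumes "cylinder n \<phi>" "n \<le> m"
  shows "cylinder m \<phi>"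
proof -
  have "\<phi> w = \<phi> w'" if "\<forall>i<m. w i = w' i" for w w'
    using assms(1) that assms(2) unfolding cylinder_def by (auto dest: less_le_trans)
  then show ?thesis using assms tame_mono unfolding cylinder_def by blast
qed

lemma tame_diff: "tame n X \<Longrightarrow> tame n Y \<Longrightarrow> tame n (\<lambda>w. X w - Y w)"
  using tame_add[of n X "\<lambda>w. (-1) * Y w"] tame_mult[OF tame_const[of n "-1"], of Y] by simp

lemma cylinder_diff:
  assumes "cylinder n \<phi>" "cylinder n \<psi>"
  shows "cylinder n (\<lambda>w. \<phi> w - \<psi> w)"
proof -
  have "partial k (\<lambda>w. \<phi> w - \<psi> w) = (\<lambda>w. partial k \<phi> w - partial k \<psi> w)" for k
    by (rule C1_fun_diff(2)[OF tame_C1 tame_C1]) (use assms in \<open>auto simp: cylinder_def\<close>)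
  then have "\<forall>k. tame n (partial k (\<lambda>w. \<phi> w - \<psi> w))" "tame n (\<lambda>w. \<phi> w - \<psi> w)"
    using assms by (auto simp: cylinder_def intro: tame_diff)
  moreover have "\<phi> w - \<psi> w = \<phi> w' - \<psi> w'" if "\<forall>i<n. w i = w' i" for w w'
  proof -
    have "\<phi> w = \<phi> w'" "\<psi> w = \<psi> w'" using assms that unfolding cylinder_def by blast+
    then show ?thesis by simp
  qed
  ultimately show ?thesis unfolding cylinder_def by blast
qed

lemma partial_cylinder_diff:
  "cylinder n \<phi> \<Longrightarrow> cylinder m \<psi> \<Longrightarrow> partial k (\<lambda>w. \<phi> w - \<psi> w) = (\<lambda>w. partial k \<phi> w - partial k \<psi> w)"
  by (rule C1_fun_diff(2)[OF tame_C1 tame_C1]) (auto simp: cylinder_def)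

lemma partial_cylinder_outside:
  assumes "cylinder n \<phi>" "n \<le> k"
  shows "partial k \<phi> = (\<lambda>_. 0)"
proof
  fix w
  have "(\<lambda>t. \<phi> (w(k := t))) = (\<lambda>t. \<phi> w)"
  proof
    fix t
    have "\<forall>i<n. (w(k := t)) i = w i" using assms(2) by auto
    then show "\<phi> (w(k := t)) = \<phi> w" using assms(1) unfolding cylinder_def by blast
  qed
  then show "partial k \<phi> w = 0" by (simp add: partial_def)
qed

lemma polyfun_local: "polyfun n d X \<Longrightarrow> (\<forall>i<n. w i = w' i) \<Longrightarrow> X w = X w'"
  by (induction rule: polyfun.induct) auto

lemma polyfun_cylinder: "polyfun n d X \<Longrightarrow> cylinder n X"
  unfolding cylinder_def using polyfun_local polyfun_tame[of n d X] polyfun_tame[OF polyfun_partial] by blast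

lemma poly_chaos_cylinder: "poly_chaos p F \<Longrightarrow> \<exists>n. cylinder n F"
  unfolding poly_chaos_def using polyfun_cylinder by blast

lemma gamma_smooth_sum: "cylinder n \<phi> \<Longrightarrow> gamma_smooth \<phi> \<psi> w = (\<Sum>k<n. partial k \<phi> w * partial k \<psi> w)"
  unfolding gamma_smooth_def by (rule suminf_finite) (auto simp: partial_cylinder_outside)

lemma gamma_integrable:
  assumes "cylinder n \<phi>" "cylinder n \<psi>"
  shows "integrable wiener (gamma_smooth \<phi> \<psi>)"
  unfolding gamma_smooth_sum[OF assms(1), abs_def]
  by (intro Bochner_Integration.integrable_sum tame_integrable(1)[OF tame_mult[OF cylinder_tame(2)[OF assms(1)] cylinder_tame(2)[OF assms(2)]]])

lemma gamma_smooth_nonneg: "cylinder n \<phi> \<Longrightarrow> 0 \<le> gamma_smooth \<phi> \<phi> w"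
  by (simp add: gamma_smooth_sum sum_nonneg)

abbreviation energy :: "((nat \<Rightarrow> real) \<Rightarrow> real) \<Rightarrow> real" where
  "energy \<phi> \<equiv> expect (gamma_smooth \<phi> \<phi>)"

lemma energy_nonneg: "cylinder n \<phi> \<Longrightarrow> 0 \<le> energy \<phi>"
  by (simp add: gamma_smooth_nonneg)

lemma gamma_L1_bound:
  assumes "cylinder n \<phi>" "cylinder n \<psi>"
  shows "expect (\<lambda>w. \<bar>gamma_smooth \<phi> \<psi> w\<bar>) \<le> sqrt (energy \<phi>) * sqrt (energy \<psi>)"
proof -
  let ?a = "\<lambda>w. sqrt (gamma_smooth \<phi> \<phi> w)" and ?b = "\<lambda>w. sqrt (gamma_smooth \<psi> \<psi> w)"
  note i = gamma_integrable[OF assms(1,1)] gamma_integrable[OF assms(2,2)] gamma_integrable[OF assms]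
  note [measurable] = borel_measurable_integrable[OF i(1)] borel_measurable_integrable[OF i(2)]
  have sq: "(?a w)\<^sup>2 = gamma_smooth \<phi> \<phi> w" "(?b w)\<^sup>2 = gamma_smooth \<psi> \<psi> w" for w
    using gamma_smooth_nonneg[OF assms(1)] gamma_smooth_nonneg[OF assms(2)] by auto
  have cs: "integrable wiener (\<lambda>w. ?a w * ?b w)" "(expect (\<lambda>w. ?a w * ?b w))\<^sup>2 \<le> energy \<phi> * energy \<psi>"
    using expect_cauchy_schwarz[of ?a ?b] i unfolding sq by auto
  have "\<bar>gamma_smooth \<phi> \<psi> w\<bar> \<le> ?a w * ?b w" for w
  proof -
    have "\<bar>gamma_smooth \<phi> \<psi> w\<bar> \<le> (\<Sum>k<n. \<bar>partial k \<phi> w\<bar> * \<bar>partial k \<psi> w\<bar>)"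
      unfolding gamma_smooth_sum[OF assms(1)] abs_mult[symmetric] by (rule sum_abs)
    also have "\<dots> \<le> L2_set (\<lambda>k. partial k \<phi> w) {..<n} * L2_set (\<lambda>k. partial k \<psi> w) {..<n}"
      by (rule L2_set_mult_ineq)
    finally show ?thesis
      unfolding L2_set_def gamma_smooth_sum[OF assms(1)] gamma_smooth_sum[OF assms(2)] power2_eq_square .
  qed
  then have "expect (\<lambda>w. \<bar>gamma_smooth \<phi> \<psi> w\<bar>) \<le> expect (\<lambda>w. ?a w * ?b w)"
    using i cs by (intro integral_mono) auto
  also have "\<dots> \<le> sqrt (energy \<phi>) * sqrt (energy \<psi>)"
    using abs_le_sqrt_mult[OF cs(2)] by simp
  finally show ?thesis .
qed

lemma energy_diff:
  assumes "cylinder n \<phi>" "cylinder n \<psi>"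
  shows "energy (\<lambda>w. \<phi> w - \<psi> w) = energy \<phi> - 2 * expect (gamma_smooth \<phi> \<psi>) + energy \<psi>"
proof -
  have "gamma_smooth (\<lambda>w. \<phi> w - \<psi> w) (\<lambda>w. \<phi> w - \<psi> w) w =
     gamma_smooth \<phi> \<phi> w - 2 * gamma_smooth \<phi> \<psi> w + gamma_smooth \<psi> \<psi> w" for w
    unfolding gamma_smooth_sum[OF cylinder_diff[OF assms]] gamma_smooth_sum[OF assms(1)] gamma_smooth_sum[OF assms(2)]
      partial_cylinder_diff[OF assms] sum_distrib_left sum_subtractf[symmetric] sum.distrib[symmetric]
    by (intro sum.cong refl) (simp add: algebra_simps)
  then have "gamma_smooth (\<lambda>w. \<phi> w - \<psi> w) (\<lambda>w. \<phi> w - \<psi> w) = (\<lambda>w. gamma_smooth \<phi> \<phi> w - 2 * gamma_smooth \<phi> \<psi> w + gamma_smooth \<psi> \<psi> w)" by auto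
  then show ?thesis
    using gamma_integrable[OF assms(1,1)] gamma_integrable[OF assms] gamma_integrable[OF assms(2,2)] by simp
qed

lemma energy_diff_le:
  assumes "cylinder n \<phi>" "cylinder n \<psi>"
  shows "energy (\<lambda>w. \<phi> w - \<psi> w) \<le> 2 * energy \<phi> + 2 * energy \<psi>"
proof -
  have "\<bar>expect (gamma_smooth \<phi> \<psi>)\<bar> \<le> sqrt (energy \<phi>) * sqrt (energy \<psi>)"
    using gamma_L1_bound[OF assms] integral_abs_bound[of wiener "gamma_smooth \<phi> \<psi>"] by linarith
  moreover have "2 * (sqrt (energy \<phi>) * sqrt (energy \<psi>)) \<le> energy \<phi> + energy \<psi>"
    using sum_squares_bound[of "sqrt (energy \<phi>)" "sqrt (energy \<psi>)"] energy_nonneg[OF assms(1)] energy_nonneg[OF assms(2)] by simp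
  ultimately show ?thesis unfolding energy_diff[OF assms] by linarith
qed

lemma gamma_ibp:
  assumes "cylinder n \<phi>" "cylinder n \<psi>"
  shows "expect (gamma_smooth \<phi> \<psi>) = - expect (\<lambda>w. ou n \<phi> w * \<psi> w)"
proof -
  have "expect (gamma_smooth \<phi> \<psi>) = (\<Sum>k<n. expect (\<lambda>w. partial k \<phi> w * partial k \<psi> w))"
    unfolding gamma_smooth_sum[OF assms(1), abs_def]
    by (intro Bochner_Integration.integral_sum tame_integrable(1)[OF tame_mult[OF cylinder_tame(2)[OF assms(1)] cylinder_tame(2)[OF assms(2)]]])
  then show ?thesis using ou_ibp[OF cylinder_tame(2)[OF assms(1)] cylinder_tame(1)[OF assms(2)]] by simp
qed

lemma ou_cylinder_extend:
  assumes "cylinder n \<phi>" "n \<le> m"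
  shows "ou m \<phi> = ou n \<phi>"
proof
  fix w
  have "(\<Sum>i<m. partial i (partial i \<phi>) w - w i * partial i \<phi> w) = (\<Sum>i<n. partial i (partial i \<phi>) w - w i * partial i \<phi> w)"
    using assms by (intro sum.mono_neutral_right) (auto simp: partial_cylinder_outside[OF assms(1)] C1_fun_const(2))
  then show "ou m \<phi> w = ou n \<phi> w" by (simp add: ou_def)
qed

lemma ou_square_integrable:
  assumes "cylinder n \<phi>"
  shows "ou n \<phi> \<in> square_integrable"
proof -
  have "(\<lambda>w. \<Sum>i\<in>I. partial i (partial i \<phi>) w - w i * partial i \<phi> w) \<in> square_integrable" if "finite I" "I \<subseteq> {..<n}" for I
    using that
  proof (induction I rule: finite_induct)
    case empty
    then show ?case using square_integrable_const[of 0] by simp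
  next
    case (insert i I)
    have i: "i < n" using insert.prems by auto
    note t = cylinder_tame(2)[OF assms, of i]
    have "partial i (partial i \<phi>) \<in> square_integrable"
      using integrable_poly_growth[OF poly_growth_mult[OF tame_growth(2)[OF t] tame_growth(2)[OF t], of i i]] tame_measurable(2)[OF t, of i]
      by (simp add: square_integrable_def power2_eq_square)
    moreover have "(\<lambda>w. w i * partial i \<phi> w) \<in> square_integrable"
      by (rule square_integrable_tame[OF tame_mult[OF tame_coordinate[OF i] t]])
    ultimately show ?case
      using insert square_integrable_add[OF square_integrable_diff] by simp
  qed
  from this[of "{..<n}"] show ?thesis unfolding ou_def[abs_def] by simp
qed

text \<open>The energy of \<open>g n\<close> is at most that of \<open>g n - g m\<close> plus twice
  the mixed term. The first is small uniformly; in the second, integration by parts moves both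
  derivatives to \<open>g n\<close>, and for fixed \<open>n\<close> it tends to 0 because
  \<open>g m\<close> does so in mean square.\<close>

lemma energy_closable:
  assumes cyl: "\<And>n. \<exists>N. cylinder N (g n)"
    and lim: "(\<lambda>n. expect (\<lambda>w. (g n w)\<^sup>2)) \<longlonglongrightarrow> 0"
    and cauchy: "\<And>\<epsilon>. \<epsilon> > 0 \<Longrightarrow> \<exists>M. \<forall>m\<ge>M. \<forall>n\<ge>M. energy (\<lambda>w. g m w - g n w) < \<epsilon>"
  shows "(\<lambda>n. energy (g n)) \<longlonglongrightarrow> 0"
proof (rule LIMSEQ_I)
  fix r :: real assume "0 < r"
  then obtain M where M: "\<And>m n. M \<le> m \<Longrightarrow> M \<le> n \<Longrightarrow> energy (\<lambda>w. g m w - g n w) < r / 2"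
    using cauchy[of "r / 2"] by auto
  have "norm (energy (g n) - 0) < r" if n: "M \<le> n" for n
  proof -
    obtain N where N: "cylinder N (g n)" using cyl by blast
    let ?s = "\<lambda>m. sqrt (expect (\<lambda>w. (ou N (g n) w)\<^sup>2)) * sqrt (expect (\<lambda>w. (g m w)\<^sup>2))"
    have "energy (g n) \<le> r / 2 + 2 * ?s m" if m: "M \<le> m" for m
    proof -
      obtain N' where N': "cylinder N' (g m)" using cyl by blast
      have c: "cylinder (max N N') (g n)" "cylinder (max N N') (g m)" using cylinder_mono[OF N] cylinder_mono[OF N'] by auto
      have "expect (gamma_smooth (g n) (g m)) = - expect (\<lambda>w. ou N (g n) w * g m w)"
        using gamma_ibp[OF c] ou_cylinder_extend[OF N, of "max N N'"] by simp
      moreover have "\<bar>expect (\<lambda>w. ou N (g n) w * g m w)\<bar> \<le> ?s m"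
        by (rule abs_le_sqrt_mult[OF square_integrable_mult(2)[OF ou_square_integrable[OF N] square_integrable_tame[OF cylinder_tame(1)[OF N']]]])
      ultimately show ?thesis using energy_diff[OF c] energy_nonneg[OF c(2)] M[OF n m] by linarith
    qed
    moreover have "(\<lambda>m. r / 2 + 2 * ?s m) \<longlonglongrightarrow> r / 2 + 2 * (sqrt (expect (\<lambda>w. (ou N (g n) w)\<^sup>2)) * sqrt 0)"
      by (intro tendsto_intros lim)
    ultimately have "energy (g n) \<le> r / 2 + 2 * (sqrt (expect (\<lambda>w. (ou N (g n) w)\<^sup>2)) * sqrt 0)"
      by (intro LIMSEQ_le_const) auto
    then show ?thesis using energy_nonneg[OF N] \<open>0 < r\<close> by simp
  qed
  then show "\<exists>M. \<forall>n\<ge>M. norm (energy (g n) - 0) < r" by blast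
qed

lemma gamma_approx_cylinder: "gamma_approx \<phi> F \<Longrightarrow> \<exists>N. cylinder N (\<phi> n)"
  by (simp add: gamma_approx_def smooth_cylinder_iff)

text \<open>Closability applied to the differences of the two approximations, which tend to zero in
  mean square and are again Cauchy in energy.\<close>

lemma gamma_approx_unique:
  assumes \<phi>: "gamma_approx \<phi> F" and f: "gamma_approx f F"
  shows "(\<lambda>n. energy (\<lambda>w. \<phi> n w - f n w)) \<longlonglongrightarrow> 0"
proof (rule energy_closable)
  note L = L2_tendstoD[of \<phi> F] L2_tendstoD[of f F]
  have L2: "L2_tendsto \<phi> F" "L2_tendsto f F" using \<phi> f by (auto simp: gamma_approx_def)
  show "\<exists>N. cylinder N (\<lambda>w. \<phi> n w - f n w)" for n
  proof -
    obtain N N' where "cylinder N (\<phi> n)" "cylinder N' (f n)" using gamma_approx_cylinder \<phi> f by meson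
    then have "cylinder (max N N') (\<phi> n)" "cylinder (max N N') (f n)" by (auto intro: cylinder_mono)
    then show ?thesis using cylinder_diff by blast
  qed
  show "(\<lambda>n. expect (\<lambda>w. (\<phi> n w - f n w)\<^sup>2)) \<longlonglongrightarrow> 0"
  proof (rule Lim_null_comparison)
    show "\<forall>\<^sub>F n in sequentially. norm (expect (\<lambda>w. (\<phi> n w - f n w)\<^sup>2)) \<le>
      2 * expect (\<lambda>w. (\<phi> n w - F w)\<^sup>2) + 2 * expect (\<lambda>w. (f n w - F w)\<^sup>2)"
    proof (intro always_eventually allI)
      fix n
      have d: "(\<lambda>w. \<phi> n w - F w) \<in> square_integrable" "(\<lambda>w. F w - f n w) \<in> square_integrable"
        using L(1,2)[OF L2(1)] L(4,5)[OF L2(2)] by (auto intro: square_integrable_diff)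
      have "expect (\<lambda>w. ((\<phi> n w - F w) + (F w - f n w))\<^sup>2) \<le> 2 * expect (\<lambda>w. (\<phi> n w - F w)\<^sup>2) + 2 * expect (\<lambda>w. (F w - f n w)\<^sup>2)"
        by (rule expect_square_add_le[OF d])
      then show "norm (expect (\<lambda>w. (\<phi> n w - f n w)\<^sup>2)) \<le> 2 * expect (\<lambda>w. (\<phi> n w - F w)\<^sup>2) + 2 * expect (\<lambda>w. (f n w - F w)\<^sup>2)"
        by (simp add: power2_commute[of "F _" "f n _"])
    qed
    have "(\<lambda>n. 2 * expect (\<lambda>w. (\<phi> n w - F w)\<^sup>2) + 2 * expect (\<lambda>w. (f n w - F w)\<^sup>2)) \<longlonglongrightarrow> 2 * 0 + 2 * 0"
      by (intro tendsto_intros L(3)[OF L2(1)] L(6)[OF L2(2)])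
    then show "(\<lambda>n. 2 * expect (\<lambda>w. (\<phi> n w - F w)\<^sup>2) + 2 * expect (\<lambda>w. (f n w - F w)\<^sup>2)) \<longlonglongrightarrow> 0" by simp
  qed
  fix \<epsilon> :: real assume "0 < \<epsilon>"
  then have q: "0 < \<epsilon> / 4" by simp
  have "\<forall>\<epsilon>>0. \<exists>M. \<forall>m\<ge>M. \<forall>n\<ge>M. energy (\<lambda>w. \<phi> m w - \<phi> n w) < \<epsilon>"
    "\<forall>\<epsilon>>0. \<exists>M. \<forall>m\<ge>M. \<forall>n\<ge>M. energy (\<lambda>w. f m w - f n w) < \<epsilon>"
    using \<phi> f unfolding gamma_approx_def by blast+
  from this[rule_format, OF q] obtain M1 M2 where M: "\<And>m n. M1 \<le> m \<Longrightarrow> M1 \<le> n \<Longrightarrow> energy (\<lambda>w. \<phi> m w - \<phi> n w) < \<epsilon> / 4"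
    "\<And>m n. M2 \<le> m \<Longrightarrow> M2 \<le> n \<Longrightarrow> energy (\<lambda>w. f m w - f n w) < \<epsilon> / 4" by blast
  have "energy (\<lambda>w. (\<phi> m w - f m w) - (\<phi> n w - f n w)) < \<epsilon>" if mn: "max M1 M2 \<le> m" "max M1 M2 \<le> n" for m n
  proof -
    obtain N1 N2 N3 N4 where N: "cylinder N1 (\<phi> m)" "cylinder N2 (\<phi> n)" "cylinder N3 (f m)" "cylinder N4 (f n)"
      using gamma_approx_cylinder \<phi> f by meson
    define N where "N = max (max N1 N2) (max N3 N4)"
    have "cylinder N (\<phi> m)" "cylinder N (\<phi> n)" "cylinder N (f m)" "cylinder N (f n)"
      unfolding N_def by (rule cylinder_mono[OF N(1)] cylinder_mono[OF N(2)] cylinder_mono[OF N(3)] cylinder_mono[OF N(4)], simp)+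
    then have "energy (\<lambda>w. (\<phi> m w - \<phi> n w) - (f m w - f n w)) \<le> 2 * energy (\<lambda>w. \<phi> m w - \<phi> n w) + 2 * energy (\<lambda>w. f m w - f n w)"
      by (intro energy_diff_le cylinder_diff)
    also have "\<dots> < \<epsilon>" using M(1)[of m n] M(2)[of m n] mn by simp
    also have "(\<lambda>w. (\<phi> m w - \<phi> n w) - (f m w - f n w)) = (\<lambda>w. (\<phi> m w - f m w) - (\<phi> n w - f n w))" by auto
    finally show ?thesis .
  qed
  then show "\<exists>M. \<forall>m\<ge>M. \<forall>n\<ge>M. energy (\<lambda>w. (\<phi> m w - f m w) - (\<phi> n w - f n w)) < \<epsilon>" by blast
qed

text \<open>On a fixed chaos the energy is proportional to the squared norm; convergence in mean
  square therefore already implies the energy Cauchy property of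
  \<open>gamma_approx\<close>.\<close>

lemma energy_poly_chaos:
  assumes "poly_chaos p F"
  shows "energy F = p * expect (\<lambda>w. (F w)\<^sup>2)"
proof -
  obtain n where n: "polyfun n p F" "eigen n p F" using assms unfolding poly_chaos_def by blast
  have "energy F = (\<Sum>k<n. expect (\<lambda>w. partial k F w * partial k F w))"
    unfolding gamma_smooth_sum[OF polyfun_cylinder[OF n(1)], abs_def]
    by (intro Bochner_Integration.integral_sum polyfun_integrable[OF polyfun_mult[OF polyfun_partial[OF n(1)] polyfun_partial[OF n(1)]]])
  then show ?thesis using eigen_ibp[OF n(2) polyfun_tame[OF n(1)]] by (simp add: power2_eq_square)
qed

lemma L2_tendsto_Cauchy:
  assumes "L2_tendsto f F" "0 < \<epsilon>"
  shows "\<exists>M. \<forall>m\<ge>M. \<forall>n\<ge>M. expect (\<lambda>w. (f m w - f n w)\<^sup>2) < \<epsilon>"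
proof -
  note F = L2_tendstoD[OF assms(1)]
  obtain M where M: "\<And>m. M \<le> m \<Longrightarrow> expect (\<lambda>w. (f m w - F w)\<^sup>2) < \<epsilon> / 4"
    using LIMSEQ_D[OF F(3), of "\<epsilon> / 4"] assms(2) by auto
  have "expect (\<lambda>w. (f m w - f n w)\<^sup>2) < \<epsilon>" if "M \<le> m" "M \<le> n" for m n
  proof -
    have d: "(\<lambda>w. f m w - F w) \<in> square_integrable" "(\<lambda>w. F w - f n w) \<in> square_integrable"
      using F by (auto intro: square_integrable_diff)
    have "expect (\<lambda>w. ((f m w - F w) + (F w - f n w))\<^sup>2) \<le> 2 * expect (\<lambda>w. (f m w - F w)\<^sup>2) + 2 * expect (\<lambda>w. (F w - f n w)\<^sup>2)"
      by (rule expect_square_add_le[OF d])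
    then show ?thesis using M[OF that(1)] M[OF that(2)] by (simp add: power2_commute[of "F _" "f n _"])
  qed
  then show ?thesis by blast
qed

lemma poly_chaos_gamma_approx:
  assumes f: "\<And>n. poly_chaos p (f n)" and L: "L2_tendsto f F"
  shows "gamma_approx f F"
  unfolding gamma_approx_def
proof (intro conjI allI impI)
  show "f n \<in> smooth_cylinder" for n
    unfolding smooth_cylinder_iff by (rule poly_chaos_cylinder[OF f])
  fix \<epsilon> :: real assume "0 < \<epsilon>"
  \<comment> \<open>The divisor \<open>real p + 1\<close> stays positive also for p = 0.\<close>
  then obtain M where M: "\<And>m n. M \<le> m \<Longrightarrow> M \<le> n \<Longrightarrow> expect (\<lambda>w. (f m w - f n w)\<^sup>2) < \<epsilon> / (real p + 1)"
    using L2_tendsto_Cauchy[OF L, of "\<epsilon> / (real p + 1)"] by auto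
  have "energy (\<lambda>w. f m w - f n w) < \<epsilon>" if "M \<le> m" "M \<le> n" for m n
  proof -
    have "energy (\<lambda>w. f m w - f n w) = p * expect (\<lambda>w. (f m w - f n w)\<^sup>2)"
      by (rule energy_poly_chaos[OF poly_chaos_diff[OF f f]])
    also have "\<dots> \<le> (real p + 1) * expect (\<lambda>w. (f m w - f n w)\<^sup>2)" by (intro mult_right_mono) auto
    also have "\<dots> < (real p + 1) * (\<epsilon> / (real p + 1))" using M[OF that] by (intro mult_strict_left_mono) auto
    finally show ?thesis by simp
  qed
  then show "\<exists>M. \<forall>m\<ge>M. \<forall>n\<ge>M. energy (\<lambda>w. f m w - f n w) < \<epsilon>" by blast
qed (rule L)

lemma gamma_add_right:
  assumes "cylinder n \<phi>" "cylinder n \<psi>" "cylinder n g"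
  shows "gamma_smooth \<phi> \<psi> w - gamma_smooth \<phi> g w = gamma_smooth \<phi> (\<lambda>w. \<psi> w - g w) w"
  unfolding gamma_smooth_sum[OF assms(1)] partial_cylinder_diff[OF assms(2,3)]
  by (simp add: right_diff_distrib sum_subtractf)

lemma gamma_commute: "cylinder n \<phi> \<Longrightarrow> cylinder n \<psi> \<Longrightarrow> gamma_smooth \<phi> \<psi> w = gamma_smooth \<psi> \<phi> w"
  by (simp add: gamma_smooth_sum mult.commute)

text \<open>Telescoping by bilinearity: one argument is exchanged at a time, and
  \<open>gamma_L1_bound\<close> applies to each difference.\<close>

lemma gamma_L1_diff:
  assumes c: "cylinder n \<phi>" "cylinder n \<psi>" "cylinder n f" "cylinder n g"
  shows "expect (\<lambda>w. \<bar>gamma_smooth \<phi> \<psi> w - gamma_smooth f g w\<bar>) \<le>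
    sqrt (energy (\<lambda>w. \<phi> w - f w)) * sqrt (energy \<psi>) + sqrt (energy f) * sqrt (energy (\<lambda>w. \<psi> w - g w))"
proof -
  have eq: "gamma_smooth \<phi> \<psi> w - gamma_smooth f g w = gamma_smooth (\<lambda>w. \<phi> w - f w) \<psi> w + gamma_smooth f (\<lambda>w. \<psi> w - g w) w" for w
    using gamma_add_right[OF c(2,1,3), of w] gamma_add_right[OF c(3,2,4), of w] gamma_commute[OF c(1,2), of w]
      gamma_commute[OF c(3,2), of w] gamma_commute[OF cylinder_diff[OF c(1,3)] c(2), of w] by linarith
  note i = gamma_integrable[OF cylinder_diff[OF c(1,3)] c(2)] gamma_integrable[OF c(3) cylinder_diff[OF c(2,4)]]
  have "expect (\<lambda>w. \<bar>gamma_smooth \<phi> \<psi> w - gamma_smooth f g w\<bar>) \<le>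
    expect (\<lambda>w. \<bar>gamma_smooth (\<lambda>w. \<phi> w - f w) \<psi> w\<bar> + \<bar>gamma_smooth f (\<lambda>w. \<psi> w - g w) w\<bar>)"
    unfolding eq using i by (intro integral_mono) auto
  also have "\<dots> = expect (\<lambda>w. \<bar>gamma_smooth (\<lambda>w. \<phi> w - f w) \<psi> w\<bar>) + expect (\<lambda>w. \<bar>gamma_smooth f (\<lambda>w. \<psi> w - g w) w\<bar>)"
    using i by simp
  also have "\<dots> \<le> sqrt (energy (\<lambda>w. \<phi> w - f w)) * sqrt (energy \<psi>) + sqrt (energy f) * sqrt (energy (\<lambda>w. \<psi> w - g w))"
    by (intro add_mono gamma_L1_bound[OF cylinder_diff[OF c(1,3)] c(2)] gamma_L1_bound[OF c(3) cylinder_diff[OF c(2,4)]])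
  finally show ?thesis .
qed

section \<open>Fatou's lemma and completeness of the space of integrable functions\<close>

lemma fatou_expect:
  assumes int: "\<And>k. integrable wiener (Y k)" and nn: "\<And>k w. 0 \<le> Y k w"
    and Z: "Z \<in> borel_measurable wiener" and ae: "AE w in wiener. (\<lambda>k. Y k w) \<longlonglongrightarrow> Z w"
    and le: "\<And>k. expect (Y k) \<le> d k" and d: "d \<longlonglongrightarrow> e"
  shows "integrable wiener Z" "expect Z \<le> e"
proof -
  note [measurable] = Z borel_measurable_integrable[OF int]
  have Zn: "AE w in wiener. 0 \<le> Z w"
    using ae by eventually_elim (rule LIMSEQ_le_const, auto simp: nn)
  have "0 \<le> expect (Y k)" for k by (simp add: nn)
  then have "0 \<le> d k" for k using le[of k] by (rule order_trans)
  then have e: "0 \<le> e" using d by (intro LIMSEQ_le_const) auto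
  have "(\<integral>\<^sup>+w. ennreal (Z w) \<partial>wiener) = (\<integral>\<^sup>+w. liminf (\<lambda>k. ennreal (Y k w)) \<partial>wiener)"
  proof (rule nn_integral_cong_AE)
    show "AE w in wiener. ennreal (Z w) = liminf (\<lambda>k. ennreal (Y k w))"
      using ae
    proof eventually_elim
      case (elim w)
      then have "(\<lambda>k. ennreal (Y k w)) \<longlonglongrightarrow> ennreal (Z w)" by (rule tendsto_ennrealI)
      then show ?case by (intro lim_imp_Liminf[symmetric]) auto
    qed
  qed
  also have "\<dots> \<le> liminf (\<lambda>k. \<integral>\<^sup>+w. ennreal (Y k w) \<partial>wiener)"
    by (rule nn_integral_liminf) measurable
  also have "\<dots> \<le> liminf (\<lambda>k. ennreal (d k))"
    by (intro Liminf_mono always_eventually allI)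
       (use int nn le in \<open>simp add: nn_integral_eq_integral ennreal_leI\<close>)
  also have "\<dots> = ennreal e"
    by (intro lim_imp_Liminf tendsto_ennrealI d) simp
  finally have le': "(\<integral>\<^sup>+w. ennreal (Z w) \<partial>wiener) \<le> ennreal e" .
  show Zi: "integrable wiener Z"
    by (rule integrableI_nonneg[OF Z Zn]) (use le' in \<open>auto intro: le_less_trans\<close>)
  have "ennreal (expect Z) \<le> ennreal e"
    using le' nn_integral_eq_integral[OF Zi Zn] by simp
  then show "expect Z \<le> e" using e by simp
qed

text \<open>A subsequence converges almost everywhere and defines the limit. Fatou's lemma along the
  subsequence turns the Cauchy estimate into an estimate of the distance to that limit, for the
  whole sequence.\<close>

lemma L1_complete:
  assumes int: "\<And>n. integrable wiener (s n)"
    and cauchy: "\<And>e::real. e > 0 \<Longrightarrow> \<exists>N. \<forall>i\<ge>N. \<forall>j\<ge>N. expect (\<lambda>w. \<bar>s i w - s j w\<bar>) < e"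
  shows "\<exists>X. integrable wiener X \<and> (\<lambda>n. expect (\<lambda>w. \<bar>s n w - X w\<bar>)) \<longlonglongrightarrow> 0"
proof -
  obtain r where r: "strict_mono r" "AE w in wiener. Cauchy (\<lambda>i. s (r i) w)"
    using cauchy_L1_AE_cauchy_subseq[OF int, unfolded real_norm_def, OF cauchy] by blast
  define X where "X w = lim (\<lambda>i. s (r i) w)" for w
  note [measurable] = borel_measurable_integrable[OF int]
  have X[measurable]: "X \<in> borel_measurable wiener" unfolding X_def[abs_def] by measurable
  have ae: "AE w in wiener. (\<lambda>i. s (r i) w) \<longlonglongrightarrow> X w"
    using r(2) by eventually_elim (simp add: X_def Cauchy_convergent_iff convergent_LIMSEQ_iff)
  have main: "\<exists>N. \<forall>n\<ge>N. integrable wiener (\<lambda>w. \<bar>s n w - X w\<bar>) \<and> expect (\<lambda>w. \<bar>s n w - X w\<bar>) \<le> e" if e: "0 < e" for e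
  proof -
    obtain N where N: "\<And>i j. N \<le> i \<Longrightarrow> N \<le> j \<Longrightarrow> expect (\<lambda>w. \<bar>s i w - s j w\<bar>) < e" using cauchy[OF e] by auto
    have "integrable wiener (\<lambda>w. \<bar>s n w - X w\<bar>) \<and> expect (\<lambda>w. \<bar>s n w - X w\<bar>) \<le> e" if n: "N \<le> n" for n
    proof
      have le: "expect (\<lambda>w. \<bar>s n w - s (r (k + N)) w\<bar>) \<le> e" for k
        using N[OF n, of "r (k + N)"] seq_suble[OF r(1), of "k + N"] by simp
      have ae': "AE w in wiener. (\<lambda>k. \<bar>s n w - s (r (k + N)) w\<bar>) \<longlonglongrightarrow> \<bar>s n w - X w\<bar>"
        using ae
      proof eventually_elim
        case (elim w)
        show ?case by (rule tendsto_rabs[OF tendsto_diff[OF tendsto_const LIMSEQ_ignore_initial_segment[OF elim]]])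
      qed
      have i: "integrable wiener (\<lambda>w. \<bar>s n w - s (r (k + N)) w\<bar>)" for k
        by (rule integrable_abs[OF Bochner_Integration.integrable_diff[OF int int]])
      have m: "(\<lambda>w. \<bar>s n w - X w\<bar>) \<in> borel_measurable wiener" by measurable
      have z: "0 \<le> \<bar>s n w - s (r (k + N)) w\<bar>" for k w by simp
      have t: "(\<lambda>_ :: nat. e) \<longlonglongrightarrow> e" by simp
      show "integrable wiener (\<lambda>w. \<bar>s n w - X w\<bar>)" by (rule fatou_expect(1)[OF i z m ae' le t])
      show "expect (\<lambda>w. \<bar>s n w - X w\<bar>) \<le> e" by (rule fatou_expect(2)[OF i z m ae' le t])
    qed
    then show ?thesis by blast
  qed
  obtain N where N: "\<forall>n\<ge>N. integrable wiener (\<lambda>w. \<bar>s n w - X w\<bar>) \<and> expect (\<lambda>w. \<bar>s n w - X w\<bar>) \<le> 1"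
    using main[OF zero_less_one] by blast
  have m: "(\<lambda>w. s N w - X w) \<in> borel_measurable wiener" by measurable
  have "integrable wiener (\<lambda>w. s N w - X w)"
    by (rule integrable_abs_cancel[OF conjunct1[OF N[rule_format, OF order_refl]] m])
  from Bochner_Integration.integrable_diff[OF int[of N] this] have "integrable wiener X" by simp
  moreover have "(\<lambda>n. expect (\<lambda>w. \<bar>s n w - X w\<bar>)) \<longlonglongrightarrow> 0"
  proof (rule LIMSEQ_I)
    fix e :: real assume "0 < e"
    then have "0 < e / 2" by simp
    from main[OF this] obtain N where N: "\<forall>n\<ge>N. integrable wiener (\<lambda>w. \<bar>s n w - X w\<bar>) \<and> expect (\<lambda>w. \<bar>s n w - X w\<bar>) \<le> e / 2"
      by blast
    have "norm (expect (\<lambda>w. \<bar>s n w - X w\<bar>) - 0) < e" if "N \<le> n" for n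
    proof -
      have "0 \<le> expect (\<lambda>w. \<bar>s n w - X w\<bar>)" by simp
      moreover have "expect (\<lambda>w. \<bar>s n w - X w\<bar>) \<le> e / 2" using N that by blast
      ultimately show ?thesis using \<open>0 < e\<close> by simp
    qed
    then show "\<exists>N. \<forall>n\<ge>N. norm (expect (\<lambda>w. \<bar>s n w - X w\<bar>) - 0) < e" by blast
  qed
  ultimately show ?thesis by blast
qed

lemma gamma_diag_L1_diff:
  assumes "poly_chaos p f" "poly_chaos p g"
  shows "expect (\<lambda>w. \<bar>gamma_smooth f f w - gamma_smooth g g w\<bar>) \<le>
    p * sqrt (expect (\<lambda>w. (f w - g w)\<^sup>2)) * (sqrt (expect (\<lambda>w. (f w)\<^sup>2)) + sqrt (expect (\<lambda>w. (g w)\<^sup>2)))"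
proof -
  obtain n where "polyfun n p f" "polyfun n p g" using assms by (rule poly_chaosE)
  then have n: "cylinder n f" "cylinder n g" by (auto intro: polyfun_cylinder)
  have alg: "(a * d) * (a * x) + (a * y) * (a * d) = (a * a) * d * (x + y)" for a d x y :: real
    by (simp add: algebra_simps)
  have "expect (\<lambda>w. \<bar>gamma_smooth f f w - gamma_smooth g g w\<bar>) \<le>
    sqrt (energy (\<lambda>w. f w - g w)) * sqrt (energy f) + sqrt (energy g) * sqrt (energy (\<lambda>w. f w - g w))"
    by (rule gamma_L1_diff[OF n(1,1,2,2)])
  also have "\<dots> = p * sqrt (expect (\<lambda>w. (f w - g w)\<^sup>2)) * (sqrt (expect (\<lambda>w. (f w)\<^sup>2)) + sqrt (expect (\<lambda>w. (g w)\<^sup>2)))"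
    unfolding energy_poly_chaos[OF assms(1)] energy_poly_chaos[OF assms(2)] energy_poly_chaos[OF poly_chaos_diff[OF assms]] real_sqrt_mult
      alg by simp
  finally show ?thesis .
qed

text \<open>Completeness yields some limit along \<open>f\<close>, so the \<open>SOME\<close> in
  \<open>carre_du_champ\<close> has a witness. The chosen version may come from other
  approximations, and \<open>gamma_approx_unique\<close> transports its convergence back to
  \<open>f\<close>.\<close>

theorem carre_du_champ_chaos:
  assumes F: "F \<in> chaos p" and f: "\<And>n. poly_chaos p (f n)" "L2_tendsto f F"
  shows "integrable wiener (carre_du_champ F F)"
    and "(\<lambda>n. expect (\<lambda>w. \<bar>gamma_smooth (f n) (f n) w - carre_du_champ F F w\<bar>)) \<longlonglongrightarrow> 0"
proof -
  note ga = poly_chaos_gamma_approx[OF f]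
  have fi: "integrable wiener (gamma_smooth (f n) (f n))" for n
    using poly_chaos_cylinder[OF f(1)] gamma_integrable by blast
  have L1: "(\<lambda>n. expect (\<lambda>w. (f n w)\<^sup>2)) \<longlonglongrightarrow> expect (\<lambda>w. (F w)\<^sup>2)" by (rule L2_tendsto_norm[OF f(2)])
  then have "Bseq (\<lambda>n. expect (\<lambda>w. (f n w)\<^sup>2))" by (simp add: convergent_imp_Bseq convergentI)
  then obtain B where B: "0 < B" "\<And>n. norm (expect (\<lambda>w. (f n w)\<^sup>2)) \<le> B" unfolding Bseq_def by blast
  have sB: "sqrt (expect (\<lambda>w. (f n w)\<^sup>2)) \<le> sqrt B" for n using B(2)[of n] by simp
  have "\<exists>X. integrable wiener X \<and> (\<lambda>n. expect (\<lambda>w. \<bar>gamma_smooth (f n) (f n) w - X w\<bar>)) \<longlonglongrightarrow> 0"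
  proof (rule L1_complete[OF fi])
    fix e :: real assume e: "0 < e"
    define K where "K = real p * (2 * sqrt B) + 1"
    have K: "0 < K" using B by (simp add: K_def add_nonneg_pos)
    obtain M where M: "\<And>m n. M \<le> m \<Longrightarrow> M \<le> n \<Longrightarrow> expect (\<lambda>w. (f m w - f n w)\<^sup>2) < (e / K)\<^sup>2"
      using L2_tendsto_Cauchy[OF f(2), of "(e / K)\<^sup>2"] e K by auto
    have "expect (\<lambda>w. \<bar>gamma_smooth (f i) (f i) w - gamma_smooth (f j) (f j) w\<bar>) < e" if "M \<le> i" "M \<le> j" for i j
    proof -
      let ?d = "sqrt (expect (\<lambda>w. (f i w - f j w)\<^sup>2))"
      have d: "0 \<le> ?d" "?d < e / K" using M[OF that] e K real_sqrt_less_mono[OF M[OF that]] by auto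
      have "expect (\<lambda>w. \<bar>gamma_smooth (f i) (f i) w - gamma_smooth (f j) (f j) w\<bar>) \<le>
        p * ?d * (sqrt (expect (\<lambda>w. (f i w)\<^sup>2)) + sqrt (expect (\<lambda>w. (f j w)\<^sup>2)))"
        by (rule gamma_diag_L1_diff[OF f(1) f(1)])
      also have "\<dots> \<le> p * ?d * (sqrt B + sqrt B)" by (intro mult_left_mono add_mono sB) auto
      also have "\<dots> = (real p * (2 * sqrt B)) * ?d" by simp
      also have "\<dots> \<le> K * ?d" using d(1) by (intro mult_right_mono) (auto simp: K_def)
      also have "\<dots> < K * (e / K)" using d(2) K by (rule mult_strict_left_mono)
      also have "\<dots> = e" using K by simp
      finally show ?thesis .
    qed
    then show "\<exists>N. \<forall>i\<ge>N. \<forall>j\<ge>N. expect (\<lambda>w. \<bar>gamma_smooth (f i) (f i) w - gamma_smooth (f j) (f j) w\<bar>) < e" by blast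
  qed
  then have "\<exists>X. is_carre_du_champ F F X"
    unfolding is_carre_du_champ_def using chaos_gamma_dom[OF F] ga by blast
  then have "is_carre_du_champ F F (carre_du_champ F F)" unfolding carre_du_champ_def by (rule someI_ex)
  then obtain \<phi> \<psi> where X: "integrable wiener (carre_du_champ F F)" and \<phi>: "gamma_approx \<phi> F" and \<psi>: "gamma_approx \<psi> F"
    and lim: "(\<lambda>n. expect (\<lambda>w. \<bar>gamma_smooth (\<phi> n) (\<psi> n) w - carre_du_champ F F w\<bar>)) \<longlonglongrightarrow> 0"
    unfolding is_carre_du_champ_def by blast
  show "integrable wiener (carre_du_champ F F)" by (rule X)
  let ?a = "\<lambda>n. energy (\<lambda>w. \<phi> n w - f n w)" and ?b = "\<lambda>n. energy (\<lambda>w. \<psi> n w - f n w)"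
  have a: "?a \<longlonglongrightarrow> 0" and b: "?b \<longlonglongrightarrow> 0"
    using gamma_approx_unique[OF \<phi> ga] gamma_approx_unique[OF \<psi> ga] by auto
  let ?e = "\<lambda>n. expect (\<lambda>w. (f n w)\<^sup>2)"
  let ?R = "\<lambda>n. sqrt (?a n) * sqrt (2 * ?b n + 2 * (p * ?e n)) + sqrt (p * ?e n) * sqrt (?b n)"
  show "(\<lambda>n. expect (\<lambda>w. \<bar>gamma_smooth (f n) (f n) w - carre_du_champ F F w\<bar>)) \<longlonglongrightarrow> 0"
  proof (rule Lim_null_comparison)
    show "\<forall>\<^sub>F n in sequentially. norm (expect (\<lambda>w. \<bar>gamma_smooth (f n) (f n) w - carre_du_champ F F w\<bar>)) \<le>
      ?R n + expect (\<lambda>w. \<bar>gamma_smooth (\<phi> n) (\<psi> n) w - carre_du_champ F F w\<bar>)"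
    proof (intro always_eventually allI)
      fix n
      obtain N1 N2 N3 where N: "cylinder N1 (\<phi> n)" "cylinder N2 (\<psi> n)" "cylinder N3 (f n)"
        using gamma_approx_cylinder \<phi> \<psi> ga by meson
      define N where "N = max N1 (max N2 N3)"
      have c: "cylinder N (\<phi> n)" "cylinder N (\<psi> n)" "cylinder N (f n)"
        unfolding N_def by (rule cylinder_mono[OF N(1)] cylinder_mono[OF N(2)] cylinder_mono[OF N(3)], simp)+
      note i = gamma_integrable[OF c(1,2)] fi[of n] X
      \<comment> \<open>Bounds the energy of \<open>\<psi> n\<close> by writing it as the difference
        of \<open>\<psi> n - f n\<close> and \<open>- f n\<close>, whose energies are
        controlled.\<close>
      have "energy (\<lambda>w. (\<psi> n w - f n w) - (\<lambda>w. 0 - f n w) w) \<le> 2 * ?b n + 2 * energy (\<lambda>w. 0 - f n w)"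
        by (rule energy_diff_le[OF cylinder_diff[OF c(2,3)] cylinder_diff[OF polyfun_cylinder[OF polyfun.const] c(3)]])
      moreover have "energy (\<lambda>w. 0 - f n w) = p * ?e n"
        using energy_poly_chaos[OF poly_chaos_diff[OF poly_chaos_zero f(1)]] by simp
      ultimately have e\<psi>: "energy (\<psi> n) \<le> 2 * ?b n + 2 * (p * ?e n)" by simp
      have "expect (\<lambda>w. \<bar>gamma_smooth (\<phi> n) (\<psi> n) w - gamma_smooth (f n) (f n) w\<bar>) \<le> sqrt (?a n) * sqrt (energy (\<psi> n)) + sqrt (energy (f n)) * sqrt (?b n)"
        by (rule gamma_L1_diff[OF c(1,2,3,3)])
      also have "\<dots> \<le> ?R n"
        using e\<psi> energy_nonneg[OF cylinder_diff[OF c(1,3)]] by (simp add: energy_poly_chaos[OF f(1)] mult_left_mono)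
      finally have 1: "expect (\<lambda>w. \<bar>gamma_smooth (\<phi> n) (\<psi> n) w - gamma_smooth (f n) (f n) w\<bar>) \<le> ?R n" .
      have "expect (\<lambda>w. \<bar>gamma_smooth (f n) (f n) w - carre_du_champ F F w\<bar>) \<le>
        expect (\<lambda>w. \<bar>gamma_smooth (\<phi> n) (\<psi> n) w - gamma_smooth (f n) (f n) w\<bar> + \<bar>gamma_smooth (\<phi> n) (\<psi> n) w - carre_du_champ F F w\<bar>)"
        using i by (intro integral_mono) auto
      also have "\<dots> = expect (\<lambda>w. \<bar>gamma_smooth (\<phi> n) (\<psi> n) w - gamma_smooth (f n) (f n) w\<bar>) + expect (\<lambda>w. \<bar>gamma_smooth (\<phi> n) (\<psi> n) w - carre_du_champ F F w\<bar>)"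
        using i by simp
      finally show "norm (expect (\<lambda>w. \<bar>gamma_smooth (f n) (f n) w - carre_du_champ F F w\<bar>)) \<le>
        ?R n + expect (\<lambda>w. \<bar>gamma_smooth (\<phi> n) (\<psi> n) w - carre_du_champ F F w\<bar>)" using 1 by simp
    qed
    have "(\<lambda>n. ?R n + expect (\<lambda>w. \<bar>gamma_smooth (\<phi> n) (\<psi> n) w - carre_du_champ F F w\<bar>)) \<longlonglongrightarrow>
      (sqrt 0 * sqrt (2 * 0 + 2 * (p * expect (\<lambda>w. (F w)\<^sup>2))) + sqrt (p * expect (\<lambda>w. (F w)\<^sup>2)) * sqrt 0) + 0"
      by (intro tendsto_intros a b L1 lim)
    then show "(\<lambda>n. ?R n + expect (\<lambda>w. \<bar>gamma_smooth (\<phi> n) (\<psi> n) w - carre_du_champ F F w\<bar>)) \<longlonglongrightarrow> 0" by simp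
  qed
qed

lemma expect_abs_le: "X \<in> square_integrable \<Longrightarrow> expect (\<lambda>w. \<bar>X w\<bar>) \<le> sqrt (expect (\<lambda>w. (X w)\<^sup>2))"
proof -
  assume X: "X \<in> square_integrable"
  then have "(\<lambda>w. \<bar>X w\<bar>) \<in> square_integrable" unfolding square_integrable_def by auto
  from square_integrable_mult(2)[OF this square_integrable_const[of 1]] show ?thesis
    by (intro real_le_rsqrt) simp
qed

lemma cos_lipschitz: "\<bar>cos x - cos y\<bar> \<le> \<bar>x - y\<bar>" for x y :: real
proof -
  have "\<bar>cos x - cos y\<bar> = 2 * (\<bar>sin ((x + y) / 2)\<bar> * \<bar>sin ((y - x) / 2)\<bar>)"
    by (simp add: cos_diff_cos abs_mult)
  also have "\<dots> \<le> 2 * (1 * \<bar>(y - x) / 2\<bar>)"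
    by (intro mult_left_mono mult_mono abs_sin_le_one abs_sin_x_le_abs_x) auto
  finally show ?thesis by simp
qed

lemma integrable_cos_wiener:
  fixes F :: "(nat \<Rightarrow> real) \<Rightarrow> real"
  assumes "F \<in> borel_measurable wiener"
  shows "integrable wiener (\<lambda>w. cos (u * F w))"
proof (rule wiener.integrable_const_bound[where B = 1])
  have "(\<lambda>x. cos (u * x)) \<in> borel_measurable borel"
    by (intro borel_measurable_continuous_onI continuous_intros)
  from measurable_compose[OF assms this] show "(\<lambda>w. cos (u * F w)) \<in> borel_measurable wiener" .
qed simp

section \<open>Passage from polynomials to the whole chaos\<close>

text \<open>The approximants have norm only close to 1, so the polynomial bound is applied after
  normalisation; division of \<open>f\<close> by \<open>sqrt a\<close> divides its gradient square
  by \<open>a\<close>.\<close>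

lemma poly_chaos_scaled_bound:
  assumes bound: "\<And>n F. polyfun n p F \<Longrightarrow> eigen n p F \<Longrightarrow> expect (\<lambda>w. (F w)\<^sup>2) = 1 \<Longrightarrow>
      c * expect (\<lambda>w. ((\<Sum>i<n. (partial i F w)\<^sup>2) - p)\<^sup>2) \<le> expect (\<lambda>w. cos (s * F w)) - exp (- (s\<^sup>2 / 2))"
    and f: "poly_chaos p f" and a: "a = expect (\<lambda>w. (f w)\<^sup>2)" "0 < a"
  shows "integrable wiener (\<lambda>w. (gamma_smooth f f w - p * a)\<^sup>2)"
    and "c * expect (\<lambda>w. (gamma_smooth f f w - p * a)\<^sup>2) \<le> a\<^sup>2 * (expect (\<lambda>w. cos (s / sqrt a * f w)) - exp (- (s\<^sup>2 / 2)))"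
proof -
  obtain n where n: "polyfun n p f" "eigen n p f" using f unfolding poly_chaos_def by blast
  let ?g = "\<lambda>w. 1 / sqrt a * f w"
  have sa: "1 / sqrt a * (1 / sqrt a) = 1 / a" using a(2) by simp
  have G: "gamma_smooth f f w = (\<Sum>i<n. (partial i f w)\<^sup>2)" for w
    by (simp add: gamma_smooth_sum[OF polyfun_cylinder[OF n(1)]] power2_eq_square)
  show "integrable wiener (\<lambda>w. (gamma_smooth f f w - p * a)\<^sup>2)"
    unfolding G
    by (rule polyfun_integrable[OF polyfun_power2[OF polyfun_diff[OF polyfun_sum[OF polyfun_power2[OF polyfun_partial[OF n(1)]]] polyfun.const]]])
  have g1: "expect (\<lambda>w. (?g w)\<^sup>2) = 1"
    using a by (simp add: power_divide)
  have "(partial i ?g w)\<^sup>2 = 1 / a * (partial i f w)\<^sup>2" for i w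
    unfolding partial_scale[OF polyfun_C1[OF n(1)]] using a(2) by (simp add: power_divide)
  then have Gg: "(\<Sum>i<n. (partial i ?g w)\<^sup>2) - p = 1 / a * (gamma_smooth f f w - p * a)" for w
    using a(2) by (simp add: G sum_divide_distrib right_diff_distrib diff_divide_distrib)
  have "c * expect (\<lambda>w. (1 / a * (gamma_smooth f f w - p * a))\<^sup>2) \<le> expect (\<lambda>w. cos (s * ?g w)) - exp (- (s\<^sup>2 / 2))"
    using bound[OF polyfun_scale[OF n(1)] eigen_scale[OF n(2)] g1] unfolding Gg .
  then have "1 / a\<^sup>2 * (c * expect (\<lambda>w. (gamma_smooth f f w - p * a)\<^sup>2)) \<le> expect (\<lambda>w. cos (s / sqrt a * f w)) - exp (- (s\<^sup>2 / 2))"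
    by (simp add: power_mult_distrib power_divide)
  then have "a\<^sup>2 * (1 / a\<^sup>2 * (c * expect (\<lambda>w. (gamma_smooth f f w - p * a)\<^sup>2))) \<le> a\<^sup>2 * (expect (\<lambda>w. cos (s / sqrt a * f w)) - exp (- (s\<^sup>2 / 2)))"
    by (rule mult_left_mono) simp
  then show "c * expect (\<lambda>w. (gamma_smooth f f w - p * a)\<^sup>2) \<le> a\<^sup>2 * (expect (\<lambda>w. cos (s / sqrt a * f w)) - exp (- (s\<^sup>2 / 2)))"
    using a(2) by simp
qed

text \<open>Cosine is 1-Lipschitz, so the difference is controlled by the mean distance of f n from
  F and by the distance of the normalising factor from 1.\<close>

lemma char_tendsto:
  assumes L: "L2_tendsto f F" and a: "a \<longlonglongrightarrow> 1" "\<And>n. 0 < a n"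
  shows "(\<lambda>n. expect (\<lambda>w. cos (s / sqrt (a n) * f n w))) \<longlonglongrightarrow> expect (\<lambda>w. cos (s * F w))"
proof -
  note F = L2_tendstoD[OF L]
  define b where "b n = 1 / sqrt (a n)" for n
  have b: "b \<longlonglongrightarrow> 1 / sqrt 1" unfolding b_def by (intro tendsto_intros a) simp
  let ?R = "\<lambda>n. \<bar>s\<bar> * (\<bar>b n\<bar> * sqrt (expect (\<lambda>w. (f n w - F w)\<^sup>2)) + \<bar>b n - 1\<bar> * expect (\<lambda>w. \<bar>F w\<bar>))"
  have "(\<lambda>n. expect (\<lambda>w. cos (s / sqrt (a n) * f n w)) - expect (\<lambda>w. cos (s * F w))) \<longlonglongrightarrow> 0"
  proof (rule Lim_null_comparison)
    show "\<forall>\<^sub>F n in sequentially. norm (expect (\<lambda>w. cos (s / sqrt (a n) * f n w)) - expect (\<lambda>w. cos (s * F w))) \<le> ?R n"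
    proof (intro always_eventually allI)
      fix n
      have d: "(\<lambda>w. f n w - F w) \<in> square_integrable" using F by (auto intro: square_integrable_diff)
      note i = integrable_abs[OF square_integrable_integrable[OF d]] integrable_abs[OF square_integrable_integrable[OF F(1)]]
      note c = integrable_cos_wiener[OF square_integrableD(1)[OF F(2)], of "s / sqrt (a n)" n] integrable_cos_wiener[OF square_integrableD(1)[OF F(1)], of s]
      have pt: "\<bar>cos (s / sqrt (a n) * f n w) - cos (s * F w)\<bar> \<le> \<bar>s\<bar> * (\<bar>b n\<bar> * \<bar>f n w - F w\<bar> + \<bar>b n - 1\<bar> * \<bar>F w\<bar>)" for w
      proof -
        have "\<bar>cos (s / sqrt (a n) * f n w) - cos (s * F w)\<bar> \<le> \<bar>s / sqrt (a n) * f n w - s * F w\<bar>" by (rule cos_lipschitz)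
        also have "s / sqrt (a n) * f n w - s * F w = s * (b n * (f n w - F w) + (b n - 1) * F w)"
          by (simp add: b_def algebra_simps)
        also have "\<bar>\<dots>\<bar> = \<bar>s\<bar> * \<bar>b n * (f n w - F w) + (b n - 1) * F w\<bar>" by (rule abs_mult)
        also have "\<dots> \<le> \<bar>s\<bar> * (\<bar>b n\<bar> * \<bar>f n w - F w\<bar> + \<bar>b n - 1\<bar> * \<bar>F w\<bar>)"
          unfolding abs_mult[of "b n", symmetric] abs_mult[of "b n - 1", symmetric] by (intro mult_left_mono abs_triangle_ineq) simp
        finally show ?thesis .
      qed
      have "\<bar>expect (\<lambda>w. cos (s / sqrt (a n) * f n w)) - expect (\<lambda>w. cos (s * F w))\<bar> = \<bar>expect (\<lambda>w. cos (s / sqrt (a n) * f n w) - cos (s * F w))\<bar>"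
        using c by simp
      also have "\<dots> \<le> expect (\<lambda>w. \<bar>cos (s / sqrt (a n) * f n w) - cos (s * F w)\<bar>)" by (rule integral_abs_bound)
      also have "\<dots> \<le> expect (\<lambda>w. \<bar>s\<bar> * (\<bar>b n\<bar> * \<bar>f n w - F w\<bar> + \<bar>b n - 1\<bar> * \<bar>F w\<bar>))"
        using c i pt by (intro integral_mono) auto
      also have "\<dots> = \<bar>s\<bar> * (\<bar>b n\<bar> * expect (\<lambda>w. \<bar>f n w - F w\<bar>) + \<bar>b n - 1\<bar> * expect (\<lambda>w. \<bar>F w\<bar>))"
        using i by simp
      also have "\<dots> \<le> ?R n"
        by (intro mult_left_mono add_mono order_refl expect_abs_le[OF d]) auto
      finally show "norm (expect (\<lambda>w. cos (s / sqrt (a n) * f n w)) - expect (\<lambda>w. cos (s * F w))) \<le> ?R n" by simp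
    qed
    have "?R \<longlonglongrightarrow> \<bar>s\<bar> * (\<bar>1 / sqrt 1\<bar> * sqrt 0 + \<bar>1 / sqrt 1 - 1\<bar> * expect (\<lambda>w. \<bar>F w\<bar>))"
      by (intro tendsto_intros b F(3))
    then show "?R \<longlonglongrightarrow> 0" by simp
  qed
  then show ?thesis by (rule LIM_zero_cancel)
qed

text \<open>The gradient squares are known to converge in mean only, so their variance might drop in
  the limit. That is the favourable direction, and Fatou's lemma along an almost surely convergent
  subsequence suffices.\<close>

theorem chaos_char_bound:
  assumes "1 \<le> p"
  shows "\<exists>c>0. \<exists>s. \<forall>F\<in>chaos p. expect (\<lambda>w. (F w)\<^sup>2) = 1 \<longrightarrow>
    c * var (carre_du_champ F F) \<le> expect (\<lambda>w. cos (s * F w)) - exp (- (s\<^sup>2 / 2))"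
proof -
  obtain c s where c: "0 < c" and bound: "\<And>n F. polyfun n p F \<Longrightarrow> eigen n p F \<Longrightarrow> expect (\<lambda>w. (F w)\<^sup>2) = 1 \<Longrightarrow>
    c * expect (\<lambda>w. ((\<Sum>i<n. (partial i F w)\<^sup>2) - p)\<^sup>2) \<le> expect (\<lambda>w. cos (s * F w)) - exp (- (s\<^sup>2 / 2))"
    using polynomial_chaos_bound[OF assms] by blast
  have "c * var (carre_du_champ F F) \<le> expect (\<lambda>w. cos (s * F w)) - exp (- (s\<^sup>2 / 2))"
    if F: "F \<in> chaos p" and F1: "expect (\<lambda>w. (F w)\<^sup>2) = 1" for F
  proof -
    define X where "X = carre_du_champ F F"
    obtain f0 where f0: "\<And>n. poly_chaos p (f0 n)" "L2_tendsto f0 F" using F by (rule chaosE) blast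
    have "(\<lambda>n. expect (\<lambda>w. (f0 n w)\<^sup>2)) \<longlonglongrightarrow> 1" using L2_tendsto_norm[OF f0(2)] F1 by simp
    then have "\<forall>\<^sub>F n in sequentially. 0 < expect (\<lambda>w. (f0 n w)\<^sup>2)" by (rule order_tendstoD) simp
    then obtain M where M: "\<And>n. M \<le> n \<Longrightarrow> 0 < expect (\<lambda>w. (f0 n w)\<^sup>2)" unfolding eventually_sequentially by blast
    \<comment> \<open>The first terms are dropped so that every approximant has positive norm and
      can be normalised.\<close>
    define f where "f n = f0 (n + M)" for n
    have f: "poly_chaos p (f n)" for n unfolding f_def by (rule f0)
    have L: "L2_tendsto f F"
      using f0(2) LIMSEQ_ignore_initial_segment[of _ _ M] unfolding L2_tendsto_def f_def by auto
    define a where "a n = expect (\<lambda>w. (f n w)\<^sup>2)" for n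
    have a_pos: "0 < a n" for n unfolding a_def f_def by (rule M) simp
    have a: "a \<longlonglongrightarrow> 1" unfolding a_def using L2_tendsto_norm[OF L] F1 by simp
    note X = carre_du_champ_chaos[OF F f L, folded X_def]
    have fi: "integrable wiener (gamma_smooth (f n) (f n))" for n
      using poly_chaos_cylinder[OF f] gamma_integrable by blast
    \<comment> \<open>The variance is centred at the mean of the limit; identifying that mean turns
      it into the expected square distance from p, to which Fatou's lemma applies.\<close>
    have EX: "expect X = p"
    proof -
      have "(\<lambda>n. expect X - p * a n) \<longlonglongrightarrow> 0"
      proof (rule Lim_null_comparison[OF _ X(2)])
        show "\<forall>\<^sub>F n in sequentially. norm (expect X - p * a n) \<le> expect (\<lambda>w. \<bar>gamma_smooth (f n) (f n) w - X w\<bar>)"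
        proof (intro always_eventually allI)
          fix n
          have "p * a n - expect X = expect (\<lambda>w. gamma_smooth (f n) (f n) w - X w)"
            using fi X(1) energy_poly_chaos[OF f] by (simp add: a_def)
          then have "\<bar>p * a n - expect X\<bar> \<le> expect (\<lambda>w. \<bar>gamma_smooth (f n) (f n) w - X w\<bar>)"
            by (simp only: integral_abs_bound)
          then show "norm (expect X - p * a n) \<le> expect (\<lambda>w. \<bar>gamma_smooth (f n) (f n) w - X w\<bar>)"
            by (simp add: abs_minus_commute)
        qed
      qed
      moreover have "(\<lambda>n. expect X - p * a n) \<longlonglongrightarrow> expect X - real p * 1" by (intro tendsto_intros a)
      ultimately have "expect X - real p * 1 = 0" using LIMSEQ_unique by blast
      then show ?thesis by simp
    qed
    obtain r where r: "strict_mono r" "AE w in wiener. (\<lambda>n. gamma_smooth (f (r n)) (f (r n)) w - X w) \<longlonglongrightarrow> 0"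
      using tendsto_L1_AE_subseq[OF Bochner_Integration.integrable_diff[OF fi X(1)], unfolded real_norm_def, OF X(2)] by blast
    have ar: "(\<lambda>n. a (r n)) \<longlonglongrightarrow> 1" using LIMSEQ_subseq_LIMSEQ[OF a r(1)] by (simp add: comp_def)
    have cr: "(\<lambda>n. expect (\<lambda>w. cos (s / sqrt (a (r n)) * f (r n) w))) \<longlonglongrightarrow> expect (\<lambda>w. cos (s * F w))"
      using LIMSEQ_subseq_LIMSEQ[OF char_tendsto[OF L a a_pos] r(1)] by (simp add: comp_def)
    let ?d = "\<lambda>n. (a (r n))\<^sup>2 * (expect (\<lambda>w. cos (s / sqrt (a (r n)) * f (r n) w)) - exp (- (s\<^sup>2 / 2))) / c"
    note sb = poly_chaos_scaled_bound[OF bound f a_def a_pos]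
    have "?d \<longlonglongrightarrow> 1\<^sup>2 * (expect (\<lambda>w. cos (s * F w)) - exp (- (s\<^sup>2 / 2))) / c"
      by (intro tendsto_intros ar cr) (use c in auto)
    then have d: "?d \<longlonglongrightarrow> (expect (\<lambda>w. cos (s * F w)) - exp (- (s\<^sup>2 / 2))) / c" by simp
    have le_div: "y \<le> z / c" if "c * y \<le> z" for y z :: real
      using that c by (simp add: pos_le_divide_eq mult.commute)
    have div_le: "c * y \<le> z" if "y \<le> z / c" for y z :: real
      using that c by (simp add: pos_le_divide_eq mult.commute)
    have le: "expect (\<lambda>w. (gamma_smooth (f (r n)) (f (r n)) w - p * a (r n))\<^sup>2) \<le> ?d n" for n
      by (rule le_div[OF sb(2)])
    have ae: "AE w in wiener. (\<lambda>n. (gamma_smooth (f (r n)) (f (r n)) w - p * a (r n))\<^sup>2) \<longlonglongrightarrow> (X w - real p * 1)\<^sup>2"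
      using r(2)
    proof eventually_elim
      case (elim w)
      show ?case
        by (rule tendsto_power[OF tendsto_diff[OF LIM_zero_cancel[OF elim] tendsto_mult[OF tendsto_const ar]]])
    qed
    have m: "(\<lambda>w. (X w - real p * 1)\<^sup>2) \<in> borel_measurable wiener" using X(1) by auto
    have "expect (\<lambda>w. (X w - real p * 1)\<^sup>2) \<le> (expect (\<lambda>w. cos (s * F w)) - exp (- (s\<^sup>2 / 2))) / c"
      by (rule fatou_expect(2)[OF sb(1) zero_le_power2 m ae le d])
    then have "c * expect (\<lambda>w. (X w - real p * 1)\<^sup>2) \<le> expect (\<lambda>w. cos (s * F w)) - exp (- (s\<^sup>2 / 2))"
      by (rule div_le)
    then show ?thesis by (simp only: EX mult_1_right flip: X_def)
  qed
  then show ?thesis using c by blast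
qed

section \<open>Total variation distance to the Edgeworth measure\<close>

lemma pos_part_eqI:
  assumes M: "sets M = sets (borel :: real measure)"
    and eq: "\<And>A. A \<in> sets borel \<Longrightarrow> (SUP B\<in>{B \<in> sets borel. B \<subseteq> A}. ennreal (\<nu> B)) = emeasure M A"
  shows "pos_part \<nu> = M"
proof -
  have sp: "space M = UNIV" using sets_eq_imp_space_eq[OF M] by simp
  have "pos_part \<nu> = measure_of UNIV (sets borel) (emeasure M)"
    unfolding pos_part_def
  proof (rule measure_of_eq)
    fix A :: "real set" assume "A \<in> sigma_sets UNIV (sets borel)"
    then have "A \<in> sets borel" using sets.sigma_sets_eq[of "borel :: real measure"] by simp
    then show "(SUP B\<in>{B \<in> sets borel. B \<subseteq> A}. ennreal (\<nu> B)) = emeasure M A" by (rule eq)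
  qed simp
  also have "\<dots> = M" using measure_of_of_measure[of M] M sp by simp
  finally show ?thesis .
qed

text \<open>For a measure the supremum in the positive part is attained at the set itself, and in
  the negative part every value is truncated to zero by \<open>ennreal\<close>.\<close>

lemma signed_integral_measure:
  assumes "finite_measure M" and M: "sets M = sets (borel :: real measure)"
  shows "signed_integral (measure M) h = integral\<^sup>L M h"
proof -
  interpret finite_measure M by fact
  have 1: "pos_part (measure M) = M"
  proof (rule pos_part_eqI[OF M])
    fix A :: "real set" assume A: "A \<in> sets borel"
    show "(SUP B\<in>{B \<in> sets borel. B \<subseteq> A}. ennreal (measure M B)) = emeasure M A"
    proof (rule antisym)
      show "(SUP B\<in>{B \<in> sets borel. B \<subseteq> A}. ennreal (measure M B)) \<le> emeasure M A"
        using A M by (intro SUP_least) (auto simp: emeasure_eq_measure[symmetric] intro: emeasure_mono)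
      show "emeasure M A \<le> (SUP B\<in>{B \<in> sets borel. B \<subseteq> A}. ennreal (measure M B))"
        unfolding emeasure_eq_measure by (rule SUP_upper) (use A in simp)
    qed
  qed
  have 2: "pos_part (\<lambda>A. - measure M A) = null_measure M"
  proof (rule pos_part_eqI)
    show "sets (null_measure M) = sets borel" using M by simp
    fix A :: "real set"
    show "(SUP B\<in>{B \<in> sets borel. B \<subseteq> A}. ennreal (- measure M B)) = emeasure (null_measure M) A"
    proof -
      have "{} \<in> {B \<in> sets borel. B \<subseteq> A}" by simp
      then have "{B \<in> sets borel. B \<subseteq> A} \<noteq> {}" by blast
      then show ?thesis by (simp add: ennreal_neg)
    qed
  qed
  \<comment> \<open>For non-measurable \<open>h\<close> the integral takes its default value 0, so
    the claim needs a case distinction.\<close>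
  have "integral\<^sup>L (null_measure M) h = integral\<^sup>L (null_measure M) (\<lambda>_. 0)"
  proof (cases "h \<in> borel_measurable M")
    case True
    have "AE x in null_measure M. h x = 0" by (rule AE_I[of _ _ "space M"]) auto
    then show ?thesis using True by (intro integral_cong_AE) (auto simp: measurable_def)
  next
    case False
    then have "\<not> integrable (null_measure M) h" by (auto simp: integrable_iff_bounded measurable_def)
    then show ?thesis by (simp add: not_integrable_integral_eq)
  qed
  then show ?thesis unfolding signed_integral_def 1 2 by simp
qed

text \<open>A Hahn decomposition: the supremum over subsets of A is attained on the part of A where
  the density is positive.\<close>

lemma pos_part_density:
  assumes g: "integrable lborel g"
  shows "pos_part (\<lambda>A. LINT x:A|lborel. g x) = density lborel (\<lambda>x. ennreal (g x))"
proof (rule pos_part_eqI)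
  note [measurable] = borel_measurable_integrable[OF g]
  fix A :: "real set" assume A: "A \<in> sets borel"
  have si: "set_integrable lborel B g" if "B \<in> sets borel" for B
    unfolding set_integrable_def using g that by (intro integrable_mult_indicator) auto
  show "(SUP B\<in>{B \<in> sets borel. B \<subseteq> A}. ennreal (LINT x:B|lborel. g x)) = emeasure (density lborel (\<lambda>x. ennreal (g x))) A"
  proof (rule antisym)
    show "(SUP B\<in>{B \<in> sets borel. B \<subseteq> A}. ennreal (LINT x:B|lborel. g x)) \<le> emeasure (density lborel (\<lambda>x. ennreal (g x))) A"
    proof (rule SUP_least)
      fix B assume "B \<in> {B \<in> sets borel. B \<subseteq> A}"
      then have B: "B \<in> sets borel" "B \<subseteq> A" by auto
      have gp: "integrable lborel (\<lambda>x. indicator B x * max 0 (g x))"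
        using integrable_mult_indicator[of B lborel "\<lambda>x. max 0 (g x)"] g B by simp
      have "(LINT x:B|lborel. g x) \<le> (\<integral>x. indicator B x * max 0 (g x) \<partial>lborel)"
        unfolding set_lebesgue_integral_def using si[OF B(1)] gp
        by (intro integral_mono) (auto simp: set_integrable_def indicator_def)
      then have "ennreal (LINT x:B|lborel. g x) \<le> ennreal (\<integral>x. indicator B x * max 0 (g x) \<partial>lborel)" by (rule ennreal_leI)
      also have "\<dots> = (\<integral>\<^sup>+x. ennreal (indicator B x * max 0 (g x)) \<partial>lborel)"
        by (rule nn_integral_eq_integral[symmetric, OF gp]) (auto simp: indicator_def)
      also have "\<dots> \<le> (\<integral>\<^sup>+x. ennreal (g x) * indicator A x \<partial>lborel)"
        using B(2) by (intro nn_integral_mono) (auto simp: indicator_def max_def ennreal_neg)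
      also have "\<dots> = emeasure (density lborel (\<lambda>x. ennreal (g x))) A" using A by (simp add: emeasure_density)
      finally show "ennreal (LINT x:B|lborel. g x) \<le> emeasure (density lborel (\<lambda>x. ennreal (g x))) A" .
    qed
    define B where "B = A \<inter> {x. 0 < g x}"
    have B: "B \<in> sets borel" "B \<subseteq> A" using A unfolding B_def by auto
    have "emeasure (density lborel (\<lambda>x. ennreal (g x))) A = (\<integral>\<^sup>+x. ennreal (g x) * indicator A x \<partial>lborel)"
      using A by (simp add: emeasure_density)
    also have "\<dots> = (\<integral>\<^sup>+x. ennreal (indicator B x * g x) \<partial>lborel)"
      by (intro nn_integral_cong) (auto simp: B_def indicator_def ennreal_neg)
    also have "\<dots> = ennreal (LINT x:B|lborel. g x)"
      unfolding set_lebesgue_integral_def using si[OF B(1)]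
      by (subst nn_integral_eq_integral) (auto simp: set_integrable_def B_def indicator_def)
    finally show "emeasure (density lborel (\<lambda>x. ennreal (g x))) A \<le> (SUP B\<in>{B \<in> sets borel. B \<subseteq> A}. ennreal (LINT x:B|lborel. g x))"
      using B by (auto intro: SUP_upper)
  qed
qed simp

lemma signed_integral_density:
  assumes g: "integrable lborel g" and h: "h \<in> borel_measurable borel" "\<And>x. \<bar>h x\<bar> \<le> 1"
  shows "signed_integral (\<lambda>A. LINT x:A|lborel. g x) h = (\<integral>x. h x * g x \<partial>lborel)"
    and "integrable lborel (\<lambda>x. h x * g x)"
proof -
  note [measurable] = borel_measurable_integrable[OF g] h(1)
  have int: "integrable lborel (\<lambda>x. h x * u x)" if u: "integrable lborel u" for u
  proof -
    have m: "(\<lambda>x. h x * u x) \<in> borel_measurable lborel"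
      using borel_measurable_times[of h lborel u] h(1) borel_measurable_integrable[OF u] by simp
    show ?thesis
    proof (rule Bochner_Integration.integrable_bound[OF u])
    show "AE x in lborel. norm (h x * u x) \<le> norm (u x)"
      using h(2) by (intro AE_I2) (simp add: abs_mult mult_left_le_one_le)
    qed (rule m)
  qed
  show "integrable lborel (\<lambda>x. h x * g x)" by (rule int[OF g])
  have d: "integral\<^sup>L (density lborel (\<lambda>x. ennreal (u x))) h = (\<integral>x. h x * max 0 (u x) \<partial>lborel)"
    if "integrable lborel u" for u
  proof -
    note [measurable] = borel_measurable_integrable[OF that]
    have "density lborel (\<lambda>x. ennreal (u x)) = density lborel (\<lambda>x. ennreal (max 0 (u x)))"
      by (intro density_cong) (auto simp: max_def ennreal_neg)
    then have "integral\<^sup>L (density lborel (\<lambda>x. ennreal (u x))) h = (\<integral>x. max 0 (u x) *\<^sub>R h x \<partial>lborel)"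
      using h(1) by (simp only:) (intro integral_density; simp)
    then show ?thesis by (simp add: mult.commute)
  qed
  have "(\<lambda>A. - (LINT x:A|lborel. g x)) = (\<lambda>A. LINT x:A|lborel. - g x)"
    by (simp add: set_lebesgue_integral_def)
  then have "signed_integral (\<lambda>A. LINT x:A|lborel. g x) h = (\<integral>x. h x * max 0 (g x) \<partial>lborel) - (\<integral>x. h x * max 0 (- g x) \<partial>lborel)"
    unfolding signed_integral_def using g by (simp add: pos_part_density d)
  also have "\<dots> = (\<integral>x. h x * max 0 (g x) - h x * max 0 (- g x) \<partial>lborel)"
    using g by (intro Bochner_Integration.integral_diff[symmetric] int) auto
  also have "\<dots> = (\<integral>x. h x * g x \<partial>lborel)"
    by (intro Bochner_Integration.integral_cong) (auto simp: max_def)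
  finally show "signed_integral (\<lambda>A. LINT x:A|lborel. g x) h = (\<integral>x. h x * g x \<partial>lborel)" .
qed

section \<open>The Edgeworth measure and the total variation distance\<close>

lemma hermite_3: "hermite 3 x = x ^ 3 - 3 * x"
  unfolding hermite_eq_poly by (simp add: numeral_3_eq_3 pderiv_pCons pderiv_1 algebra_simps one_pCons)

lemma integral_cos_std_normal:
  "integrable lborel (\<lambda>x. cos (s * x) * std_normal_density x)"
  "(\<integral>x. cos (s * x) * std_normal_density x \<partial>lborel) = exp (- (s\<^sup>2 / 2))"
proof -
  have c: "(\<lambda>x. cos (s * x)) \<in> borel_measurable borel"
    by (intro borel_measurable_continuous_onI continuous_intros)
  have i: "integrable lborel std_normal_density" by simp
  show i1: "integrable lborel (\<lambda>x. cos (s * x) * std_normal_density x)"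
    by (rule signed_integral_density(2)[OF i c]) simp
  have "Re (char std_normal_distribution s) = exp (- (s\<^sup>2 / 2))"
    by (simp add: char_std_normal_distribution)
  moreover have "Re (char std_normal_distribution s) = (\<integral>x. cos (s * x) \<partial>std_normal_distribution)"
  proof -
    interpret real_distribution std_normal_distribution by (rule real_dist_normal_dist)
    have "integrable std_normal_distribution (\<lambda>x. iexp (s * x))" by (rule integrable_iexp) auto
    then show ?thesis unfolding char_def by (subst integral_Re[symmetric]) (auto simp: Re_exp)
  qed
  moreover have "(\<integral>x. cos (s * x) \<partial>std_normal_distribution) = (\<integral>x. cos (s * x) * std_normal_density x \<partial>lborel)"
    by (subst integral_density) (auto simp: mult.commute)
  ultimately show "(\<integral>x. cos (s * x) * std_normal_density x \<partial>lborel) = exp (- (s\<^sup>2 / 2))" by simp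
qed

definition edgeworth_density :: "real \<Rightarrow> real \<Rightarrow> real" where
  "edgeworth_density k x = exp (- x\<^sup>2 / 2) / sqrt (2 * pi) * (1 + k * hermite 3 x)"

lemma edgeworth_density_eq:
  "edgeworth_density k x = std_normal_density x + k * (std_normal_density x * (x ^ 3 - 3 * x))"
proof -
  have "exp (- x\<^sup>2 / 2) / sqrt (2 * pi) = std_normal_density x" by (simp add: std_normal_density_def)
  then show ?thesis unfolding edgeworth_density_def hermite_3 by (simp add: distrib_left)
qed

lemma integrable_cubic: "integrable lborel (\<lambda>x. std_normal_density x * (x ^ 3 - 3 * x))"
  using integrable_std_normal_moment[of 3] integrable_std_normal_moment[of 1]
  by (simp add: right_diff_distrib mult.left_commute)

lemma integrable_edgeworth_density: "integrable lborel (edgeworth_density k)"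
  unfolding edgeworth_density_eq[abs_def] using integrable_cubic by simp

lemma integral_cos_edgeworth: "(\<integral>x. cos (s * x) * edgeworth_density k x \<partial>lborel) = exp (- (s\<^sup>2 / 2))"
proof -
  let ?o = "\<lambda>x. cos (s * x) * (std_normal_density x * (x ^ 3 - 3 * x))"
  have c: "(\<lambda>x. cos (s * x)) \<in> borel_measurable borel"
    by (intro borel_measurable_continuous_onI continuous_intros)
  have o: "integrable lborel ?o" by (rule signed_integral_density(2)[OF integrable_cubic c]) simp
  \<comment> \<open>Reflection at the origin: the cubic correction is odd and the cosine even, so
    the integral equals its own negative whatever the third moment is.\<close>
  have "integral\<^sup>L lborel ?o = \<bar>- 1\<bar> *\<^sub>R (\<integral>x. ?o (0 + (- 1) * x) \<partial>lborel)"
    by (rule lborel_integral_real_affine) simp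
  also have "\<dots> = (\<integral>x. - ?o x \<partial>lborel)"
  proof -
    have even: "std_normal_density (- x) = std_normal_density x" for x by (simp add: std_normal_density_def)
    have odd: "(- x) ^ 3 - 3 * (- x) = - (x ^ 3 - 3 * x)" for x :: real by simp
    have "?o (0 + (- 1) * x) = - ?o x" for x
      using even[of x] odd[of x] by (simp only: add_0 mult_minus1 mult_minus_right cos_minus)
    then show ?thesis by (simp only: abs_minus_cancel abs_one scaleR_one)
  qed
  finally have z: "integral\<^sup>L lborel ?o = 0" by simp
  have "cos (s * x) * edgeworth_density k x = cos (s * x) * std_normal_density x + k * ?o x" for x
    by (simp add: edgeworth_density_eq algebra_simps)
  then have "(\<integral>x. cos (s * x) * edgeworth_density k x \<partial>lborel) = (\<integral>x. cos (s * x) * std_normal_density x \<partial>lborel) + k * integral\<^sup>L lborel ?o"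
    using integral_cos_std_normal(1) o by simp
  then show ?thesis by (simp add: z integral_cos_std_normal(2))
qed

text \<open>The cosine is an admissible test function, and its two integrals are the characteristic
  function of F and that of the standard normal law.\<close>

lemma d_TV_lower_bound:
  assumes F: "F \<in> borel_measurable wiener"
  shows "\<bar>expect (\<lambda>w. cos (s * F w)) - exp (- (s\<^sup>2 / 2))\<bar> / 2 \<le> d_TV (law F) (edgeworth F)"
proof -
  define k where "k = expect (\<lambda>w. hermite 3 (F w)) / fact 3"
  have e: "edgeworth F = (\<lambda>A. LINT x:A|lborel. edgeworth_density k x)"
    by (simp add: edgeworth_def[abs_def] edgeworth_density_def k_def)
  let ?H = "{h. continuous_on UNIV h \<and> (\<forall>x. \<bar>h x\<bar> \<le> (1 :: real))}"
  let ?D = "\<lambda>h. \<bar>signed_integral (law F) h - signed_integral (edgeworth F) h\<bar>"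
  have law: "signed_integral (law F) h = expect (\<lambda>w. h (F w))" if "h \<in> borel_measurable borel" for h
  proof -
    have "finite_measure (distr wiener borel F)"
      using wiener.prob_space_distr[OF F] by (rule prob_space.finite_measure)
    then have "signed_integral (law F) h = integral\<^sup>L (distr wiener borel F) h"
      unfolding law_def[abs_def] by (rule signed_integral_measure) simp
    also have "\<dots> = expect (\<lambda>w. h (F w))" by (rule integral_distr[OF F that])
    finally show ?thesis .
  qed
  have edge: "signed_integral (edgeworth F) h = (\<integral>x. h x * edgeworth_density k x \<partial>lborel)"
    "integrable lborel (\<lambda>x. h x * edgeworth_density k x)" if "h \<in> borel_measurable borel" "\<And>x. \<bar>h x\<bar> \<le> 1" for h
    using signed_integral_density[OF integrable_edgeworth_density that] unfolding e by auto
  \<comment> \<open>A real supremum bounds its members only for sets bounded above; here the bound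
    is 1 plus the total mass of the absolute density.\<close>
  have bdd: "bdd_above (?D ` ?H)"
  proof (rule bdd_aboveI2)
    fix h :: "real \<Rightarrow> real" assume "h \<in> ?H"
    then have h: "h \<in> borel_measurable borel" "\<And>x. \<bar>h x\<bar> \<le> 1" by (auto intro: borel_measurable_continuous_onI)
    have "(\<lambda>w. h (F w)) \<in> borel_measurable wiener" using measurable_compose[OF F h(1)] .
    then have hi: "integrable wiener (\<lambda>w. h (F w))"
      by (intro wiener.integrable_const_bound[where B = 1]) (auto simp: h(2))
    have "\<bar>expect (\<lambda>w. h (F w))\<bar> \<le> expect (\<lambda>w. \<bar>h (F w)\<bar>)" by (rule integral_abs_bound)
    also have "\<dots> \<le> expect (\<lambda>w. 1)" using hi h(2) by (intro integral_mono) auto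
    finally have 1: "\<bar>expect (\<lambda>w. h (F w))\<bar> \<le> 1" by simp
    have "\<bar>\<integral>x. h x * edgeworth_density k x \<partial>lborel\<bar> \<le> (\<integral>x. \<bar>h x * edgeworth_density k x\<bar> \<partial>lborel)"
      by (rule integral_abs_bound)
    also have "\<dots> \<le> (\<integral>x. \<bar>edgeworth_density k x\<bar> \<partial>lborel)"
      using integrable_abs[OF edge(2)[OF h]] integrable_edgeworth_density[of k] h(2)
      by (intro integral_mono) (auto simp: abs_mult mult_left_le_one_le)
    finally show "?D h \<le> 1 + (\<integral>x. \<bar>edgeworth_density k x\<bar> \<partial>lborel)"
      unfolding law[OF h(1)] edge(1)[OF h] using 1 by linarith
  qed
  have c: "(\<lambda>x. cos (s * x)) \<in> borel_measurable borel" "\<And>x. \<bar>cos (s * x)\<bar> \<le> 1"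
    by (intro borel_measurable_continuous_onI continuous_intros) (rule abs_cos_le_one)
  have "?D (\<lambda>x. cos (s * x)) \<le> (SUP h\<in>?H. ?D h)"
    by (rule cSUP_upper[OF _ bdd]) (auto intro!: continuous_intros)
  then show ?thesis
    unfolding d_TV_def law[OF c(1)] edge(1)[OF c] integral_cos_edgeworth by simp
qed

theorem proposition1p3:
  fixes p :: nat
  assumes "p \<ge> 1"
  shows "\<exists>c>0. \<forall>F\<in>chaos p. expect (\<lambda>w. (F w)\<^sup>2) = 1 \<longrightarrow>
           c * var (carre_du_champ F F) \<le> d_TV (law F) (edgeworth F)"
proof -
  obtain c s where c: "0 < c" and bound: "\<And>F. F \<in> chaos p \<Longrightarrow> expect (\<lambda>w. (F w)\<^sup>2) = 1 \<Longrightarrow>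
    c * var (carre_du_champ F F) \<le> expect (\<lambda>w. cos (s * F w)) - exp (- (s\<^sup>2 / 2))"
    using chaos_char_bound[OF assms] by blast
  \<comment> \<open>The factor 1 / 2 is the one in the definition of the total variation
    distance.\<close>
  have "c / 2 * var (carre_du_champ F F) \<le> d_TV (law F) (edgeworth F)"
    if "F \<in> chaos p" "expect (\<lambda>w. (F w)\<^sup>2) = 1" for F
  proof -
    let ?x = "expect (\<lambda>w. cos (s * F w)) - exp (- (s\<^sup>2 / 2))"
    have "c / 2 * var (carre_du_champ F F) = (c * var (carre_du_champ F F)) / 2" by simp
    also have "\<dots> \<le> \<bar>?x\<bar> / 2" using bound[OF that] by (intro divide_right_mono) auto
    also have "\<dots> \<le> d_TV (law F) (edgeworth F)"
      by (rule d_TV_lower_bound[OF square_integrableD(1)[OF chaos_square_integrable[OF that(1)]]])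
    finally show ?thesis .
  qed
  then show ?thesis using c by (intro exI[of _ "c / 2"]) auto
qed

end
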